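(* Let $H=-I_1+I_2+\eta I_3^2+F$ with $\eta\ne0$ be as in the context. Given a formal separatrix $\hat{\mathbf{\Gamma}}$ of $H$, there exist $r_->0$ and a unique analytic function $\mathbf{\Gamma}^-:\mathbb{T}_h\times D^-_{r_-}\to\mathbb{C}^4$ solving $$\mathcal{D}\mathbf{\Gamma}^-=X_H(\mathbf{\Gamma}^-),\qquad \mathcal{D}=\partial_\varphi+\partial_\tau,$$ such that $\mathbf{\Gamma}^-(\varphi,\tau)\sim\hat{\mathbf{\Gamma}}(\varphi,\tau)$ as $\tau\to\infty$ in $D^-_{r_-}$.
   Context: Coordinates on $\mathbb{C}^4$ are $(\mathbf q,\mathbf p)=(q_1,q_2,p_1,p_2)$; $X_H=(\partial H/\partial\mathbf p,-\partial H/\partial\mathbf q)$. Set $I_1=q_2p_1-q_1p_2$, $I_2=\frac12(q_1^2+q_2^2)$, $I_3=\frac12(p_1^2+p_2^2)$. The (weighted) order of a monomial is computed by giving each $q_i$ order $2$ and each $p_i$ order $1$. Standing assumption: $H=-I_1+I_2+\eta I_3^2+F$, where $\eta\in\mathbb{C}\setminus\{0\}$ and $F$ is a bounded analytic complex-valued function on an open neighbourhood of the origin in $\mathbb{C}^4$ containing only monomials of weighted order $\geq5$. $\mathsf{T}$ is the space of trigonometric polynomials in $\varphi$ with complex coefficients. A formal separatrix is a non-zero formal solution $\hat{\mathbf\Gamma}=(\tau^{-2}\hat\Gamma_1,\tau^{-2}\hat\Gamma_2,\tau^{-1}\hat\Gamma_3,\tau^{-1}\hat\Gamma_4)^T$,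 $\hat\Gamma_i\in\mathsf{T}[[\tau^{-1}]]$, of $\mathcal{D}\hat{\mathbf\Gamma}=X_H(\hat{\mathbf\Gamma})$. Fixed parameters: $h>0$, $0<\theta<\pi/4$. $\mathbb{T}_h=\{\varphi\in\mathbb{C}/2\pi\mathbb{Z}:|\mathrm{Im}\,\varphi|<h\}$; $D_r^-=\{\tau\in\mathbb{C}:|\arg(\tau+r)|>\theta\}$ for $r>0$. Asymptotic expansion: for a function $f$ on $\mathbb{T}_h\times X$, $f(\varphi,\tau)\sim\sum_n c_n(\varphi)\tau^{-n}$ as $\tau\to\infty$ in $X$ means that for every $N$, $f-\sum_{n\le N}c_n(\varphi)\tau^{-n}=O(\tau^{-N-1})$ as $\tau\to\infty$ in $X$, uniformly in $\varphi\in\mathbb{T}_h$ (componentwise for vector-valued $f$). *)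

theory Defs
  imports "HOL-Analysis.Analysis"
begin

definition has_power_series_at ::
  "(complex^'n \<Rightarrow> complex) \<Rightarrow> complex^'n \<Rightarrow> (nat^'n \<Rightarrow> complex) \<Rightarrow> bool" where
  "has_power_series_at f z c \<longleftrightarrow>
     (\<exists>\<rho>>0. \<forall>w. (\<forall>i. norm (w $ i - z $ i) < \<rho>) \<longrightarrow>
        ((\<lambda>\<alpha>. c \<alpha> * (\<Prod>i\<in>UNIV. (w $ i - z $ i) ^ (\<alpha> $ i))) has_sum f w) UNIV)"

definition analytic_several :: "(complex^'n \<Rightarrow> complex) \<Rightarrow> (complex^'n) set \<Rightarrow> bool" where
  "analytic_several f S \<longleftrightarrow> (\<forall>z\<in>S. \<exists>c. has_power_series_at f z c)"

(* Only meaningful where f is analytic; the expansion is then unique. *)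
definition taylor_coeff :: "(complex^'n \<Rightarrow> complex) \<Rightarrow> complex^'n \<Rightarrow> nat^'n \<Rightarrow> complex" where
  "taylor_coeff f z = (THE c. has_power_series_at f z c)"

definition partial_deriv :: "'n \<Rightarrow> (complex^'n \<Rightarrow> complex) \<Rightarrow> complex^'n \<Rightarrow> complex" where
  "partial_deriv i f z = deriv (\<lambda>w. f (\<chi> j. if j = i then w else z $ j)) (z $ i)"

(* Coordinates: z$1 = q1, z$2 = q2, z$3 = p1, z$4 = p2. *)

definition I1 :: "complex^4 \<Rightarrow> complex" where
  "I1 z = z$2 * z$3 - z$1 * z$4"

definition I2 :: "complex^4 \<Rightarrow> complex" where
  "I2 z = ((z$1)^2 + (z$2)^2) / 2"

definition I3 :: "complex^4 \<Rightarrow> complex" where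
  "I3 z = ((z$3)^2 + (z$4)^2) / 2"

definition hamiltonian :: "complex \<Rightarrow> (complex^4 \<Rightarrow> complex) \<Rightarrow> complex^4 \<Rightarrow> complex" where
  "hamiltonian \<eta> F z = - I1 z + I2 z + \<eta> * (I3 z)^2 + F z"

definition ham_field :: "(complex^4 \<Rightarrow> complex) \<Rightarrow> complex^4 \<Rightarrow> complex^4" where
  "ham_field H z = vector [partial_deriv 3 H z, partial_deriv 4 H z,
                           - partial_deriv 1 H z, - partial_deriv 2 H z]"

(* q has weight 2 and p weight 1; the same exponents give the prefactors of a formal separatrix. *)
definition weight :: "4 \<Rightarrow> nat" where
  "weight i = (if i = 1 \<or> i = 2 then 2 else 1)"

definition weighted_order :: "nat^4 \<Rightarrow> nat" where
  "weighted_order \<alpha> = (\<Sum>i\<in>UNIV. weight i * \<alpha> $ i)"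

definition trig_poly :: "(complex \<Rightarrow> complex) \<Rightarrow> bool" where
  "trig_poly f \<longleftrightarrow>
     (\<exists>(K::nat) (a :: int \<Rightarrow> complex).
        \<forall>\<phi>. f \<phi> = (\<Sum>k\<in>{- int K..int K}. a k * exp (\<i> * of_int k * \<phi>)))"

(* A power series in 1/tau whose coefficients are functions of phi is encoded as a function from phi
   to series over the complex numbers; the indeterminate fps_X stands for 1/tau. *)

definition trig_series :: "(complex \<Rightarrow> complex fps) \<Rightarrow> bool" where
  "trig_series g \<longleftrightarrow> (\<forall>n. trig_poly (\<lambda>\<phi>. fps_nth (g \<phi>) n))"

(* With X = 1/tau, the derivation d/dtau is -X^2 d/dX. *)
definition formal_D :: "(complex \<Rightarrow> complex fps) \<Rightarrow> complex \<Rightarrow> complex fps" where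
  "formal_D g \<phi> =
     Abs_fps (\<lambda>n. deriv (\<lambda>\<psi>. fps_nth (g \<psi>) n) \<phi>) - fps_X^2 * fps_deriv (g \<phi>)"

(* Substitution of G into the power series with coefficients c. When the components of G have no
   constant term, multi-indices of total degree > n do not contribute to the n-th coefficient, so
   the truncation below is exact. *)
definition formal_subst :: "(nat^'n \<Rightarrow> complex) \<Rightarrow> (complex fps)^'n \<Rightarrow> complex fps" where
  "formal_subst c G =
     Abs_fps (\<lambda>n. \<Sum>\<alpha> | (\<Sum>i\<in>UNIV. \<alpha> $ i) \<le> n.
                     c \<alpha> * fps_nth (\<Prod>i\<in>UNIV. (G $ i) ^ (\<alpha> $ i)) n)"

definition formal_separatrix ::
  "(complex^4 \<Rightarrow> complex) \<Rightarrow> (complex \<Rightarrow> (complex fps)^4) \<Rightarrow> bool" where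
  "formal_separatrix H G \<longleftrightarrow>
     (\<exists>g :: complex \<Rightarrow> (complex fps)^4.
        (\<forall>i. trig_series (\<lambda>\<phi>. g \<phi> $ i)) \<and>
        (\<forall>\<phi> i. G \<phi> $ i = fps_X ^ weight i * g \<phi> $ i)) \<and>
     (\<exists>\<phi>. G \<phi> \<noteq> 0) \<and>
     (\<forall>\<phi> i. formal_D (\<lambda>\<psi>. G \<psi> $ i) \<phi> =
             formal_subst (taylor_coeff (\<lambda>z. ham_field H z $ i) 0) (G \<phi>))"

(* A function on T_h is a 2 pi-periodic function on this strip. *)
definition strip :: "real \<Rightarrow> complex set" where
  "strip h = {\<phi>. \<bar>Im \<phi>\<bar> < h}"

(* Arg 0 = 0, so the vertex -r is excluded. *)
definition D_minus :: "real \<Rightarrow> real \<Rightarrow> complex set" where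
  "D_minus \<theta> r = {\<tau>. \<bar>Arg (\<tau> + of_real r)\<bar> > \<theta>}"

definition asymp_expansion ::
  "real \<Rightarrow> complex set \<Rightarrow> (complex \<Rightarrow> complex \<Rightarrow> complex) \<Rightarrow> (complex \<Rightarrow> complex fps) \<Rightarrow> bool" where
  "asymp_expansion h X f g \<longleftrightarrow>
     (\<forall>N. \<exists>C R. \<forall>\<phi>\<in>strip h. \<forall>\<tau>\<in>X. norm \<tau> \<ge> R \<longrightarrow>
        norm (f \<phi> \<tau> - (\<Sum>n\<le>N. fps_nth (g \<phi>) n / \<tau> ^ n)) \<le> C / norm \<tau> ^ (N + 1))"

(* H is only given on U, so that taking values in U is part of solving D Gamma = X_H(Gamma). *)
definition analytic_solution ::
  "real \<Rightarrow> complex set \<Rightarrow> (complex^4) set \<Rightarrow> (complex^4 \<Rightarrow> complex) \<Rightarrow>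
   (complex \<Rightarrow> complex \<Rightarrow> complex^4) \<Rightarrow> bool" where
  "analytic_solution h X U H \<Gamma> \<longleftrightarrow>
     (\<forall>\<phi>\<in>strip h. \<forall>\<tau>\<in>X. \<Gamma> (\<phi> + 2 * of_real pi) \<tau> = \<Gamma> \<phi> \<tau>) \<and>
     (\<forall>i. analytic_several (\<lambda>x::complex^2. \<Gamma> (x$1) (x$2) $ i) {x. x$1 \<in> strip h \<and> x$2 \<in> X}) \<and>
     (\<forall>\<phi>\<in>strip h. \<forall>\<tau>\<in>X. \<Gamma> \<phi> \<tau> \<in> U) \<and>
     (\<forall>\<phi>\<in>strip h. \<forall>\<tau>\<in>X. \<forall>i.
        deriv (\<lambda>\<psi>. \<Gamma> \<psi> \<tau> $ i) \<phi> + deriv (\<lambda>\<sigma>. \<Gamma> \<phi> \<sigma> $ i) \<tau> = ham_field H (\<Gamma> \<phi> \<tau>) $ i)"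

end

theory Submission
  imports Defs "HOL-Complex_Analysis.Conformal_Mappings"
begin

text \<open>
  Write D = \<partial>_\<phi> + \<partial>_\<tau> and split the Hamiltonian field near the origin as X_H(z) = J z + g(z).
  Here J is the rotation generated by -I_1, and g comes from I_2 + \<eta> I_3^2 + F, all of whose
  monomials have weighted order at least 4. In terms of the weights w_i of the coordinates, g_i has
  weighted order at least w_i + 1, one more than (J z)_i.

  Let k = cot \<theta>. The domain D_r^- is exactly the set where k |Im \<tau>| - Re \<tau> > r. Measure the size of
  \<tau> there by a(\<tau>) = 2 k |Im \<tau>| - Re \<tau>, which is comparable to |\<tau>| and satisfies
  a(\<tau> - s) = a(\<tau>) + s along the half-lines \<tau> - s, s \<ge> 0; these stay in the domain. Hence D is
  inverted by integrating u(\<phi> - s, \<tau> - s) over s \<ge> 0, and this inverse turns a bound K a^(-m-1)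
  into (K/m) a^(-m) (lemmas \<open>char_integrable\<close>, \<open>char_integral_properties\<close>, \<open>transport_decay\<close>). The
  factor 1/m is what makes the problem a contraction.

  Let P be the truncation of the formal separatrix at order M + 3 and look for a solution
  P + e^(\<phi> J) \<delta> with \<delta>_i = O(a^(-M-w_i)). The rotating frame removes J, so that \<delta> has to solve
  D \<delta> = e^(-\<phi> J) (g(P + e^(\<phi> J) \<delta>) + J P - D P). The weights of g give a Lipschitz bound that gains
  exactly one power of 1/a (\<open>weighted_lipschitz_exists\<close>), with a constant that does not depend on M.
  After integration the Lipschitz constant is O(1/M). For large M there is therefore a fixed point
  (\<open>solution_exists\<close>), and two solutions that agree to order M coincide (\<open>solution_unique\<close>). The
  residual of P is small because Taylor expansion commutes with formal substitution
  (\<open>formal_subst_expansion\<close>, \<open>truncation_residual\<close>).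

  One admissible order M_0 yields \<Gamma>^- on D_r^-. For larger M the same construction works far out; by
  uniqueness it returns \<Gamma>^-, which therefore has the full expansion (\<open>near_imp_asymptotic\<close>). A competing
  solution agrees with \<Gamma>^- far out and then on all of D_r^- by the identity theorem in \<tau>.

  Analyticity in two variables is handled through separately holomorphic functions; Osgood's lemma
  turns them into power series (\<open>analytic_several_osgood\<close>).
\<close>

section \<open>Cauchy estimates and integrals depending on a parameter\<close>

lemma has_field_derivative_quadratic:
  fixes f :: "complex \<Rightarrow> complex"
  assumes "e > 0" and bd: "\<And>t. norm t < e \<Longrightarrow> norm (f (z + t) - f z - t * D) \<le> C * norm t ^ 2"
  shows "(f has_field_derivative D) (at z)"
proof -
  have "((\<lambda>t. (f (z + t) - f z) / t - D) \<longlongrightarrow> 0) (at 0)"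
  proof (rule Lim_null_comparison)
    show "\<forall>\<^sub>F t in at 0. norm ((f (z + t) - f z) / t - D) \<le> C * norm t"
    proof (rule eventually_at_ball'[OF \<open>e > 0\<close>, of 0 UNIV, THEN eventually_mono])
      fix t :: complex assume t: "t \<in> ball 0 e \<and> t \<noteq> 0 \<and> t \<in> UNIV"
      have "(f (z + t) - f z) / t - D = (f (z + t) - f z - t * D) / t"
        using t by (simp add: field_simps)
      then have "norm ((f (z + t) - f z) / t - D) = norm (f (z + t) - f z - t * D) / norm t"
        by (simp add: norm_divide)
      also have "\<dots> \<le> C * norm t ^ 2 / norm t"
        using t bd[of t] by (intro divide_right_mono) auto
      also have "\<dots> = C * norm t" by (simp add: power2_eq_square)
      finally show "norm ((f (z + t) - f z) / t - D) \<le> C * norm t" .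
    qed
    show "((\<lambda>t. C * norm t) \<longlongrightarrow> 0) (at (0::complex))"
      by (auto intro!: tendsto_eq_intros)
  qed
  then have "((\<lambda>t. (f (z + t) - f z) / t) \<longlongrightarrow> D) (at 0)"
    using Lim_null by blast
  then show ?thesis by (simp add: DERIV_def)
qed

text \<open>Cauchy's inequality on the circle of radius r/2: the bound on f is known on the open disc only.\<close>

lemma deriv_bound_ball:
  assumes "f holomorphic_on ball z r" "r > 0" "\<And>w. w \<in> ball z r \<Longrightarrow> norm (f w) \<le> b"
  shows "norm ((deriv ^^ n) f z) \<le> fact n * b / (r / 2) ^ n"
proof (rule Cauchy_inequality)
  have s: "cball z (r / 2) \<subseteq> ball z r" using assms(2) by auto
  show "f holomorphic_on ball z (r / 2)"
    using assms(1) by (rule holomorphic_on_subset) (use assms(2) in auto)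
  show "continuous_on (cball z (r / 2)) f"
    using holomorphic_on_imp_continuous_on[OF assms(1)] s continuous_on_subset by blast
  show "norm (f x) \<le> b" if "norm (z - x) = r / 2" for x
    using assms(3)[of x] s that assms(2) by (auto simp: dist_norm)
qed (use assms in auto)

text \<open>The constant is 2! b/(r/4)^2=32b/r^2, the bound for f'' on the disc of radius r/2 by
  \<open>deriv_bound_ball\<close> on discs of radius r/2. Its linear dependence on b is what allows the
  remainder to be integrated in \<open>has_field_derivative_integral_param\<close>.\<close>

lemma taylor_bound_ball:
  assumes hol: "f holomorphic_on ball z r" and r: "r > 0"
    and b: "\<And>w. w \<in> ball z r \<Longrightarrow> norm (f w) \<le> b" and t: "norm t < r / 2"
  shows "norm (f (z + t) - f z - t * deriv f z) \<le> (32 * b / r\<^sup>2) * norm t ^ 2"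
proof -
  define g where "g i = (deriv ^^ i) f" for i
  have "norm (g 0 (z + t) - (\<Sum>i\<le>1. g i z * ((z + t) - z) ^ i / fact i))
      \<le> (32 * b / r\<^sup>2) * norm ((z + t) - z) ^ Suc 1 / fact 1"
  proof (rule complex_Taylor[where S = "ball z (r / 2)"])
    fix i x assume x: "x \<in> ball z (r / 2)" "i \<le> (1::nat)"
    have "(g i has_field_derivative g (Suc i) x) (at x)"
      unfolding g_def by (rule has_field_derivative_higher_deriv[OF hol]) (use x r in auto)
    then show "(g i has_field_derivative g (Suc i) x) (at x within ball z (r / 2))"
      by (rule has_field_derivative_at_within)
  next
    fix x assume x: "x \<in> ball z (r / 2)"
    have sub: "ball x (r / 2) \<subseteq> ball z r"
    proof
      fix w assume "w \<in> ball x (r / 2)"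
      then show "w \<in> ball z r" using x dist_triangle[of z w x] by simp
    qed
    have "norm ((deriv ^^ 2) f x) \<le> fact 2 * b / (r / 2 / 2) ^ 2"
      by (rule deriv_bound_ball)
        (use holomorphic_on_subset[OF hol sub] sub r b in auto)
    also have "\<dots> = 32 * b / r\<^sup>2" by (simp add: power2_eq_square)
    finally show "norm (g (Suc 1) x) \<le> 32 * b / r\<^sup>2"
      by (simp add: g_def numeral_2_eq_2)
  qed (use t r in \<open>auto simp: dist_norm\<close>)
  moreover have "g 0 (z + t) - (\<Sum>i\<le>1. g i z * ((z + t) - z) ^ i / fact i)
      = f (z + t) - f z - t * deriv f z"
    by (simp add: g_def algebra_simps)
  ultimately show ?thesis by (simp add: power2_eq_square)
qed

lemma small_at_sequence: "\<exists>\<xi>::nat \<Rightarrow> complex. (\<xi> \<longlonglongrightarrow> 0) \<and> (\<forall>n. \<xi> n \<noteq> 0 \<and> norm (\<xi> n) < e)"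
  if "e > 0"
proof (intro exI conjI allI)
  show "(\<lambda>n. of_real (e / 2 * inverse (real (Suc n)))) \<longlonglongrightarrow> (0::complex)"
  proof -
    have "(\<lambda>n. e / 2 * inverse (real (Suc n))) \<longlonglongrightarrow> 0"
      using tendsto_mult_right_zero[OF LIMSEQ_inverse_real_of_nat] by blast
    from tendsto_of_real[OF this, where ?'a = complex] show ?thesis by simp
  qed
  fix n
  have "inverse (real (Suc n)) \<le> 1" by (simp add: field_simps)
  then have "e / 2 * inverse (real (Suc n)) \<le> e / 2" using that by (intro mult_left_le) auto
  then show "norm (of_real (e / 2 * inverse (real (Suc n))) :: complex) < e"
    using that by (simp only: norm_of_real abs_of_nonneg) (simp add: )
  show "of_real (e / 2 * inverse (real (Suc n))) \<noteq> (0::complex)"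
    unfolding of_real_eq_0_iff using that by simp
qed

text \<open>Differentiation under the integral sign without a hypothesis on the derivative: by
  \<open>taylor_bound_ball\<close> the quadratic remainder is dominated by a multiple of the integrable bound.
  The measure is arbitrary because the lemma serves two purposes, integrals over a half-line and,
  with counting measure, multiple power series.\<close>

lemma has_field_derivative_integral_param:
  fixes f :: "complex \<Rightarrow> 's \<Rightarrow> complex" and M :: "'s measure"
  assumes A: "open A" "z \<in> A"
    and hol: "\<And>s. s \<in> space M \<Longrightarrow> (\<lambda>z. f z s) holomorphic_on A"
    and meas: "\<And>z. z \<in> A \<Longrightarrow> f z \<in> borel_measurable M"
    and int: "integrable M b"
    and bd: "\<And>z s. z \<in> A \<Longrightarrow> s \<in> space M \<Longrightarrow> norm (f z s) \<le> b s"
  shows "integrable M (\<lambda>s. deriv (\<lambda>z. f z s) z)"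
    and "((\<lambda>z. \<integral>s. f z s \<partial>M) has_field_derivative (\<integral>s. deriv (\<lambda>z. f z s) z \<partial>M)) (at z)"
proof -
  obtain r where r: "r > 0" "ball z r \<subseteq> A"
    using A openE by blast
  let ?d = "\<lambda>s. deriv (\<lambda>z. f z s) z"
  have quad: "norm (f (z + t) s - f z s - t * ?d s) \<le> (32 * b s / r\<^sup>2) * norm t ^ 2"
    if "norm t < r / 2" "s \<in> space M" for t s
    by (rule taylor_bound_ball) (use holomorphic_on_subset[OF hol[OF that(2)] r(2)] r bd that in auto)
  have inA: "z + t \<in> A" if "norm t < r / 2" for t
  proof -
    have "dist z (z + t) < r" using that r by (simp add: dist_norm)
    then show ?thesis using r by auto
  qed
  obtain \<xi> :: "nat \<Rightarrow> complex" where \<xi>: "\<xi> \<longlonglongrightarrow> 0" "\<And>n. \<xi> n \<noteq> 0" "\<And>n. norm (\<xi> n) < r / 2"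
    using small_at_sequence[of "r / 2"] r by auto
  have dmeas: "?d \<in> borel_measurable M"
  proof (rule borel_measurable_LIMSEQ_metric)
    show "(\<lambda>s. (f (z + \<xi> n) s - f z s) / \<xi> n) \<in> borel_measurable M" for n
      using meas[OF inA[OF \<xi>(3)]] meas[OF A(2)] by measurable
    fix s assume s: "s \<in> space M"
    have "((\<lambda>z. f z s) has_field_derivative ?d s) (at z)"
      using hol[OF s] A by (simp add: holomorphic_derivI)
    then have "((\<lambda>t. (f (z + t) s - f z s) / t) \<longlongrightarrow> ?d s) (at 0)"
      by (simp add: DERIV_def)
    then show "(\<lambda>n. (f (z + \<xi> n) s - f z s) / \<xi> n) \<longlonglongrightarrow> ?d s"
      using \<xi> by (auto simp: tendsto_at_iff_sequentially comp_def)
  qed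
  have b0: "0 \<le> b s" if "s \<in> space M" for s
    using bd[OF A(2) that] by (rule order_trans[rotated]) simp
  show di: "integrable M ?d"
  proof (rule Bochner_Integration.integrable_bound)
    show "integrable M (\<lambda>s. 2 / r * b s)" using int by simp
    show "AE s in M. norm (?d s) \<le> norm (2 / r * b s)"
    proof (rule AE_I2)
      fix s assume s: "s \<in> space M"
      have "norm ((deriv ^^ 1) (\<lambda>z. f z s) z) \<le> fact 1 * b s / (r / 2) ^ 1"
        by (rule deriv_bound_ball) (use holomorphic_on_subset[OF hol[OF s] r(2)] r bd s in auto)
      also have "\<dots> \<le> norm (2 / r * b s)" using b0[OF s] r by (simp add: mult.commute)
      finally show "norm (?d s) \<le> norm (2 / r * b s)" by simp
    qed
  qed (rule dmeas)
  have fi: "integrable M (f x)" if "x \<in> A" for x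
    by (rule Bochner_Integration.integrable_bound[OF int meas[OF that]])
      (use bd that b0 in \<open>auto intro!: AE_I2\<close>)
  show "((\<lambda>z. \<integral>s. f z s \<partial>M) has_field_derivative (\<integral>s. ?d s \<partial>M)) (at z)"
  proof (rule has_field_derivative_quadratic)
    show "r / 2 > 0" using r by simp
    fix t :: complex assume t: "norm t < r / 2"
    have "(\<integral>s. f (z + t) s \<partial>M) - (\<integral>s. f z s \<partial>M) - t * (\<integral>s. ?d s \<partial>M)
        = (\<integral>s. f (z + t) s - f z s - t * ?d s \<partial>M)"
      using fi[OF inA[OF t]] fi[OF A(2)] di by simp
    also have "norm \<dots> \<le> (\<integral>s. norm (f (z + t) s - f z s - t * ?d s) \<partial>M)"
      by (rule integral_norm_bound)
    also have "\<dots> \<le> (\<integral>s. (32 * b s / r\<^sup>2) * norm t ^ 2 \<partial>M)"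
      by (rule integral_mono)
        (use fi[OF inA[OF t]] fi[OF A(2)] di int quad[OF t] in auto)
    also have "\<dots> = (32 / r\<^sup>2 * (\<integral>s. b s \<partial>M)) * norm t ^ 2" by simp
    finally show "norm ((\<integral>s. f (z + t) s \<partial>M) - (\<integral>s. f z s \<partial>M) - t * (\<integral>s. ?d s \<partial>M))
      \<le> (32 / r\<^sup>2 * (\<integral>s. b s \<partial>M)) * norm t ^ 2" .
  qed
qed

text \<open>The difference quotients in x are holomorphic in y, and by \<open>taylor_bound_ball\<close> they
  converge uniformly in y.\<close>

lemma holomorphic_deriv_in_parameter:
  fixes f :: "complex \<Rightarrow> complex \<Rightarrow> complex"
  assumes B: "open B" and d: "d > 0"
    and hx: "\<And>y. y \<in> B \<Longrightarrow> (\<lambda>x. f x y) holomorphic_on ball x d"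
    and hy: "\<And>x'. x' \<in> ball x d \<Longrightarrow> (\<lambda>y. f x' y) holomorphic_on B"
    and b: "\<And>x' y. x' \<in> ball x d \<Longrightarrow> y \<in> B \<Longrightarrow> norm (f x' y) \<le> b"
  shows "(\<lambda>y. deriv (\<lambda>x. f x y) x) holomorphic_on B"
proof -
  obtain \<xi> :: "nat \<Rightarrow> complex" where \<xi>: "\<xi> \<longlonglongrightarrow> 0" "\<And>n. \<xi> n \<noteq> 0" "\<And>n. norm (\<xi> n) < d / 2"
    using small_at_sequence[of "d / 2"] d by auto
  have \<xi>in: "x + \<xi> n \<in> ball x d" for n
    using \<xi>(3)[of n] d by (simp add: dist_norm)
  let ?g = "\<lambda>n y. (f (x + \<xi> n) y - f x y) / \<xi> n"
  have err: "norm (?g n y - deriv (\<lambda>x. f x y) x) \<le> 32 * b / d\<^sup>2 * norm (\<xi> n)" if "y \<in> B" for n y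
  proof -
    have "norm (f (x + \<xi> n) y - f x y - \<xi> n * deriv (\<lambda>x. f x y) x) \<le> (32 * b / d\<^sup>2) * norm (\<xi> n) ^ 2"
      by (rule taylor_bound_ball) (use hx b d that \<xi> in auto)
    moreover have "?g n y - deriv (\<lambda>x. f x y) x = (f (x + \<xi> n) y - f x y - \<xi> n * deriv (\<lambda>x. f x y) x) / \<xi> n"
      using \<xi>(2)[of n] by (simp add: field_simps)
    ultimately show ?thesis using \<xi>(2)[of n]
      by (simp add: norm_divide divide_le_eq power2_eq_square mult.assoc)
  qed
  have ul: "uniform_limit B ?g (\<lambda>y. deriv (\<lambda>x. f x y) x) sequentially"
  proof (rule uniform_limitI)
    fix e :: real assume e: "e > 0"
    have "(\<lambda>n. 32 * b / d\<^sup>2 * norm (\<xi> n)) \<longlonglongrightarrow> 32 * b / d\<^sup>2 * 0"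
      using tendsto_norm[OF \<xi>(1)] by (intro tendsto_mult_left) simp
    then have "\<forall>\<^sub>F n in sequentially. 32 * b / d\<^sup>2 * norm (\<xi> n) < e"
      using e by (auto dest: order_tendstoD)
    then show "\<forall>\<^sub>F n in sequentially. \<forall>y\<in>B. dist (?g n y) (deriv (\<lambda>x. f x y) x) < e"
    proof eventually_elim
      case (elim n)
      show ?case
      proof
        fix y assume "y \<in> B"
        from err[OF this, of n] elim show "dist (?g n y) (deriv (\<lambda>x. f x y) x) < e"
          unfolding dist_norm by linarith
      qed
    qed
  qed
  show ?thesis
  proof (rule holomorphic_uniform_sequence[OF B])
    show "?g n holomorphic_on B" for n
      using hy[OF \<xi>in[of n]] hy[of x] d \<xi>(2)[of n] by (intro holomorphic_intros) auto
    fix y assume "y \<in> B"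
    then obtain e where "e > 0" "cball y e \<subseteq> B" using B open_contains_cball by blast
    then show "\<exists>d>0. cball y d \<subseteq> B \<and> uniform_limit (cball y d) ?g (\<lambda>y. deriv (\<lambda>x. f x y) x) sequentially"
      using uniform_limit_on_subset[OF ul] by blast
  qed
qed

section \<open>Separately holomorphic functions and Osgood's lemma\<close>

text \<open>Holomorphic in each variable separately. Together with local boundedness this is equivalent to
  joint analyticity, but it is much easier to verify for integrals, limits and compositions.\<close>

definition sep_holo :: "complex set \<Rightarrow> complex set \<Rightarrow> (complex \<Rightarrow> complex \<Rightarrow> complex) \<Rightarrow> bool" where
  "sep_holo A B f \<longleftrightarrow>
     (\<forall>y\<in>B. (\<lambda>x. f x y) holomorphic_on A) \<and> (\<forall>x\<in>A. (\<lambda>y. f x y) holomorphic_on B)"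

lemma sep_holo_swap: "sep_holo A B f \<Longrightarrow> sep_holo B A (\<lambda>y x. f x y)"
  by (auto simp: sep_holo_def)

lemma sep_holo_deriv_fst:
  assumes A: "open A" and B: "open B" and f: "sep_holo A B f"
    and b: "\<And>x y. x \<in> A \<Longrightarrow> y \<in> B \<Longrightarrow> norm (f x y) \<le> b"
  shows "sep_holo A B (\<lambda>x y. deriv (\<lambda>x. f x y) x)"
  unfolding sep_holo_def
proof (intro conjI ballI)
  show "(\<lambda>x. deriv (\<lambda>x. f x y) x) holomorphic_on A" if "y \<in> B" for y
    using f that A by (auto simp: sep_holo_def intro!: holomorphic_deriv)
  show "(\<lambda>y. deriv (\<lambda>x. f x y) x) holomorphic_on B" if "x \<in> A" for x
  proof -
    obtain r where r: "r > 0" "ball x r \<subseteq> A" using A \<open>x \<in> A\<close> openE by blast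
    show ?thesis
      by (rule holomorphic_deriv_in_parameter[where d = r and b = b])
        (use B r f b in \<open>auto simp: sep_holo_def elim: holomorphic_on_subset\<close>)
  qed
qed

text \<open>Chain rule in the direction (1,1) of the characteristics. The increment is split into a step in
  x at the moved point y+t and a step in y; the first is controlled by the quadratic Taylor
  remainder, uniformly in y, and by continuity of the x-derivative in y.\<close>

lemma sep_holo_diag_derivative:
  assumes A: "open A" and B: "open B" and f: "sep_holo A B f"
    and b: "\<And>x y. x \<in> A \<Longrightarrow> y \<in> B \<Longrightarrow> norm (f x y) \<le> b"
    and x: "x \<in> A" and y: "y \<in> B"
  shows "((\<lambda>t. f (x + t) (y + t)) has_field_derivative
           (deriv (\<lambda>x. f x y) x + deriv (\<lambda>y. f x y) y)) (at 0)"
proof -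
  obtain r where r: "r > 0" "ball x r \<subseteq> A" "ball y r \<subseteq> B"
  proof -
    obtain r1 where "r1 > 0" "ball x r1 \<subseteq> A" using A x openE by blast
    moreover obtain r2 where "r2 > 0" "ball y r2 \<subseteq> B" using B y openE by blast
    ultimately show ?thesis by (intro that[of "min r1 r2"]) (auto simp: ball_min_Int)
  qed
  let ?d1 = "\<lambda>y. deriv (\<lambda>x. f x y) x" and ?d2 = "deriv (\<lambda>y. f x y) y"
  have d1h: "?d1 holomorphic_on ball y r"
    using sep_holo_deriv_fst[OF A B f b] x r by (auto simp: sep_holo_def elim: holomorphic_on_subset)
  then have d1c: "((\<lambda>t. ?d1 (y + t)) \<longlongrightarrow> ?d1 y) (at 0)"
    using r continuous_on_eq_continuous_at[of "ball y r" ?d1] holomorphic_on_imp_continuous_on[OF d1h]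
    by (auto simp: isCont_iff)
  have d2: "((\<lambda>t. (f x (y + t) - f x y) / t) \<longlongrightarrow> ?d2) (at 0)"
  proof -
    have "((\<lambda>y. f x y) has_field_derivative ?d2) (at y)"
      using f x y B by (auto simp: sep_holo_def intro: holomorphic_derivI)
    then show ?thesis by (simp add: DERIV_def)
  qed
  have e: "((\<lambda>t. (f (x + t) (y + t) - f x (y + t)) / t - ?d1 (y + t)) \<longlongrightarrow> 0) (at 0)"
  proof (rule Lim_null_comparison)
    show "\<forall>\<^sub>F t in at 0. norm ((f (x + t) (y + t) - f x (y + t)) / t - ?d1 (y + t)) \<le> 32 * b / r\<^sup>2 * norm t"
    proof (rule eventually_at_ball'[of "r / 2" 0 UNIV, THEN eventually_mono])
      fix t :: complex assume t: "t \<in> ball 0 (r / 2) \<and> t \<noteq> 0 \<and> t \<in> UNIV"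
      have yt: "y + t \<in> ball y r" using t r by (auto simp: dist_norm)
      then have ytB: "y + t \<in> B" using r by auto
      have hyt: "(\<lambda>x. f x (y + t)) holomorphic_on ball x r"
        using f ytB r(2) holomorphic_on_subset unfolding sep_holo_def by blast
      have "norm (f (x + t) (y + t) - f x (y + t) - t * ?d1 (y + t)) \<le> (32 * b / r\<^sup>2) * norm t ^ 2"
        by (rule taylor_bound_ball) (use hyt b r t ytB in auto)
      moreover have "(f (x + t) (y + t) - f x (y + t)) / t - ?d1 (y + t)
         = (f (x + t) (y + t) - f x (y + t) - t * ?d1 (y + t)) / t" using t by (simp add: field_simps)
      ultimately show "norm ((f (x + t) (y + t) - f x (y + t)) / t - ?d1 (y + t)) \<le> 32 * b / r\<^sup>2 * norm t"
        using t by (simp add: norm_divide divide_le_eq power2_eq_square mult.assoc)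
    qed (use r in auto)
    show "((\<lambda>t. 32 * b / r\<^sup>2 * norm t) \<longlongrightarrow> 0) (at (0::complex))"
      using r(1) by (auto intro!: tendsto_eq_intros)
  qed
  have "((\<lambda>t. ((f (x + t) (y + t) - f x (y + t)) / t - ?d1 (y + t)) + ?d1 (y + t) + (f x (y + t) - f x y) / t)
        \<longlongrightarrow> 0 + ?d1 y + ?d2) (at 0)"
    by (intro tendsto_add e d1c d2)
  then show ?thesis by (simp add: DERIV_def diff_divide_distrib)
qed

lemma sep_holo_higher_deriv_fst:
  assumes A: "open A" and B: "open B" and f: "sep_holo A B f"
    and b: "\<And>x y. x \<in> A \<Longrightarrow> y \<in> B \<Longrightarrow> norm (f x y) \<le> b"
    and "x \<in> A"
  shows "(\<lambda>y. (deriv ^^ n) (\<lambda>x. f x y) x) holomorphic_on B"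
  using \<open>x \<in> A\<close>
proof (induction n arbitrary: x)
  case 0
  then show ?case using f by (simp add: sep_holo_def)
next
  case (Suc n)
  obtain r where r: "r > 0" "ball x r \<subseteq> A" using A Suc.prems openE by blast
  have hol: "(\<lambda>x. f x y) holomorphic_on A" if "y \<in> B" for y
    using f that by (auto simp: sep_holo_def)
  have "(\<lambda>y. deriv (\<lambda>x. (deriv ^^ n) (\<lambda>x. f x y) x) x) holomorphic_on B"
  proof (rule holomorphic_deriv_in_parameter[where d = "r / 2" and b = "fact n * b / (r / 2 / 2) ^ n"])
    show "(\<lambda>x. (deriv ^^ n) (\<lambda>x. f x y) x) holomorphic_on ball x (r / 2)" if "y \<in> B" for y
    proof -
      have "(deriv ^^ n) (\<lambda>x. f x y) holomorphic_on A"
        by (rule holomorphic_higher_deriv[OF hol[OF that] A])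
      then show ?thesis by (rule holomorphic_on_subset) (use r in auto)
    qed
    fix x' assume x': "x' \<in> ball x (r / 2)"
    have sub: "ball x' (r / 2) \<subseteq> A"
    proof
      fix w assume "w \<in> ball x' (r / 2)"
      then have "w \<in> ball x r" using x' dist_triangle[of x w x'] by simp
      then show "w \<in> A" using r by auto
    qed
    then have "x' \<in> A" using r by auto
    then show "(\<lambda>y. (deriv ^^ n) (\<lambda>x. f x y) x') holomorphic_on B" by (rule Suc.IH)
    show "norm ((deriv ^^ n) (\<lambda>x. f x y) x') \<le> fact n * b / (r / 2 / 2) ^ n" if "y \<in> B" for y
      by (rule deriv_bound_ball[OF holomorphic_on_subset[OF hol[OF that] sub]])
        (use b sub that r in auto)
  qed (use B r in auto)
  then show ?case by simp
qed

lemma geometric_double_summable: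
  "(\<lambda>(n, m). b * (1 / 2) ^ n * (1 / 2) ^ m) summable_on (UNIV :: (nat \<times> nat) set)" if "b \<ge> 0" for b :: real
proof -
  have g: "((\<lambda>n. (1 / 2) ^ n) has_sum (2::real)) (UNIV :: nat set)"
    using geometric_sums[of "1 / 2 :: real"] by (intro norm_summable_imp_has_sum) (auto simp: summable_geometric)
  have "(\<lambda>(n, m). b * (1 / 2) ^ n * (1 / 2) ^ m) summable_on (SIGMA n:(UNIV::nat set). (UNIV :: nat set))"
  proof (rule summable_on_SigmaI)
    show "((\<lambda>m. (case (n, m) of (n, m) \<Rightarrow> b * (1 / 2) ^ n * (1 / 2) ^ m)) has_sum (b * (1 / 2) ^ n * 2)) UNIV" for n
      using has_sum_cmult_right[OF g] by simp
    show "(\<lambda>n. b * (1 / 2) ^ n * 2) summable_on (UNIV :: nat set)"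
      using has_sum_cmult_left[OF has_sum_cmult_right[OF g]] by (blast intro: has_sum_imp_summable)
  qed (use that in auto)
  then show ?thesis by simp
qed

text \<open>Osgood's lemma. Expand in x with coefficients a_n(y), which are holomorphic by
  \<open>sep_holo_higher_deriv_fst\<close>, and expand these in y. Cauchy's estimates in both variables bound
  the coefficients by b (r/2)^(-n-m), so the double series converges absolutely and may be
  summed in any order.\<close>

lemma osgood_power_series:
  assumes A: "open A" and B: "open B" and f: "sep_holo A B f"
    and b: "\<And>x y. x \<in> A \<Longrightarrow> y \<in> B \<Longrightarrow> norm (f x y) \<le> b"
    and x0: "x0 \<in> A" and y0: "y0 \<in> B"
  obtains c \<rho> where "\<rho> > 0" "\<And>x y. norm (x - x0) < \<rho> \<Longrightarrow> norm (y - y0) < \<rho> \<Longrightarrow>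
      ((\<lambda>(n, m). c n m * (x - x0) ^ n * (y - y0) ^ m) has_sum f x y) UNIV"
proof -
  obtain r where r: "r > 0" "ball x0 r \<subseteq> A" "ball y0 r \<subseteq> B"
  proof -
    obtain r1 where "r1 > 0" "ball x0 r1 \<subseteq> A" using A x0 openE by blast
    moreover obtain r2 where "r2 > 0" "ball y0 r2 \<subseteq> B" using B y0 openE by blast
    ultimately show ?thesis by (intro that[of "min r1 r2"]) (auto simp: ball_min_Int)
  qed
  define a where "a n y = (deriv ^^ n) (\<lambda>x. f x y) x0 / fact n" for n y
  define c where "c n m = (deriv ^^ m) (a n) y0 / fact m" for n m
  have b0: "b \<ge> 0" using b[OF x0 y0] norm_ge_zero order_trans by blast
  have holx: "(\<lambda>x. f x y) holomorphic_on ball x0 r" if "y \<in> B" for y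
    using f that r(2) by (auto simp: sep_holo_def elim: holomorphic_on_subset)
  have hola: "a n holomorphic_on ball y0 r" for n
  proof -
    have "(\<lambda>y. (deriv ^^ n) (\<lambda>x. f x y) x0) holomorphic_on ball y0 r"
      by (rule holomorphic_on_subset[OF sep_holo_higher_deriv_fst[OF A B f b x0] r(3)])
    then show ?thesis unfolding a_def by (intro holomorphic_intros) auto
  qed
  have ab: "norm (a n y) \<le> b / (r / 2) ^ n" if "y \<in> B" for n y
  proof -
    have "norm ((deriv ^^ n) (\<lambda>x. f x y) x0) \<le> fact n * b / (r / 2) ^ n"
      by (rule deriv_bound_ball[OF holx[OF that]]) (use b r that in auto)
    then show ?thesis by (simp add: a_def norm_divide divide_le_eq mult_ac)
  qed
  have cb: "norm (c n m) \<le> b / (r / 2) ^ n / (r / 2) ^ m" for n m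
  proof -
    have "norm ((deriv ^^ m) (a n) y0) \<le> fact m * (b / (r / 2) ^ n) / (r / 2) ^ m"
      by (rule deriv_bound_ball[OF hola]) (use ab r in auto)
    then show ?thesis by (simp add: c_def norm_divide divide_le_eq mult_ac)
  qed
  show ?thesis
  proof (rule that[of "r / 4" c])
    \<comment> \<open>A quarter of the radius gives the ratio (r/4)/(r/2)=1/2 in each variable.\<close>
    show "r / 4 > 0" using r by simp
    fix x y assume x: "norm (x - x0) < r / 4" and y: "norm (y - y0) < r / 4"
    have yB: "y \<in> B" and xb: "x \<in> ball x0 r" and yb: "y \<in> ball y0 r"
      using y x r by (auto simp: dist_norm norm_minus_commute)
    let ?t = "\<lambda>(n, m). c n m * (x - x0) ^ n * (y - y0) ^ m"
    have tb: "norm (?t p) \<le> (\<lambda>(n, m). b * (1 / 2) ^ n * (1 / 2) ^ m) p" for p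
    proof (cases p)
      case (Pair n m)
      have "norm (?t p) = norm (c n m) * norm (x - x0) ^ n * norm (y - y0) ^ m"
        by (simp add: Pair norm_mult norm_power)
      also have "\<dots> \<le> (b / (r / 2) ^ n / (r / 2) ^ m) * (r / 4) ^ n * (r / 4) ^ m"
        using x y b0 r by (intro mult_mono power_mono cb) auto
      also have "\<dots> = b * ((r / 4) ^ n / (r / 2) ^ n) * ((r / 4) ^ m / (r / 2) ^ m)"
        by (simp only: divide_inverse mult_ac)
      also have "\<dots> = b * ((r / 4) / (r / 2)) ^ n * ((r / 4) / (r / 2)) ^ m"
        by (simp only: power_divide[of "r / 4" "r / 2"])
      also have "(r / 4) / (r / 2) = 1 / 2" using r by simp
      finally show ?thesis by (simp add: Pair)
    qed
    have summ: "?t summable_on UNIV"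
    proof -
      have "(\<lambda>p. norm (?t p)) summable_on UNIV"
        by (rule Infinite_Sum.abs_summable_on_comparison_test'[OF geometric_double_summable[OF b0]]) (use tb in blast)
      then show ?thesis by (rule abs_summable_summable)
    qed
    have row: "((\<lambda>m. ?t (n, m)) has_sum (a n y * (x - x0) ^ n)) UNIV" for n
    proof -
      have "(\<lambda>m. ?t (n, m)) summable_on UNIV"
        using summ summable_on_SigmaD1[of "\<lambda>n m. c n m * (x - x0) ^ n * (y - y0) ^ m" UNIV "\<lambda>_. UNIV" n] by simp
      then obtain S where S: "((\<lambda>m. ?t (n, m)) has_sum S) UNIV" by (auto simp: summable_on_def)
      have "(\<lambda>m. c n m * (y - y0) ^ m * (x - x0) ^ n) sums (a n y * (x - x0) ^ n)"
        unfolding c_def by (intro sums_mult2 holomorphic_power_series[OF hola yb])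
      then have "(\<lambda>m. ?t (n, m)) sums (a n y * (x - x0) ^ n)" by (simp add: mult_ac)
      with has_sum_imp_sums[OF S] S show ?thesis using sums_unique2 by blast
    qed
    obtain S where S: "(?t has_sum S) UNIV" using summ by (auto simp: summable_on_def)
    have "((\<lambda>n. a n y * (x - x0) ^ n) has_sum S) UNIV"
    proof (rule has_sum_SigmaD[where f = ?t and A = UNIV and B = "\<lambda>_. UNIV", rotated])
      show "((\<lambda>m. ?t (n, m)) has_sum (a n y * (x - x0) ^ n)) UNIV" for n by (rule row)
    qed (use S in simp)
    then have "(\<lambda>n. a n y * (x - x0) ^ n) sums S" by (rule has_sum_imp_sums)
    moreover have "(\<lambda>n. a n y * (x - x0) ^ n) sums f x y"
      unfolding a_def by (rule holomorphic_power_series[OF holx[OF yB] xb])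
    ultimately have "S = f x y" using sums_unique2 by blast
    with S show "(?t has_sum f x y) UNIV" by simp
  qed
qed

lemma analytic_several_osgood:
  assumes A: "open A" and B: "open B" and f: "sep_holo A B f"
    and b: "\<And>x y. x \<in> A \<Longrightarrow> y \<in> B \<Longrightarrow> norm (f x y) \<le> b"
  shows "analytic_several (\<lambda>v::complex^2. f (v$1) (v$2)) {v. v$1 \<in> A \<and> v$2 \<in> B}"
  unfolding analytic_several_def
proof
  fix z :: "complex^2" assume "z \<in> {v. v$1 \<in> A \<and> v$2 \<in> B}"
  then have z: "z$1 \<in> A" "z$2 \<in> B" by auto
  obtain \<rho> c where \<rho>: "\<rho> > 0" "\<And>x y. norm (x - z$1) < \<rho> \<Longrightarrow> norm (y - z$2) < \<rho> \<Longrightarrow>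
      ((\<lambda>(n, m). c n m * (x - z$1) ^ n * (y - z$2) ^ m) has_sum f x y) UNIV"
    by (rule osgood_power_series[OF A B f b z]) blast+
  have bij: "bij_betw (\<lambda>\<alpha>::nat^2. (\<alpha>$1, \<alpha>$2)) UNIV UNIV"
  proof (rule bij_betwI[where g = "\<lambda>p. vector [fst p, snd p]"])
    show "vector [fst (\<alpha> $ 1, \<alpha> $ 2), snd (\<alpha> $ 1, \<alpha> $ 2)] = \<alpha>" for \<alpha> :: "nat^2"
      by (simp add: vec_eq_iff forall_2)
  qed auto
  have "has_power_series_at (\<lambda>v::complex^2. f (v$1) (v$2)) z (\<lambda>\<alpha>. c (\<alpha>$1) (\<alpha>$2))"
    unfolding has_power_series_at_def
  proof (intro exI conjI allI impI)
    fix w :: "complex^2" assume w: "\<forall>i. norm (w $ i - z $ i) < \<rho>"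
    have "((\<lambda>(n, m). c n m * (w$1 - z$1) ^ n * (w$2 - z$2) ^ m) has_sum f (w$1) (w$2)) UNIV"
      using w by (intro \<rho>) auto
    then have "((\<lambda>\<alpha>::nat^2. (\<lambda>(n, m). c n m * (w$1 - z$1) ^ n * (w$2 - z$2) ^ m) (\<alpha>$1, \<alpha>$2)) has_sum f (w$1) (w$2)) UNIV"
      using has_sum_reindex_bij_betw[OF bij] by blast
    then show "((\<lambda>\<alpha>. c (\<alpha> $ 1) (\<alpha> $ 2) * (\<Prod>i\<in>UNIV. (w $ i - z $ i) ^ \<alpha> $ i)) has_sum f (w $ 1) (w $ 2)) UNIV"
      by (simp add: prod_2 mult.assoc UNIV_2 cong: has_sum_cong)
  qed (rule \<rho>)
  then show "\<exists>c. has_power_series_at (\<lambda>v::complex^2. f (v$1) (v$2)) z c" by blast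
qed

section \<open>Power series in several variables\<close>

definition vmon :: "nat^'n \<Rightarrow> complex^'n \<Rightarrow> complex" where
  "vmon \<alpha> w = (\<Prod>i\<in>UNIV. (w $ i) ^ (\<alpha> $ i))"

definition tdeg :: "nat^'n \<Rightarrow> nat" where
  "tdeg \<alpha> = (\<Sum>i\<in>UNIV. \<alpha> $ i)"

text \<open>The coefficient-wise form of \<open>has_power_series_at\<close> at the origin with an explicit polydisc.\<close>

definition pseries_on :: "(nat^'n \<Rightarrow> complex) \<Rightarrow> real \<Rightarrow> (complex^'n \<Rightarrow> complex) \<Rightarrow> bool" where
  "pseries_on c \<rho> f \<longleftrightarrow>
     (\<forall>w. (\<forall>i. norm (w $ i) < \<rho>) \<longrightarrow> ((\<lambda>\<alpha>. c \<alpha> * vmon \<alpha> w) has_sum f w) UNIV)"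

lemma has_power_series_at_iff:
  "has_power_series_at f z c \<longleftrightarrow> (\<exists>\<rho>>0. pseries_on c \<rho> (\<lambda>w. f (z + w)))"
proof -
  have "(\<forall>w. (\<forall>i. norm (w $ i - z $ i) < \<rho>) \<longrightarrow>
        ((\<lambda>\<alpha>. c \<alpha> * (\<Prod>i\<in>UNIV. (w $ i - z $ i) ^ (\<alpha> $ i))) has_sum f w) UNIV)
    \<longleftrightarrow> pseries_on c \<rho> (\<lambda>w. f (z + w))" for \<rho>
    unfolding pseries_on_def vmon_def
  proof safe
    fix w :: "complex^'a"
    assume *: "\<forall>w. (\<forall>i. norm (w $ i - z $ i) < \<rho>) \<longrightarrow>
        ((\<lambda>\<alpha>. c \<alpha> * (\<Prod>i\<in>UNIV. (w $ i - z $ i) ^ (\<alpha> $ i))) has_sum f w) UNIV"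
      and "\<forall>i. norm (w $ i) < \<rho>"
    then show "((\<lambda>\<alpha>. c \<alpha> * (\<Prod>i\<in>UNIV. (w $ i) ^ (\<alpha> $ i))) has_sum f (z + w)) UNIV"
      using *[rule_format, of "z + w"] by simp
  next
    fix w :: "complex^'a"
    assume *: "\<forall>w. (\<forall>i. norm (w $ i) < \<rho>) \<longrightarrow>
        ((\<lambda>\<alpha>. c \<alpha> * (\<Prod>i\<in>UNIV. (w $ i) ^ (\<alpha> $ i))) has_sum f (z + w)) UNIV"
      and "\<forall>i. norm (w $ i - z $ i) < \<rho>"
    then show "((\<lambda>\<alpha>. c \<alpha> * (\<Prod>i\<in>UNIV. (w $ i - z $ i) ^ (\<alpha> $ i))) has_sum f w) UNIV"
      using *[rule_format, of "w - z"] by simp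
  qed
  then show ?thesis by (simp add: has_power_series_at_def)
qed

lemma has_power_series_at_0_iff:
  "has_power_series_at f 0 c \<longleftrightarrow> (\<exists>\<rho>>0. pseries_on c \<rho> f)"
  by (simp add: has_power_series_at_iff)

lemma pseries_on_mono: "pseries_on c \<rho> f \<Longrightarrow> \<rho>' \<le> \<rho> \<Longrightarrow> pseries_on c \<rho>' f"
  unfolding pseries_on_def by (meson less_le_trans)

lemma pseries_on_cong:
  assumes "pseries_on c \<rho> f" "\<And>w. \<forall>i. norm (w $ i) < \<rho> \<Longrightarrow> f w = g w"
  shows "pseries_on c \<rho> g"
  using assms by (simp add: pseries_on_def)

lemma norm_vmon_le:
  assumes "\<And>i. norm (w $ i) \<le> s"
  shows "norm (vmon \<alpha> w) \<le> s ^ tdeg \<alpha>"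
proof -
  have "norm (vmon \<alpha> w) = (\<Prod>i\<in>UNIV. norm (w $ i) ^ (\<alpha> $ i))"
    by (simp add: vmon_def norm_power flip: prod_norm)
  also have "\<dots> \<le> (\<Prod>i\<in>UNIV. s ^ (\<alpha> $ i))"
    by (intro prod_mono conjI power_mono assms) auto
  also have "\<dots> = s ^ tdeg \<alpha>" by (simp add: tdeg_def power_sum)
  finally show ?thesis .
qed

lemma pseries_on_summable:
  assumes "pseries_on c \<rho> f" "0 \<le> s" "s < \<rho>"
  shows "(\<lambda>\<alpha>. norm (c \<alpha>) * s ^ tdeg \<alpha>) summable_on UNIV"
proof -
  define w :: "complex^'a" where "w = (\<chi> i. of_real s)"
  have "((\<lambda>\<alpha>. c \<alpha> * vmon \<alpha> w) has_sum f w) UNIV"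
    using assms by (auto simp: pseries_on_def w_def)
  then have "(\<lambda>\<alpha>. c \<alpha> * vmon \<alpha> w) summable_on UNIV" by (rule has_sum_imp_summable)
  then have "(\<lambda>\<alpha>. norm (c \<alpha> * vmon \<alpha> w)) summable_on UNIV"
    by (rule summable_on_iff_abs_summable_on_complex[THEN iffD1])
  moreover have "norm (vmon \<alpha> w) = s ^ tdeg \<alpha>" for \<alpha>
    using assms by (simp add: vmon_def w_def norm_power tdeg_def power_sum flip: prod_norm)
  ultimately show ?thesis by (simp add: norm_mult)
qed

lemma power_series_zero_coeffs:
  fixes a :: "nat \<Rightarrow> complex"
  assumes "r > 0" and "\<And>x. norm x < r \<Longrightarrow> (\<lambda>n. a n * x ^ n) sums 0"
  shows "a m = 0"
proof (rule ccontr)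
  assume m: "a m \<noteq> 0"
  have a0: "a 0 = 0"
    using assms(2)[of 0] assms(1) powser_sums_zero[of a] sums_unique2 by fastforce
  with m have "m > 0" by (metis gr0I)
  show False
  proof (rule powser_0_nonzero[where r = r and a = a and \<xi> = 0 and f = "\<lambda>_. 0" and m = m])
    fix s :: real
    assume s: "s > 0" "\<And>z::complex. z \<in> cball 0 s - {0} \<Longrightarrow> (0::complex) \<noteq> 0"
    have "complex_of_real s \<in> cball 0 s - {0}" using s(1) by auto
    from s(2)[OF this] show False by simp
  qed (use assms m \<open>m > 0\<close> in auto)
qed

text \<open>One variable is eliminated at a time: for a set S of processed variables the partial series over
  all exponents that agree with \<beta> on S still vanishes identically. A new variable is
  processed by grouping the terms according to its exponent and using uniqueness for power series
  in that variable.\<close>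

lemma pseries_on_zero:
  fixes e :: "nat^'n \<Rightarrow> complex"
  assumes \<rho>: "\<rho> > 0" and e: "pseries_on e \<rho> (\<lambda>_. 0)"
  shows "e \<beta> = 0"
proof -
  have "\<forall>w. (\<forall>i. norm (w $ i) < \<rho>) \<longrightarrow>
      ((\<lambda>\<alpha>. e \<alpha> * (\<Prod>i\<in>-S. (w $ i) ^ (\<alpha> $ i))) has_sum 0) {\<alpha>. \<forall>j\<in>S. \<alpha> $ j = \<beta> $ j}"
    for S :: "'n set"
  proof (induction S rule: infinite_finite_induct)
    case (infinite S)
    then show ?case by simp
  next
    case empty
    show ?case using e by (simp add: pseries_on_def vmon_def)
  next
    case (insert k S)
    show ?case
    proof (intro allI impI)
      fix w :: "complex^'n" assume w: "\<forall>i. norm (w $ i) < \<rho>"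
      define E where "E n = {\<alpha>. (\<forall>j\<in>S. \<alpha> $ j = \<beta> $ j) \<and> \<alpha> $ k = n}" for n
      let ?P = "\<lambda>\<alpha>. e \<alpha> * (\<Prod>i\<in>-insert k S. (w $ i) ^ (\<alpha> $ i))"
      have split: "(\<Prod>i\<in>-S. ((\<chi> j. if j = k then t else w $ j) $ i) ^ (\<alpha> $ i))
          = t ^ (\<alpha> $ k) * (\<Prod>i\<in>-insert k S. (w $ i) ^ (\<alpha> $ i))" for t \<alpha>
      proof -
        have eq: "- S = insert k (- insert k S)" using insert.hyps by auto
        show ?thesis by (subst eq, subst prod.insert) (auto intro!: prod.cong)
      qed
      have IH: "((\<lambda>\<alpha>. t ^ (\<alpha> $ k) * ?P \<alpha>) has_sum 0) {\<alpha>. \<forall>j\<in>S. \<alpha> $ j = \<beta> $ j}" if "norm t < \<rho>" for t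
      proof -
        have "((\<lambda>\<alpha>. e \<alpha> * (\<Prod>i\<in>-S. ((\<chi> j. if j = k then t else w $ j) $ i) ^ (\<alpha> $ i))) has_sum 0)
            {\<alpha>. \<forall>j\<in>S. \<alpha> $ j = \<beta> $ j}"
          using insert.IH[rule_format, of "\<chi> j. if j = k then t else w $ j"] w that by simp
        then show ?thesis unfolding split by (simp add: mult_ac)
      qed
      have IH2: "((\<lambda>(n, \<alpha>). t ^ n * ?P \<alpha>) has_sum 0) (Sigma UNIV E)" if "norm t < \<rho>" for t
      proof -
        have "((\<lambda>(n, \<alpha>). t ^ n * ?P \<alpha>) has_sum 0) (Sigma UNIV E)
            = ((\<lambda>\<alpha>. t ^ (\<alpha> $ k) * ?P \<alpha>) has_sum 0) {\<alpha>. \<forall>j\<in>S. \<alpha> $ j = \<beta> $ j}"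
          by (rule has_sum_reindex_bij_witness[where i = "\<lambda>\<alpha>. (\<alpha> $ k, \<alpha>)" and j = snd]) (auto simp: E_def)
        then show ?thesis using IH[OF that] by simp
      qed
      have sm: "?P summable_on E n" for n
      proof -
        \<comment> \<open>Any non-zero point of the disc serves to divide by the power of the processed variable.\<close>
        define t where "t = complex_of_real (\<rho> / 2)"
        have t: "norm t < \<rho>" "t \<noteq> 0" using \<rho> by (auto simp: t_def)
        have "(\<lambda>\<alpha>. t ^ n * ?P \<alpha>) summable_on E n"
          using summable_on_SigmaD1[of "\<lambda>n \<alpha>. t ^ n * ?P \<alpha>" UNIV E n] has_sum_imp_summable[OF IH2[OF t(1)]] by simp
        then have "(\<lambda>\<alpha>. inverse (t ^ n) * (t ^ n * ?P \<alpha>)) summable_on E n"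
          by (rule summable_on_cmult_right)
        then show ?thesis using t by (simp add: field_simps)
      qed
      define g where "g n = infsum ?P (E n)" for n
      have g: "(?P has_sum g n) (E n)" for n unfolding g_def using sm by simp
      have "(\<lambda>n. g n * t ^ n) sums 0" if "norm t < \<rho>" for t
      proof -
        have "((\<lambda>n. t ^ n * g n) has_sum 0) UNIV"
        proof (rule has_sum_SigmaD[OF IH2[OF that]])
          show "((\<lambda>y. case (n, y) of (n, \<alpha>) \<Rightarrow> t ^ n * ?P \<alpha>) has_sum t ^ n * g n) (E n)" for n
            using has_sum_cmult_right[OF g[of n], of "t ^ n"] by simp
        qed
        then show ?thesis by (simp add: has_sum_imp_sums mult.commute)
      qed
      then have "g (\<beta> $ k) = 0" using power_series_zero_coeffs[OF \<rho>] by blast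
      moreover have "E (\<beta> $ k) = {\<alpha>. \<forall>j\<in>insert k S. \<alpha> $ j = \<beta> $ j}" by (auto simp: E_def)
      ultimately show "(?P has_sum 0) {\<alpha>. \<forall>j\<in>insert k S. \<alpha> $ j = \<beta> $ j}" using g[of "\<beta> $ k"] by simp
    qed
  qed
  from this[of UNIV, rule_format, of 0] \<rho> have "(e has_sum 0) {\<beta>}"
    by (simp flip: vec_eq_iff)
  then show ?thesis by (auto dest: has_sum_imp_sums simp: has_sum_finite_iff)
qed

lemma pseries_on_add:
  "pseries_on c \<rho> f \<Longrightarrow> pseries_on d \<rho> g \<Longrightarrow> pseries_on (\<lambda>\<alpha>. c \<alpha> + d \<alpha>) \<rho> (\<lambda>w. f w + g w)"
  unfolding pseries_on_def by (auto simp: distrib_right intro!: has_sum_add)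

lemma pseries_on_cmult:
  "pseries_on c \<rho> f \<Longrightarrow> pseries_on (\<lambda>\<alpha>. k * c \<alpha>) \<rho> (\<lambda>w. k * f w)"
  unfolding pseries_on_def by (auto simp: mult.assoc intro!: has_sum_cmult_right)

lemma pseries_on_vmon: "pseries_on (\<lambda>\<alpha>. if \<alpha> = \<beta> then 1 else 0) \<rho> (vmon \<beta>)"
  unfolding pseries_on_def by (auto intro!: has_sum_finite_neutralI[of "{\<beta>}"] split: if_splits)

lemma pseries_on_unique:
  assumes "\<rho> > 0" "pseries_on c \<rho> f" "\<rho>' > 0" "pseries_on d \<rho>' f"
  shows "c = d"
proof
  fix \<beta>
  define r where "r = min \<rho> \<rho>'"
  have "pseries_on (\<lambda>\<alpha>. c \<alpha> + (-1) * d \<alpha>) r (\<lambda>w. f w + (-1) * f w)"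
    unfolding r_def by (intro pseries_on_add pseries_on_cmult pseries_on_mono[OF assms(2)] pseries_on_mono[OF assms(4)]) auto
  then have "c \<beta> + (-1) * d \<beta> = 0"
    using pseries_on_zero[of r "\<lambda>\<alpha>. c \<alpha> + (-1) * d \<alpha>" \<beta>] assms by (simp add: r_def)
  then show "c \<beta> = d \<beta>" by simp
qed

lemma taylor_coeff_eq:
  assumes "has_power_series_at f 0 c"
  shows "taylor_coeff f 0 = c"
  unfolding taylor_coeff_def
proof (rule the_equality)
  show "has_power_series_at f 0 c" by (rule assms)
  show "d = c" if "has_power_series_at f 0 d" for d
    using that assms pseries_on_unique unfolding has_power_series_at_0_iff by blast
qed

text \<open>Termwise differentiation, as differentiation under an integral with respect to counting measure.\<close>

lemma has_sum_field_derivative: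
  fixes f :: "complex \<Rightarrow> 'i \<Rightarrow> complex"
  assumes A: "open A" "z \<in> A"
    and hol: "\<And>\<alpha>. (\<lambda>z. f z \<alpha>) holomorphic_on A"
    and b: "b summable_on UNIV" "\<And>z \<alpha>. z \<in> A \<Longrightarrow> norm (f z \<alpha>) \<le> b \<alpha>"
  shows "(\<lambda>\<alpha>. deriv (\<lambda>z. f z \<alpha>) z) summable_on UNIV"
    and "((\<lambda>z. infsum (f z) UNIV) has_field_derivative infsum (\<lambda>\<alpha>. deriv (\<lambda>z. f z \<alpha>) z) UNIV) (at z)"
proof -
  have ei: "(\<lambda>\<alpha>. norm (g \<alpha>)) summable_on UNIV \<longleftrightarrow> integrable (count_space UNIV) g" for g :: "'i \<Rightarrow> complex"
    using abs_summable_equivalent[of g UNIV] unfolding Infinite_Set_Sum.abs_summable_on_def .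
  have ei': "(\<lambda>\<alpha>. norm (g \<alpha>)) summable_on UNIV \<longleftrightarrow> integrable (count_space UNIV) g" for g :: "'i \<Rightarrow> real"
    using abs_summable_equivalent[of g UNIV] unfolding Infinite_Set_Sum.abs_summable_on_def .
  have es: "integral\<^sup>L (count_space UNIV) g = infsum g UNIV" if "integrable (count_space UNIV) g" for g :: "'i \<Rightarrow> complex"
    using infsetsum_infsum[of g UNIV] that
    unfolding Infinite_Set_Sum.abs_summable_on_def infsetsum_def by simp
  have b0: "norm (b \<alpha>) = b \<alpha>" for \<alpha> using order_trans[OF norm_ge_zero b(2)[OF A(2), of \<alpha>]] by simp
  have bi: "integrable (count_space UNIV) b" using b(1) ei'[of b] b0 by simp
  note P = has_field_derivative_integral_param[where M = "count_space UNIV" and f = f and b = b, OF A]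
  have di: "integrable (count_space UNIV) (\<lambda>s. deriv (\<lambda>z. f z s) z)"
    by (rule P(1)) (use hol bi b in auto)
  show "(\<lambda>\<alpha>. deriv (\<lambda>z. f z \<alpha>) z) summable_on UNIV"
    using di ei abs_summable_summable by blast
  have D: "((\<lambda>z. integral\<^sup>L (count_space UNIV) (f z)) has_field_derivative
         integral\<^sup>L (count_space UNIV) (\<lambda>s. deriv (\<lambda>z. f z s) z)) (at z)"
    by (rule P(2)) (use hol bi b in auto)
  show "((\<lambda>z. infsum (f z) UNIV) has_field_derivative infsum (\<lambda>\<alpha>. deriv (\<lambda>z. f z \<alpha>) z) UNIV) (at z)"
    unfolding es[OF di, symmetric]
  proof (rule has_field_derivative_transform_within_open[OF D A])
    fix x assume "x \<in> A"
    then have "integrable (count_space UNIV) (f x)"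
      by (intro Bochner_Integration.integrable_bound[OF bi]) (use b b0 in \<open>auto simp: AE_count_space\<close>)
    then show "integral\<^sup>L (count_space UNIV) (f x) = infsum (f x) UNIV" by (rule es)
  qed
qed

lemma pseries_on_compose_holomorphic:
  assumes f: "pseries_on c \<rho> f" and s: "0 \<le> s" "s < \<rho>" and A: "open A"
    and u: "\<And>i. (\<lambda>x. u x $ i) holomorphic_on A" "\<And>x i. x \<in> A \<Longrightarrow> norm (u x $ i) \<le> s"
  shows "(\<lambda>x. f (u x)) holomorphic_on A"
proof -
  have eq: "infsum (\<lambda>\<alpha>. c \<alpha> * vmon \<alpha> (u x)) UNIV = f (u x)" if "x \<in> A" for x
  proof -
    have "\<forall>i. norm (u x $ i) < \<rho>" using u(2)[OF that] s(2) le_less_trans by blast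
    then show ?thesis using f by (auto simp: pseries_on_def intro!: infsumI)
  qed
  have "\<exists>D. ((\<lambda>x. infsum (\<lambda>\<alpha>. c \<alpha> * vmon \<alpha> (u x)) UNIV) has_field_derivative D) (at x)" if "x \<in> A" for x
  proof -
    have "((\<lambda>x. infsum (\<lambda>\<alpha>. c \<alpha> * vmon \<alpha> (u x)) UNIV) has_field_derivative
        infsum (\<lambda>\<alpha>. deriv (\<lambda>x. c \<alpha> * vmon \<alpha> (u x)) x) UNIV) (at x)"
    proof (rule has_sum_field_derivative[OF A that])
      show "(\<lambda>x. c \<alpha> * vmon \<alpha> (u x)) holomorphic_on A" for \<alpha>
        unfolding vmon_def using u(1) by (intro holomorphic_intros)
      show "(\<lambda>\<alpha>. norm (c \<alpha>) * s ^ tdeg \<alpha>) summable_on UNIV" by (rule pseries_on_summable[OF f s])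
      show "norm (c \<alpha> * vmon \<alpha> (u z)) \<le> norm (c \<alpha>) * s ^ tdeg \<alpha>" if "z \<in> A" for z \<alpha>
        using norm_vmon_le[of "u z" s \<alpha>] u(2)[OF that] by (simp add: norm_mult mult_left_mono)
    qed
    then show ?thesis by blast
  qed
  then have "(\<lambda>x. infsum (\<lambda>\<alpha>. c \<alpha> * vmon \<alpha> (u x)) UNIV) holomorphic_on A"
    using A by (simp add: holomorphic_on_open)
  then show ?thesis using eq by (simp cong: holomorphic_cong)
qed

text \<open>The converse of Osgood's lemma, by restricting the local power series to coordinate lines.\<close>

lemma analytic_several_sep_holo:
  assumes an: "analytic_several (\<lambda>x::complex^2. f (x$1) (x$2)) {x. x$1 \<in> A \<and> x$2 \<in> X}"
    and A: "open A" and X: "open X"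
  shows "sep_holo A X f"
proof -
  have loc: "(\<lambda>x. f x \<tau>) field_differentiable (at \<phi>)" "(\<lambda>y. f \<phi> y) field_differentiable (at \<tau>)"
    if "\<phi> \<in> A" "\<tau> \<in> X" for \<phi> \<tau>
  proof -
    define z :: "complex^2" where "z = vector [\<phi>, \<tau>]"
    have "z \<in> {x. x$1 \<in> A \<and> x$2 \<in> X}" using that by (simp add: z_def)
    then obtain c \<rho> where \<rho>: "\<rho> > 0" "pseries_on c \<rho> (\<lambda>w::complex^2. f ((z + w)$1) ((z + w)$2))"
      using an unfolding analytic_several_def has_power_series_at_iff by blast
    have 1: "(\<lambda>x. (\<lambda>w::complex^2. f ((z + w)$1) ((z + w)$2)) (vector [x - \<phi>, 0])) holomorphic_on ball \<phi> (\<rho>/2)"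
    proof (rule pseries_on_compose_holomorphic[OF \<rho>(2), where s = "\<rho>/2"])
      show "(\<lambda>x. (vector [x - \<phi>, 0] :: complex^2) $ i) holomorphic_on ball \<phi> (\<rho>/2)" for i :: 2
        using exhaust_2[of i] by (auto intro!: holomorphic_intros)
      show "norm ((vector [x - \<phi>, 0] :: complex^2) $ i) \<le> \<rho>/2" if "x \<in> ball \<phi> (\<rho>/2)" for x and i :: 2
        using exhaust_2[of i] that \<rho>(1) by (auto simp: dist_norm norm_minus_commute)
    qed (use \<rho>(1) in auto)
    have 2: "(\<lambda>y. (\<lambda>w::complex^2. f ((z + w)$1) ((z + w)$2)) (vector [0, y - \<tau>])) holomorphic_on ball \<tau> (\<rho>/2)"
    proof (rule pseries_on_compose_holomorphic[OF \<rho>(2), where s = "\<rho>/2"])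
      show "(\<lambda>y. (vector [0, y - \<tau>] :: complex^2) $ i) holomorphic_on ball \<tau> (\<rho>/2)" for i :: 2
        using exhaust_2[of i] by (auto intro!: holomorphic_intros)
      show "norm ((vector [0, y - \<tau>] :: complex^2) $ i) \<le> \<rho>/2" if "y \<in> ball \<tau> (\<rho>/2)" for y and i :: 2
        using exhaust_2[of i] that \<rho>(1) by (auto simp: dist_norm norm_minus_commute)
    qed (use \<rho>(1) in auto)
    show "(\<lambda>x. f x \<tau>) field_differentiable (at \<phi>)"
      using holomorphic_on_imp_differentiable_at[OF 1 open_ball, of \<phi>] \<rho>(1) by (simp add: z_def)
    show "(\<lambda>y. f \<phi> y) field_differentiable (at \<tau>)"
      using holomorphic_on_imp_differentiable_at[OF 2 open_ball, of \<tau>] \<rho>(1) by (simp add: z_def)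
  qed
  show ?thesis
    unfolding sep_holo_def using loc by (auto simp: holomorphic_on_def field_differentiable_at_within)
qed

definition update_coord :: "'n \<Rightarrow> complex \<Rightarrow> complex^'n \<Rightarrow> complex^'n" where
  "update_coord i t z = (\<chi> j. if j = i then t else z $ j)"

lemma update_coord_nth: "update_coord i t z $ j = (if j = i then t else z $ j)"
  by (simp add: update_coord_def)

text \<open>The coefficients of the termwise partial derivative.\<close>

definition shift_coeff :: "'n \<Rightarrow> (nat^'n \<Rightarrow> complex) \<Rightarrow> nat^'n \<Rightarrow> complex" where
  "shift_coeff i c \<beta> = of_nat (Suc (\<beta> $ i)) * c (\<beta> + axis i 1)"

lemma vmon_update_coord: "vmon \<alpha> (update_coord i t z) = t ^ (\<alpha> $ i) * (\<Prod>j\<in>-{i}. (z $ j) ^ (\<alpha> $ j))"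
proof -
  have "insert i (-{i}) = UNIV" by auto
  then have "vmon \<alpha> (update_coord i t z) = (\<Prod>j\<in>insert i (-{i}). (update_coord i t z $ j) ^ (\<alpha> $ j))"
    by (simp add: vmon_def)
  also have "\<dots> = t ^ (\<alpha> $ i) * (\<Prod>j\<in>-{i}. (update_coord i t z $ j) ^ (\<alpha> $ j))"
    by (subst prod.insert) (auto simp: update_coord_nth)
  also have "(\<Prod>j\<in>-{i}. (update_coord i t z $ j) ^ (\<alpha> $ j)) = (\<Prod>j\<in>-{i}. (z $ j) ^ (\<alpha> $ j))"
    by (intro prod.cong) (auto simp: update_coord_nth)
  finally show ?thesis .
qed

lemma pseries_on_partial_deriv:
  fixes f :: "complex^'n \<Rightarrow> complex"
  assumes f: "pseries_on c \<rho> f"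
  shows "pseries_on (shift_coeff i c) \<rho> (partial_deriv i f)"
    and "(\<forall>i. norm (z $ i) < \<rho>) \<Longrightarrow> (\<lambda>t. f (update_coord i t z)) field_differentiable (at (z $ i))"
proof -
  have main: "((\<lambda>t. f (update_coord i t z)) has_field_derivative infsum (\<lambda>\<alpha>. deriv (\<lambda>t. c \<alpha> * vmon \<alpha> (update_coord i t z)) (z $ i)) UNIV) (at (z $ i))
    \<and> (\<lambda>\<alpha>. deriv (\<lambda>t. c \<alpha> * vmon \<alpha> (update_coord i t z)) (z $ i)) summable_on UNIV"
    if z: "\<forall>i. norm (z $ i) < \<rho>" for z
  proof -
    define m where "m = Max (range (\<lambda>i. norm (z $ i)))"
    have m: "m < \<rho>" "\<And>i. norm (z $ i) \<le> m"
      using z by (auto simp: m_def)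
    obtain s where s: "m < s" "s < \<rho>" using m(1) dense by blast
    have s0: "0 \<le> s" using m(2)[of i] s(1) norm_ge_zero[of "z $ i"] by linarith
    let ?A = "ball (0::complex) s"
    have zA: "z $ i \<in> ?A" using m(2)[of i] s by simp
    have ub: "norm (update_coord i t z $ j) \<le> s" if "t \<in> ?A" for t j
      using that m(2)[of j] s by (auto simp: update_coord_nth)
    have nb: "norm (c \<alpha> * vmon \<alpha> (update_coord i t z)) \<le> norm (c \<alpha>) * s ^ tdeg \<alpha>" if "t \<in> ?A" for t \<alpha>
      using norm_vmon_le[of "update_coord i t z" s \<alpha>] ub[OF that] by (simp add: norm_mult mult_left_mono)
    have hol: "(\<lambda>t. c \<alpha> * vmon \<alpha> (update_coord i t z)) holomorphic_on ?A" for \<alpha>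
      unfolding vmon_update_coord by (intro holomorphic_intros)
    note D = has_sum_field_derivative[OF open_ball zA hol pseries_on_summable[OF f s0 s(2)] nb]
    have "((\<lambda>t. f (update_coord i t z)) has_field_derivative infsum (\<lambda>\<alpha>. deriv (\<lambda>t. c \<alpha> * vmon \<alpha> (update_coord i t z)) (z $ i)) UNIV) (at (z $ i))"
    proof (rule has_field_derivative_transform_within_open[OF D(2) open_ball zA])
      fix t assume "t \<in> ?A"
      then have "\<forall>j. norm (update_coord i t z $ j) < \<rho>" using ub s(2) le_less_trans by blast
      then show "infsum (\<lambda>\<alpha>. c \<alpha> * vmon \<alpha> (update_coord i t z)) UNIV = f (update_coord i t z)"
        using f by (auto simp: pseries_on_def intro!: infsumI)
    qed
    with D(1) show ?thesis by blast
  qed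
  show "(\<forall>i. norm (z $ i) < \<rho>) \<Longrightarrow> (\<lambda>t. f (update_coord i t z)) field_differentiable (at (z $ i))"
    using main field_differentiable_def by blast
  show "pseries_on (shift_coeff i c) \<rho> (partial_deriv i f)"
    unfolding pseries_on_def
  proof (intro allI impI)
    fix z :: "complex^'n" assume z: "\<forall>i. norm (z $ i) < \<rho>"
    let ?d = "\<lambda>\<alpha>. deriv (\<lambda>t. c \<alpha> * vmon \<alpha> (update_coord i t z)) (z $ i)"
    have "partial_deriv i f z = infsum ?d UNIV"
      unfolding partial_deriv_def update_coord_def[symmetric] using main[OF z] DERIV_imp_deriv by blast
    then have S: "(?d has_sum partial_deriv i f z) UNIV" using main[OF z] by simp
    have d: "?d \<alpha> = c \<alpha> * (of_nat (\<alpha> $ i) * (z $ i) ^ (\<alpha> $ i - 1) * (\<Prod>j\<in>-{i}. (z $ j) ^ (\<alpha> $ j)))" for \<alpha>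
      unfolding vmon_update_coord by (rule DERIV_imp_deriv) (auto intro!: derivative_eq_intros)
    have 1: "(?d has_sum partial_deriv i f z) {\<alpha>. \<alpha> $ i \<noteq> 0}"
      using S by (rule has_sum_cong_neutral[THEN iffD1, rotated 3]) (auto simp: d)
    have "((\<lambda>\<beta>. shift_coeff i c \<beta> * vmon \<beta> z) has_sum partial_deriv i f z) UNIV
        = (?d has_sum partial_deriv i f z) {\<alpha>. \<alpha> $ i \<noteq> 0}"
    proof (rule has_sum_reindex_bij_witness[where i = "\<lambda>\<alpha>. \<alpha> - axis i 1" and j = "\<lambda>\<beta>. \<beta> + axis i 1"])
      fix \<beta> :: "nat^'n"
      have "vmon \<beta> z = (z $ i) ^ (\<beta> $ i) * (\<Prod>j\<in>-{i}. (z $ j) ^ (\<beta> $ j))"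
      proof -
        have "update_coord i (z $ i) z = z" by (simp add: update_coord_def vec_eq_iff)
        then show ?thesis using vmon_update_coord[of \<beta> i "z $ i" z] by simp
      qed
      moreover have "(\<Prod>j\<in>-{i}. (z $ j) ^ ((\<beta> + axis i 1) $ j)) = (\<Prod>j\<in>-{i}. (z $ j) ^ (\<beta> $ j))"
        by (intro prod.cong) (auto simp: axis_def)
      ultimately show "?d (\<beta> + axis i 1) = shift_coeff i c \<beta> * vmon \<beta> z"
        unfolding d shift_coeff_def by (simp add: axis_def mult_ac)
    next
      fix \<alpha> :: "nat^'n" assume "\<alpha> \<in> {\<alpha>. \<alpha> $ i \<noteq> 0}"
      then show "\<alpha> - axis i 1 + axis i 1 = \<alpha>" by (auto simp: vec_eq_iff axis_def)
    qed (auto simp: vec_eq_iff axis_def)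
    then show "((\<lambda>\<beta>. shift_coeff i c \<beta> * vmon \<beta> z) has_sum partial_deriv i f z) UNIV" using 1 by blast
  qed
qed

section \<open>Integration along the characteristics\<close>

definition half_line :: "real measure" where
  "half_line = restrict_space lborel {0..}"

lemma space_half_line [simp]: "space half_line = {0..}"
  by (simp add: half_line_def space_restrict_space)

lemma borel_measurable_half_line: "continuous_on {0..} f \<Longrightarrow> f \<in> borel_measurable half_line"
  for f :: "real \<Rightarrow> complex"
proof -
  assume "continuous_on {0..} f"
  then have "f \<in> borel_measurable (restrict_space borel {0..})"
    by (rule borel_measurable_continuous_on_restrict)
  moreover have "borel_measurable (restrict_space borel {0..}) = (borel_measurable half_line :: (real \<Rightarrow> complex) set)"
    unfolding half_line_def by (intro measurable_cong_sets sets_restrict_space_cong) auto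
  ultimately show ?thesis by simp
qed

lemma has_bochner_integral_half_line_power:
  assumes "a > 0" "m \<ge> 1" "K \<ge> 0"
  shows "has_bochner_integral half_line (\<lambda>s. K / (a + s) ^ Suc m) (K / (real m * a ^ m))"
proof -
  define f where "f s = (if s < 0 then 0 else K / (a + s) ^ Suc m)" for s
  define F where "F s = - (K / real m) * inverse (a + s) ^ m" for s
  have "(\<integral>\<^sup>+x. ennreal (f x) * indicator {0..} x \<partial>lborel) = 0 - F 0"
  proof (rule nn_integral_FTC_atLeast)
    show "f \<in> borel_measurable borel" unfolding f_def by measurable
    fix x :: real assume x: "0 \<le> x"
    show "0 \<le> f x" using x assms by (simp add: f_def)
    have ne: "a + x \<noteq> 0" using x assms by simp
    obtain n where n: "m = Suc n" using assms by (cases m) auto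
    have "((\<lambda>s. inverse (a + s)) has_real_derivative - (inverse (a + x) * inverse (a + x))) (at x)"
      using ne by (auto intro!: derivative_eq_intros)
    from DERIV_cmult[OF DERIV_power[OF this, of m], of "- (K / real m)"]
    have "(F has_real_derivative - (K / real m) *
        (real m * (- (inverse (a + x) * inverse (a + x)) * inverse (a + x) ^ (m - Suc 0)))) (at x)"
      by (simp add: F_def[abs_def])
    also have "- (K / real m) * (real m * (- (inverse (a + x) * inverse (a + x)) * inverse (a + x) ^ (m - Suc 0)))
        = f x"
      using x assms by (simp add: f_def n divide_inverse power_inverse)
    finally show "(F has_real_derivative f x) (at x)" .
  next
    have "filterlim (\<lambda>s. a + s) at_top at_top"
      by (intro filterlim_tendsto_add_at_top[OF tendsto_const] filterlim_ident)
    then have "((\<lambda>s. inverse (a + s)) \<longlongrightarrow> 0) at_top"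
      by (rule tendsto_inverse_0_at_top)
    then have "((\<lambda>s. - (K / real m) * inverse (a + s) ^ m) \<longlongrightarrow> - (K / real m) * 0 ^ m) at_top"
      by (intro tendsto_mult tendsto_const tendsto_power)
    then show "(F \<longlongrightarrow> 0) at_top" using assms by (simp add: F_def[abs_def] power_0_left)
  qed
  then have nn: "(\<integral>\<^sup>+x. ennreal (f x) \<partial>half_line) = ennreal (K / (real m * a ^ m))"
    by (simp add: half_line_def nn_integral_restrict_space F_def divide_inverse power_inverse mult_ac)
  have "has_bochner_integral half_line f (K / (real m * a ^ m))"
  proof (rule has_bochner_integral_nn_integral)
    have "f \<in> borel_measurable lborel" unfolding f_def by measurable
    then show "f \<in> borel_measurable half_line"
      unfolding half_line_def by (rule measurable_restrict_space1)
    show "AE x in half_line. 0 \<le> f x" using assms by (intro AE_I2) (auto simp: f_def)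
  qed (use nn assms in auto)
  then show ?thesis
    by (rule has_bochner_integral_cong[THEN iffD1, rotated 3]) (auto simp: f_def)
qed

text \<open>The Henstock-Kurzweil form of the fundamental theorem is used on bounded intervals because it
  requires no continuity of the derivative.\<close>

lemma half_line_FTC:
  fixes w :: "real \<Rightarrow> complex"
  assumes w: "\<And>s. s \<ge> 0 \<Longrightarrow> (w has_vector_derivative w' s) (at s)"
    and int: "integrable half_line w'" and lim: "(w \<longlongrightarrow> 0) at_top"
  shows "integral\<^sup>L half_line w' = - w 0"
proof -
  have si: "set_integrable lborel {0..} w'"
    using int by (simp add: half_line_def integrable_restrict_space set_integrable_def)
  have "((\<lambda>b. set_lebesgue_integral lborel {0..b} w') \<longlongrightarrow> set_lebesgue_integral lborel {0..} w') at_top"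
    by (rule tendsto_set_lebesgue_integral_at_top[OF _ si]) auto
  moreover have "\<forall>\<^sub>F b in at_top. set_lebesgue_integral lborel {0..b} w' = w b - w 0"
    using eventually_ge_at_top[of "0::real"]
  proof eventually_elim
    case (elim b)
    have "set_integrable lborel {0..b} w'" by (rule set_integrable_subset[OF si]) auto
    then have "set_lebesgue_integral lborel {0..b} w' = integral {0..b} w'"
      by (rule set_borel_integral_eq_integral)
    also have "(w' has_integral w b - w 0) {0..b}"
      using elim w by (intro fundamental_theorem_of_calculus) (auto intro: has_vector_derivative_at_within)
    then have "integral {0..b} w' = w b - w 0" by (rule integral_unique)
    finally show ?case .
  qed
  ultimately have "((\<lambda>b. w b - w 0) \<longlongrightarrow> set_lebesgue_integral lborel {0..} w') at_top"
    by (rule Lim_transform_eventually)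
  moreover have "((\<lambda>b. w b - w 0) \<longlongrightarrow> 0 - w 0) at_top" by (intro tendsto_diff lim tendsto_const)
  ultimately have "set_lebesgue_integral lborel {0..} w' = 0 - w 0"
    by (rule tendsto_unique[rotated]) simp
  then show ?thesis by (simp add: half_line_def integral_restrict_space set_lebesgue_integral_def)
qed

text \<open>Integration backwards along the characteristic of \<partial>_\<phi>+\<partial>_\<tau> through
  (\<phi>,\<tau>).\<close>

definition char_integral :: "(complex \<Rightarrow> complex \<Rightarrow> complex) \<Rightarrow> complex \<Rightarrow> complex \<Rightarrow> complex" where
  "char_integral u \<phi> \<tau> = (\<integral>s. u (\<phi> - of_real s) (\<tau> - of_real s) \<partial>half_line)"

definition transport :: "(complex \<Rightarrow> complex \<Rightarrow> complex) \<Rightarrow> complex \<Rightarrow> complex \<Rightarrow> complex" where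
  "transport u \<phi> \<tau> = deriv (\<lambda>x. u x \<tau>) \<phi> + deriv (\<lambda>y. u \<phi> y) \<tau>"

lemma deriv_shift: "deriv (\<lambda>x. f (x - c)) x = deriv f (x - c)"
  for f :: "complex \<Rightarrow> complex"
proof -
  have "((\<lambda>x. f (x - c)) has_field_derivative D) (at x) \<longleftrightarrow> (f has_field_derivative D) (at (x - c))" for D
    using DERIV_shift[of f D x "-c"] by simp
  then show ?thesis by (simp add: deriv_def)
qed

text \<open>A product domain that is invariant under backward translation along the characteristics, with a
  weight \<open>a\<close> that grows at unit speed along them. Exact unit speed makes the integral of
  a^(-m-1) along a characteristic equal to a^(-m)/m.\<close>

locale translation_domain =
  fixes A X :: "complex set" and a :: "complex \<Rightarrow> real" and \<rho> :: real
  assumes open_A: "open A" and open_X: "open X"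
    and A_shift: "\<And>\<phi> s. \<phi> \<in> A \<Longrightarrow> \<phi> - of_real s \<in> A"
    and X_shift: "\<And>\<tau> s. \<tau> \<in> X \<Longrightarrow> s \<ge> 0 \<Longrightarrow> \<tau> - of_real s \<in> X"
    and a_shift: "\<And>\<tau> s. a (\<tau> - of_real s) = a \<tau> + s"
    and a_lower: "\<And>\<tau>. \<tau> \<in> X \<Longrightarrow> \<rho> < a \<tau>"
    and rho_pos: "0 < \<rho>"
begin

lemma a_pos: "\<tau> \<in> X \<Longrightarrow> 0 < a \<tau>"
  using a_lower rho_pos by (meson less_trans)

lemma decay_bounded:
  assumes "\<And>\<phi> \<tau>. \<phi> \<in> A \<Longrightarrow> \<tau> \<in> X \<Longrightarrow> norm (u \<phi> \<tau>) \<le> K / a \<tau> ^ n" "\<phi> \<in> A" "\<tau> \<in> X" "K \<ge> 0"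
  shows "norm (u \<phi> \<tau>) \<le> K / \<rho> ^ n"
proof -
  have "K / a \<tau> ^ n \<le> K / \<rho> ^ n"
    using assms a_lower[of \<tau>] rho_pos by (intro divide_left_mono power_mono mult_pos_pos) (auto intro!: zero_less_power a_pos)
  then show ?thesis using assms(1)[OF assms(2,3)] by linarith
qed

lemma char_derivative:
  assumes u: "sep_holo A X u" and b: "\<And>\<phi> \<tau>. \<phi> \<in> A \<Longrightarrow> \<tau> \<in> X \<Longrightarrow> norm (u \<phi> \<tau>) \<le> b"
    and \<phi>: "\<phi> \<in> A" and \<tau>: "\<tau> \<in> X" and s: "s \<ge> 0"
  shows "((\<lambda>s. u (\<phi> - of_real s) (\<tau> - of_real s)) has_vector_derivative
    - transport u (\<phi> - of_real s) (\<tau> - of_real s)) (at s)"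
proof -
  let ?D = "transport u (\<phi> - of_real s) (\<tau> - of_real s)"
  have 1: "((\<lambda>t. u (\<phi> - of_real s + t) (\<tau> - of_real s + t)) has_field_derivative ?D) (at (of_real (s - s)))"
    using sep_holo_diag_derivative[OF open_A open_X u b A_shift[OF \<phi>, of s] X_shift[OF \<tau> s]]
    by (simp add: transport_def)
  have 2: "((\<lambda>x. complex_of_real (s - x)) has_vector_derivative -1) (at s)"
    by (auto intro!: derivative_eq_intros simp: has_vector_derivative_def of_real_def)
  have "((\<lambda>t. u (\<phi> - of_real s + t) (\<tau> - of_real s + t)) \<circ> (\<lambda>x. complex_of_real (s - x)) has_vector_derivative -1 * ?D) (at s)"
    by (rule field_vector_diff_chain_at[OF 2]) (use 1 in simp)
  then show ?thesis by (simp add: o_def)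
qed

lemma char_continuous:
  assumes u: "sep_holo A X u" and b: "\<And>\<phi> \<tau>. \<phi> \<in> A \<Longrightarrow> \<tau> \<in> X \<Longrightarrow> norm (u \<phi> \<tau>) \<le> b"
    and \<phi>: "\<phi> \<in> A" and \<tau>: "\<tau> \<in> X"
  shows "continuous_on {0..} (\<lambda>s. u (\<phi> - of_real s) (\<tau> - of_real s))"
  by (intro continuous_at_imp_continuous_on ballI has_vector_derivative_continuous[OF char_derivative[OF u b \<phi> \<tau>]]) auto

text \<open>The decisive gain is the factor 1/m in the bound for the integral.\<close>

lemma char_integrable:
  assumes u: "sep_holo A X u" and m: "m \<ge> 1" and K: "K \<ge> 0"
    and b: "\<And>\<phi> \<tau>. \<phi> \<in> A \<Longrightarrow> \<tau> \<in> X \<Longrightarrow> norm (u \<phi> \<tau>) \<le> K / a \<tau> ^ Suc m"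
    and \<phi>: "\<phi> \<in> A" and \<tau>: "\<tau> \<in> X"
  shows "(\<lambda>s. u (\<phi> - of_real s) (\<tau> - of_real s)) \<in> borel_measurable half_line"
    and "integrable half_line (\<lambda>s. u (\<phi> - of_real s) (\<tau> - of_real s))"
    and "norm (char_integral u \<phi> \<tau>) \<le> K / (real m * a \<tau> ^ m)"
proof -
  let ?u = "\<lambda>s. u (\<phi> - of_real s) (\<tau> - of_real s)" and ?b = "\<lambda>s. K / (a \<tau> + s) ^ Suc m"
  have bb: "norm (u \<phi> \<tau>) \<le> K / \<rho> ^ Suc m" if "\<phi> \<in> A" "\<tau> \<in> X" for \<phi> \<tau>
    by (rule decay_bounded[OF b that K])
  show meas: "?u \<in> borel_measurable half_line"
    by (rule borel_measurable_half_line[OF char_continuous[OF u bb \<phi> \<tau>]])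
  have ds: "norm (?u s) \<le> ?b s" if "s \<ge> 0" for s
    using b[OF A_shift[OF \<phi>, of s] X_shift[OF \<tau> that]] by (simp add: a_shift)
  have bi: "integrable half_line ?b" "(\<integral>s. ?b s \<partial>half_line) = K / (real m * a \<tau> ^ m)"
    using has_bochner_integral_half_line_power[OF a_pos[OF \<tau>] m K] by (auto simp: has_bochner_integral_iff)
  show ui: "integrable half_line ?u"
  proof (rule Bochner_Integration.integrable_bound[OF bi(1) meas AE_I2])
    fix s assume "s \<in> space half_line"
    then show "norm (?u s) \<le> norm (?b s)"
      using order_trans[OF ds[of s] abs_ge_self] by simp
  qed
  have "norm (char_integral u \<phi> \<tau>) \<le> (\<integral>s. norm (?u s) \<partial>half_line)"
    unfolding char_integral_def by (rule integral_norm_bound)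
  also have "\<dots> \<le> (\<integral>s. ?b s \<partial>half_line)"
    by (rule integral_mono) (use ui bi(1) ds in auto)
  finally show "norm (char_integral u \<phi> \<tau>) \<le> K / (real m * a \<tau> ^ m)" using bi(2) by simp
qed

text \<open>Along a characteristic the transport derivative is minus the derivative in s, so the integral
  telescopes to the value at s=0; the contribution from infinity vanishes by decay.\<close>

lemma char_integral_transport:
  assumes v: "sep_holo A X v" and n: "n \<ge> 1" and K: "K \<ge> 0"
    and vb: "\<And>\<phi> \<tau>. \<phi> \<in> A \<Longrightarrow> \<tau> \<in> X \<Longrightarrow> norm (v \<phi> \<tau>) \<le> K / a \<tau> ^ n"
    and \<phi>: "\<phi> \<in> A" and \<tau>: "\<tau> \<in> X"
    and int: "integrable half_line (\<lambda>s. transport v (\<phi> - of_real s) (\<tau> - of_real s))"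
  shows "char_integral (transport v) \<phi> \<tau> = v \<phi> \<tau>"
proof -
  have bb: "norm (v \<phi> \<tau>) \<le> K / \<rho> ^ n" if "\<phi> \<in> A" "\<tau> \<in> X" for \<phi> \<tau>
    by (rule decay_bounded[OF vb that K])
  have "(\<integral>s. - transport v (\<phi> - of_real s) (\<tau> - of_real s) \<partial>half_line) = - v (\<phi> - of_real 0) (\<tau> - of_real 0)"
  proof (rule half_line_FTC)
    show "integrable half_line (\<lambda>s. - transport v (\<phi> - of_real s) (\<tau> - of_real s))" using int by simp
    show "((\<lambda>s. v (\<phi> - of_real s) (\<tau> - of_real s)) has_vector_derivative
        - transport v (\<phi> - of_real s) (\<tau> - of_real s)) (at s)" if "s \<ge> 0" for s
      by (rule char_derivative[OF v bb \<phi> \<tau> that])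
    show "((\<lambda>s. v (\<phi> - of_real s) (\<tau> - of_real s)) \<longlongrightarrow> 0) at_top"
    proof (rule Lim_null_comparison)
      show "\<forall>\<^sub>F s in at_top. norm (v (\<phi> - of_real s) (\<tau> - of_real s)) \<le> K / (a \<tau> + s) ^ n"
        using eventually_ge_at_top[of 0]
      proof eventually_elim
        case (elim s)
        then show ?case using vb[OF A_shift[OF \<phi>, of s] X_shift[OF \<tau> elim]] by (simp add: a_shift)
      qed
      have "filterlim (\<lambda>s. (a \<tau> + s) ^ n) at_top at_top"
        using n by (intro filterlim_pow_at_top filterlim_tendsto_add_at_top[OF tendsto_const] filterlim_ident) auto
      then show "((\<lambda>s. K / (a \<tau> + s) ^ n) \<longlongrightarrow> 0) at_top"
        by (rule tendsto_divide_0[OF tendsto_const filterlim_at_top_imp_at_infinity])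
    qed
  qed
  then show ?thesis by (simp add: char_integral_def)
qed

text \<open>The integral inverts the transport operator from the right: differentiation under the integral
  moves the operator onto u, and then \<open>char_integral_transport\<close> applies to u itself.\<close>

lemma char_integral_properties:
  assumes u: "sep_holo A X u" and m: "m \<ge> 1" and K: "K \<ge> 0"
    and b: "\<And>\<phi> \<tau>. \<phi> \<in> A \<Longrightarrow> \<tau> \<in> X \<Longrightarrow> norm (u \<phi> \<tau>) \<le> K / a \<tau> ^ Suc m"
  shows "sep_holo A X (char_integral u)"
    and "\<phi> \<in> A \<Longrightarrow> \<tau> \<in> X \<Longrightarrow> transport (char_integral u) \<phi> \<tau> = u \<phi> \<tau>"
proof -
  have meas: "(\<lambda>s. u (\<phi> - of_real s) (\<tau> - of_real s)) \<in> borel_measurable half_line"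
    if "\<phi> \<in> A" "\<tau> \<in> X" for \<phi> \<tau>
    by (rule char_integrable(1)[OF u m K b that])
  have ds': "norm (u (\<phi> - of_real s) (\<tau> - of_real s)) \<le> K / (\<rho> + s) ^ Suc m"
    if "\<phi> \<in> A" "\<tau> \<in> X" "s \<in> space half_line" for \<phi> \<tau> s
  proof -
    have "norm (u (\<phi> - of_real s) (\<tau> - of_real s)) \<le> K / (a \<tau> + s) ^ Suc m"
      using b[OF A_shift[OF that(1), of s] X_shift[OF that(2), of s]] that(3) by (simp add: a_shift)
    also have "\<dots> \<le> K / (\<rho> + s) ^ Suc m"
      using that K rho_pos a_lower[of \<tau>] a_pos[of \<tau>]
      by (intro divide_left_mono power_mono mult_pos_pos zero_less_power) auto
    finally show ?thesis .
  qed
  have bi': "integrable half_line (\<lambda>s. K / (\<rho> + s) ^ Suc m)"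
    using has_bochner_integral_half_line_power[OF rho_pos m K] by (simp add: has_bochner_integral_iff)
  have holx: "(\<lambda>x. u x \<tau>) holomorphic_on A" if "\<tau> \<in> X" for \<tau> using u that by (simp add: sep_holo_def)
  have holy: "(\<lambda>y. u \<phi> y) holomorphic_on X" if "\<phi> \<in> A" for \<phi> using u that by (simp add: sep_holo_def)
  have Dx: "integrable half_line (\<lambda>s. deriv (\<lambda>x. u x (\<tau> - of_real s)) (\<phi> - of_real s))"
    "((\<lambda>x. char_integral u x \<tau>) has_field_derivative (\<integral>s. deriv (\<lambda>x. u x (\<tau> - of_real s)) (\<phi> - of_real s) \<partial>half_line)) (at \<phi>)"
    if "\<phi> \<in> A" "\<tau> \<in> X" for \<phi> \<tau>
  proof -
    have h: "(\<lambda>x. u (x - of_real s) (\<tau> - of_real s)) holomorphic_on A" if "s \<in> space half_line" for s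
    proof -
      have "((\<lambda>x. u x (\<tau> - of_real s)) \<circ> (\<lambda>x. x - of_real s)) holomorphic_on A"
        by (rule holomorphic_on_compose_gen[OF _ holx[OF X_shift[OF \<open>\<tau> \<in> X\<close>, of s]]])
          (use that A_shift in \<open>auto intro: holomorphic_intros\<close>)
      then show ?thesis by (simp add: o_def)
    qed
    have d: "deriv (\<lambda>x. u (x - of_real s) (\<tau> - of_real s)) \<phi> = deriv (\<lambda>x. u x (\<tau> - of_real s)) (\<phi> - of_real s)" for s
      by (rule deriv_shift[of "\<lambda>x. u x (\<tau> - of_real s)"])
    note P = has_field_derivative_integral_param[where M = half_line and f = "\<lambda>x s. u (x - of_real s) (\<tau> - of_real s)",
        OF open_A \<open>\<phi> \<in> A\<close> h meas[OF _ \<open>\<tau> \<in> X\<close>] bi' ds'[OF _ \<open>\<tau> \<in> X\<close>], unfolded d]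
    from P show "integrable half_line (\<lambda>s. deriv (\<lambda>x. u x (\<tau> - of_real s)) (\<phi> - of_real s))"
      "((\<lambda>x. char_integral u x \<tau>) has_field_derivative (\<integral>s. deriv (\<lambda>x. u x (\<tau> - of_real s)) (\<phi> - of_real s) \<partial>half_line)) (at \<phi>)"
      by (simp_all add: char_integral_def)
  qed
  have Dy: "integrable half_line (\<lambda>s. deriv (\<lambda>y. u (\<phi> - of_real s) y) (\<tau> - of_real s))"
    "((\<lambda>y. char_integral u \<phi> y) has_field_derivative (\<integral>s. deriv (\<lambda>y. u (\<phi> - of_real s) y) (\<tau> - of_real s) \<partial>half_line)) (at \<tau>)"
    if "\<phi> \<in> A" "\<tau> \<in> X" for \<phi> \<tau>
  proof -
    have h: "(\<lambda>y. u (\<phi> - of_real s) (y - of_real s)) holomorphic_on X" if "s \<in> space half_line" for s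
    proof -
      have "((\<lambda>y. u (\<phi> - of_real s) y) \<circ> (\<lambda>y. y - of_real s)) holomorphic_on X"
        by (rule holomorphic_on_compose_gen[OF _ holy[OF A_shift[OF \<open>\<phi> \<in> A\<close>, of s]]])
          (use that X_shift in \<open>auto intro: holomorphic_intros\<close>)
      then show ?thesis by (simp add: o_def)
    qed
    have d: "deriv (\<lambda>y. u (\<phi> - of_real s) (y - of_real s)) \<tau> = deriv (\<lambda>y. u (\<phi> - of_real s) y) (\<tau> - of_real s)" for s
      by (rule deriv_shift[of "\<lambda>y. u (\<phi> - of_real s) y"])
    note P = has_field_derivative_integral_param[where M = half_line and f = "\<lambda>y s. u (\<phi> - of_real s) (y - of_real s)",
        OF open_X \<open>\<tau> \<in> X\<close> h meas[OF \<open>\<phi> \<in> A\<close>] bi' ds'[OF \<open>\<phi> \<in> A\<close>], unfolded d]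
    from P show "integrable half_line (\<lambda>s. deriv (\<lambda>y. u (\<phi> - of_real s) y) (\<tau> - of_real s))"
      "((\<lambda>y. char_integral u \<phi> y) has_field_derivative (\<integral>s. deriv (\<lambda>y. u (\<phi> - of_real s) y) (\<tau> - of_real s) \<partial>half_line)) (at \<tau>)"
      by (simp_all add: char_integral_def)
  qed
  show "sep_holo A X (char_integral u)"
    unfolding sep_holo_def holomorphic_on_open[OF open_A] holomorphic_on_open[OF open_X]
    using Dx(2) Dy(2) by blast
  show "transport (char_integral u) \<phi> \<tau> = u \<phi> \<tau>" if "\<phi> \<in> A" "\<tau> \<in> X" for \<phi> \<tau>
  proof -
    have "transport (char_integral u) \<phi> \<tau> = char_integral (transport u) \<phi> \<tau>"
      unfolding transport_def char_integral_def[of "\<lambda>\<phi> \<tau>. deriv (\<lambda>x. u x \<tau>) \<phi> + deriv (\<lambda>y. u \<phi> y) \<tau>"]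
      using Dx[OF that] Dy[OF that] by (simp add: DERIV_imp_deriv)
    also have "\<dots> = u \<phi> \<tau>"
      by (rule char_integral_transport[OF u _ K b that])
        (use Dx(1)[OF that] Dy(1)[OF that] in \<open>auto simp: transport_def\<close>)
    finally show ?thesis .
  qed
qed

text \<open>The a priori form of the same estimate: a decaying v is recovered from its transport
  derivative, so any decay of v improves to the decay dictated by that derivative.\<close>

lemma transport_decay:
  assumes v: "sep_holo A X v" and m: "m \<ge> 1" and K: "K \<ge> 0" and K': "K' \<ge> 0" and n: "n \<ge> 1"
    and vb: "\<And>\<phi> \<tau>. \<phi> \<in> A \<Longrightarrow> \<tau> \<in> X \<Longrightarrow> norm (v \<phi> \<tau>) \<le> K' / a \<tau> ^ n"
    and u: "sep_holo A X u" and uv: "\<And>\<phi> \<tau>. \<phi> \<in> A \<Longrightarrow> \<tau> \<in> X \<Longrightarrow> transport v \<phi> \<tau> = u \<phi> \<tau>"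
    and ub: "\<And>\<phi> \<tau>. \<phi> \<in> A \<Longrightarrow> \<tau> \<in> X \<Longrightarrow> norm (u \<phi> \<tau>) \<le> K / a \<tau> ^ Suc m"
    and \<phi>: "\<phi> \<in> A" and \<tau>: "\<tau> \<in> X"
  shows "norm (v \<phi> \<tau>) \<le> K / (real m * a \<tau> ^ m)"
proof -
  have along: "transport v (\<phi> - of_real s) (\<tau> - of_real s) = u (\<phi> - of_real s) (\<tau> - of_real s)"
    if "s \<in> space half_line" for s
    by (rule uv[OF A_shift[OF \<phi>] X_shift[OF \<tau>]]) (use that in simp)
  have "v \<phi> \<tau> = char_integral (transport v) \<phi> \<tau>"
  proof (rule char_integral_transport[OF v n K' vb \<phi> \<tau>, symmetric])
    show "integrable half_line (\<lambda>s. transport v (\<phi> - of_real s) (\<tau> - of_real s))"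
      using char_integrable(2)[OF u m K ub \<phi> \<tau>] along
      by (subst Bochner_Integration.integrable_cong[OF refl]) auto
  qed
  also have "\<dots> = char_integral u \<phi> \<tau>"
    unfolding char_integral_def by (rule Bochner_Integration.integral_cong[OF refl along])
  finally show ?thesis using char_integrable(3)[OF u m K ub \<phi> \<tau>] by simp
qed

end

section \<open>Lipschitz estimates with weights\<close>

lemma norm_power_diff_le:
  fixes x y :: complex
  assumes "norm x \<le> B" "norm y \<le> B" "norm (x - y) \<le> \<kappa>" "B \<ge> 1"
  shows "norm (x ^ n - y ^ n) \<le> real n * B ^ n * \<kappa>"
proof (induction n)
  case 0
  then show ?case by simp
next
  case (Suc n)
  have k: "\<kappa> \<ge> 0" using assms(3) norm_ge_zero order_trans by blast
  have B0: "B \<ge> 0" using assms by simp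
  have "x ^ Suc n - y ^ Suc n = x * (x ^ n - y ^ n) + (x - y) * y ^ n" by (simp add: algebra_simps)
  then have "norm (x ^ Suc n - y ^ Suc n) \<le> norm x * norm (x ^ n - y ^ n) + norm (x - y) * norm y ^ n"
    using norm_triangle_ineq[of "x * (x ^ n - y ^ n)" "(x - y) * y ^ n"] by (simp add: norm_mult norm_power)
  also have "\<dots> \<le> B * (real n * B ^ n * \<kappa>) + \<kappa> * B ^ n"
    using assms Suc B0 k by (intro add_mono mult_mono power_mono) auto
  also have "\<kappa> * B ^ n \<le> \<kappa> * B ^ Suc n"
    using assms k by (intro mult_left_mono power_increasing) auto
  finally show ?case by (simp add: algebra_simps)
qed

lemma norm_prod_power_diff_le:
  fixes x y :: "'i \<Rightarrow> complex"
  assumes "finite S" and B: "B \<ge> 1" and k: "\<kappa> \<ge> 0"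
    and "\<And>i. norm (x i) \<le> B" "\<And>i. norm (y i) \<le> B" "\<And>i. norm (x i - y i) \<le> \<kappa>"
  shows "norm ((\<Prod>i\<in>S. x i ^ m i) - (\<Prod>i\<in>S. y i ^ m i)) \<le> real (sum m S) * B ^ sum m S * \<kappa>"
  using assms(1)
proof (induction S)
  case empty
  then show ?case by simp
next
  case (insert j S)
  have B0: "B \<ge> 0" using B by simp
  have "(\<Prod>i\<in>insert j S. x i ^ m i) - (\<Prod>i\<in>insert j S. y i ^ m i)
    = x j ^ m j * ((\<Prod>i\<in>S. x i ^ m i) - (\<Prod>i\<in>S. y i ^ m i)) + (x j ^ m j - y j ^ m j) * (\<Prod>i\<in>S. y i ^ m i)"
    using insert.hyps by (simp add: algebra_simps)
  also have "norm \<dots>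
    \<le> norm (x j ^ m j) * norm ((\<Prod>i\<in>S. x i ^ m i) - (\<Prod>i\<in>S. y i ^ m i)) + norm (x j ^ m j - y j ^ m j) * norm (\<Prod>i\<in>S. y i ^ m i)"
    by (rule order_trans[OF norm_triangle_ineq]) (simp add: norm_mult)
  also have "\<dots> \<le> B ^ m j * (real (sum m S) * B ^ sum m S * \<kappa>) + (real (m j) * B ^ m j * \<kappa>) * B ^ sum m S"
  proof (intro add_mono mult_mono norm_power_diff_le insert.IH assms)
    show "norm (x j ^ m j) \<le> B ^ m j" using assms by (simp add: norm_power power_mono)
    have "norm (\<Prod>i\<in>S. y i ^ m i) = (\<Prod>i\<in>S. norm (y i) ^ m i)" by (simp add: norm_power flip: prod_norm)
    also have "\<dots> \<le> (\<Prod>i\<in>S. B ^ m i)" by (intro prod_mono conjI power_mono assms) auto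
    finally show "norm (\<Prod>i\<in>S. y i ^ m i) \<le> B ^ sum m S" by (simp add: power_sum)
  qed (use B0 k in auto)
  also have "\<dots> = real (sum m (insert j S)) * B ^ sum m (insert j S) * \<kappa>"
    using insert.hyps by (simp add: algebra_simps power_add)
  finally show ?case .
qed

lemma tdeg_le_weighted_order: "tdeg \<alpha> \<le> weighted_order \<alpha>"
  unfolding tdeg_def weighted_order_def by (intro sum_mono) (simp add: weight_def)

lemma vmon_weight_scaling:
  assumes "a \<noteq> 0"
  shows "vmon \<alpha> (\<chi> i. z $ i / of_real a ^ weight i) = vmon \<alpha> z / of_real a ^ weighted_order \<alpha>"
  by (simp add: vmon_def weighted_order_def power_divide prod_dividef power_sum flip: power_mult)

text \<open>In the rescaled coordinates y_i=a^(w_i)z_i both points are bounded by B, and a monomial of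
  weighted order w scales by a^(-w).\<close>

lemma norm_vmon_diff_weighted:
  assumes a: "a > 0" and B: "B \<ge> 1" and k: "\<kappa> \<ge> 0"
    and "\<And>i. norm (z $ i) \<le> B / a ^ weight i" "\<And>i. norm (z' $ i) \<le> B / a ^ weight i"
    and "\<And>i. norm (z $ i - z' $ i) \<le> \<kappa> / a ^ weight i"
  shows "norm (vmon \<alpha> z - vmon \<alpha> z') \<le> real (tdeg \<alpha>) * B ^ tdeg \<alpha> * \<kappa> / a ^ weighted_order \<alpha>"
proof -
  define y where "y w = (\<chi> i. w $ i * of_real a ^ weight i)" for w :: "complex^4"
  have zy: "vmon \<alpha> w = vmon \<alpha> (y w) / of_real a ^ weighted_order \<alpha>" for w
    using vmon_weight_scaling[of a \<alpha> "y w"] a by (simp add: y_def)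
  have yn: "norm (y w $ i) = norm (w $ i) * a ^ weight i" for w i
    using a by (simp add: y_def norm_mult norm_power)
  have yd: "norm (y z $ i - y z' $ i) = norm (z $ i - z' $ i) * a ^ weight i" for i
    using a by (simp add: y_def norm_mult norm_power flip: left_diff_distrib)
  have "norm (vmon \<alpha> (y z) - vmon \<alpha> (y z')) \<le> real (tdeg \<alpha>) * B ^ tdeg \<alpha> * \<kappa>"
    unfolding vmon_def tdeg_def
  proof (rule norm_prod_power_diff_le)
    have p: "0 < a ^ weight i" for i using a by simp
    show "norm (y z $ i) \<le> B" "norm (y z' $ i) \<le> B" "norm (y z $ i - y z' $ i) \<le> \<kappa>" for i
      using assms(4-6)[of i] p[of i] unfolding yn yd by (simp_all add: pos_le_divide_eq)
  qed (use B k in auto)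
  then have "norm (vmon \<alpha> (y z) - vmon \<alpha> (y z')) / a ^ weighted_order \<alpha>
      \<le> real (tdeg \<alpha>) * B ^ tdeg \<alpha> * \<kappa> / a ^ weighted_order \<alpha>"
    using a by (intro divide_right_mono) auto
  moreover have "norm (vmon \<alpha> z - vmon \<alpha> z') = norm (vmon \<alpha> (y z) - vmon \<alpha> (y z')) / a ^ weighted_order \<alpha>"
    using a by (simp add: zy[of z] zy[of z'] norm_divide norm_power flip: diff_divide_distrib)
  ultimately show ?thesis by simp
qed

text \<open>Terms of weighted order above k only help: since the weighted order dominates the total degree
  n, the surplus factor a^(k-w) turns B^n into (B/a_0)^n, and for a_0 large the
  remaining series converges.\<close>

lemma pseries_weighted_lipschitz:
  fixes g :: "complex^4 \<Rightarrow> complex"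
  assumes g: "pseries_on d \<rho> g" and \<rho>: "\<rho> > 0"
    and wt: "\<And>\<alpha>. d \<alpha> \<noteq> 0 \<Longrightarrow> k \<le> weighted_order \<alpha>"
  shows "\<exists>C a0. C \<ge> 0 \<and> a0 \<ge> 1 \<and> B / a0 < \<rho> \<and>
    (\<forall>a z z' \<kappa>. a0 \<le> a \<and> \<kappa> \<ge> 0 \<and> (\<forall>i. norm (z $ i) \<le> B / a ^ weight i) \<and>
        (\<forall>i. norm (z' $ i) \<le> B / a ^ weight i) \<and> (\<forall>i. norm (z $ i - z' $ i) \<le> \<kappa> / a ^ weight i) \<longrightarrow>
      norm (g z - g z') \<le> C * \<kappa> / a ^ k)"
proof -
  define B1 where "B1 = max B 1"
  have B1: "B1 \<ge> 1" "B \<le> B1" by (auto simp: B1_def)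
  \<comment> \<open>One factor 2 absorbs the degree through n\<le> 2^n, the other keeps 2B/a_0 away from the radius of convergence.\<close>
  define a0 where "a0 = max 1 (4 * B1 / \<rho>)"
  have a0: "a0 \<ge> 1" "4 * B1 / \<rho> \<le> a0" by (auto simp: a0_def)
  have "4 * B1 \<le> \<rho> * a0" using a0(2) \<rho> by (simp add: pos_divide_le_eq mult.commute)
  then have "2 * B1 / a0 \<le> \<rho> / 2" using a0(1) by (simp add: pos_divide_le_eq)
  then have s: "2 * B1 / a0 < \<rho>" using \<rho> by simp
  define s where "s = 2 * B1 / a0"
  have s0: "0 \<le> s" using B1 a0 by (simp add: s_def)
  have sm: "(\<lambda>\<alpha>. norm (d \<alpha>) * s ^ tdeg \<alpha>) summable_on UNIV"
    by (rule pseries_on_summable[OF g s0]) (use s in \<open>simp add: s_def\<close>)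
  define T where "T = infsum (\<lambda>\<alpha>. norm (d \<alpha>) * s ^ tdeg \<alpha>) UNIV"
  have T: "((\<lambda>\<alpha>. norm (d \<alpha>) * s ^ tdeg \<alpha>) has_sum T) UNIV" using sm by (simp add: T_def)
  have T0: "T \<ge> 0" unfolding T_def using s0 by (intro infsum_nonneg) auto
  have main: "norm (g z - g z') \<le> a0 ^ k * T * \<kappa> / a ^ k"
    if a: "a0 \<le> a" and k: "\<kappa> \<ge> 0" and z: "\<forall>i. norm (z $ i) \<le> B / a ^ weight i"
      and z': "\<forall>i. norm (z' $ i) \<le> B / a ^ weight i" and zz: "\<forall>i. norm (z $ i - z' $ i) \<le> \<kappa> / a ^ weight i"
    for a z z' \<kappa>
  proof -
    have a1: "a \<ge> 1" using a a0 by simp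
    have small: "norm (w $ i) < \<rho>" if "\<forall>i. norm (w $ i) \<le> B / a ^ weight i" for w :: "complex^4" and i
    proof -
      have "norm (w $ i) \<le> B / a ^ weight i" using that by simp
      also have "\<dots> \<le> B1 / a ^ weight i" using B1 a1 by (intro divide_right_mono) auto
      also have "\<dots> \<le> B1 / a0"
      proof (intro divide_left_mono)
        have "a0 \<le> a ^ 1" using a by simp
        also have "\<dots> \<le> a ^ weight i" using a1 by (intro power_increasing) (auto simp: weight_def)
        finally show "a0 \<le> a ^ weight i" .
      qed (use B1 a0 a1 in auto)
      also have "\<dots> \<le> 2 * B1 / a0" using B1 a0 by (intro divide_right_mono) auto
      finally show ?thesis using s by simp
    qed
    have 1: "((\<lambda>\<alpha>. d \<alpha> * vmon \<alpha> z) has_sum g z) UNIV" "((\<lambda>\<alpha>. d \<alpha> * vmon \<alpha> z') has_sum g z') UNIV"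
      using g small[OF z] small[OF z'] by (auto simp: pseries_on_def)
    have 2: "((\<lambda>\<alpha>. d \<alpha> * vmon \<alpha> z + (-1) * (d \<alpha> * vmon \<alpha> z')) has_sum (g z + (-1) * g z')) UNIV"
      by (intro has_sum_add has_sum_cmult_right 1)
    have 3: "((\<lambda>\<alpha>. (a0 ^ k * \<kappa> / a ^ k) * (norm (d \<alpha>) * s ^ tdeg \<alpha>)) has_sum (a0 ^ k * \<kappa> / a ^ k) * T) UNIV"
      by (intro has_sum_cmult_right T)
    have "norm (g z + (-1) * g z') \<le> (a0 ^ k * \<kappa> / a ^ k) * T"
    proof (rule norm_infsum_le[OF 2 3])
      fix \<alpha> :: "nat^4"
      show "norm (d \<alpha> * vmon \<alpha> z + (-1) * (d \<alpha> * vmon \<alpha> z')) \<le> (a0 ^ k * \<kappa> / a ^ k) * (norm (d \<alpha>) * s ^ tdeg \<alpha>)"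
      proof (cases "d \<alpha> = 0")
        case False
        let ?W = "weighted_order \<alpha>" and ?n = "tdeg \<alpha>"
        have kW: "k \<le> ?W" by (rule wt[OF False])
        have bnd: "norm (w $ i) \<le> B1 / a ^ weight i" if "\<forall>i. norm (w $ i) \<le> B / a ^ weight i" for w :: "complex^4" and i
          using that[rule_format, of i] divide_right_mono[OF B1(2), of "a ^ weight i"] a1 by simp
        have "norm (vmon \<alpha> z - vmon \<alpha> z') \<le> real ?n * B1 ^ ?n * \<kappa> / a ^ ?W"
          by (rule norm_vmon_diff_weighted) (use a1 B1 k bnd[OF z] bnd[OF z'] zz in auto)
        also have "\<dots> \<le> 2 ^ ?n * B1 ^ ?n * \<kappa> / a ^ ?W"
        proof -
          have "real ?n \<le> 2 ^ ?n" using of_nat_less_two_power[of ?n, where 'a = real] by simp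
          then show ?thesis using B1 k a1 by (intro divide_right_mono mult_right_mono) auto
        qed
        also have "\<dots> = (2 * B1) ^ ?n * \<kappa> / (a ^ k * a ^ (?W - k))"
          using kW by (simp add: power_mult_distrib flip: power_add)
        also have "\<dots> \<le> (2 * B1) ^ ?n * \<kappa> / (a ^ k * a0 ^ (?W - k))"
          using a a0 a1 B1 k by (intro divide_left_mono mult_left_mono power_mono mult_pos_pos mult_nonneg_nonneg) auto
        also have "\<dots> = (2 * B1) ^ ?n * \<kappa> * a0 ^ k / (a ^ k * a0 ^ ?W)"
          using a0(1) kW by (simp add: power_diff)
        also have "\<dots> \<le> (2 * B1) ^ ?n * \<kappa> * a0 ^ k / (a ^ k * a0 ^ ?n)"
          using a0 a1 B1 k tdeg_le_weighted_order[of \<alpha>]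
          by (intro divide_left_mono mult_left_mono power_increasing mult_pos_pos mult_nonneg_nonneg) auto
        also have "\<dots> = (a0 ^ k * \<kappa> / a ^ k) * s ^ ?n"
          by (simp add: s_def power_divide)
        finally have "norm (vmon \<alpha> z - vmon \<alpha> z') \<le> (a0 ^ k * \<kappa> / a ^ k) * s ^ ?n" .
        then have "norm (d \<alpha>) * norm (vmon \<alpha> z - vmon \<alpha> z') \<le> norm (d \<alpha>) * ((a0 ^ k * \<kappa> / a ^ k) * s ^ ?n)"
          by (intro mult_left_mono) auto
        moreover have "d \<alpha> * vmon \<alpha> z + (-1) * (d \<alpha> * vmon \<alpha> z') = d \<alpha> * (vmon \<alpha> z - vmon \<alpha> z')"
          by (simp add: algebra_simps)
        ultimately show ?thesis by (simp add: norm_mult mult_ac)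
      qed simp
    qed
    then show ?thesis by (simp add: mult_ac)
  qed
  have "B / a0 \<le> 2 * B1 / a0" using B1 a0 by (intro divide_right_mono) auto
  then have "B / a0 < \<rho>" using s by simp
  then show ?thesis
    using main a0 T0 by (intro exI[of _ "a0 ^ k * T"] exI[of _ a0]) auto
qed

text \<open>The rate \<open>Suc (weight i)\<close> is one power of 1/a better than the size a^(-w_i) of the
  i-th coordinate. This is the power that integration along the characteristics consumes.\<close>

definition weighted_lipschitz :: "(complex^4 \<Rightarrow> complex^4) \<Rightarrow> real \<Rightarrow> real \<Rightarrow> real \<Rightarrow> bool" where
  "weighted_lipschitz g B C a0 \<longleftrightarrow>
     (\<forall>a z z' \<kappa> i. a0 \<le> a \<and> \<kappa> \<ge> 0 \<and> (\<forall>i. norm (z $ i) \<le> B / a ^ weight i) \<and>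
        (\<forall>i. norm (z' $ i) \<le> B / a ^ weight i) \<and> (\<forall>i. norm (z $ i - z' $ i) \<le> \<kappa> / a ^ weight i) \<longrightarrow>
      norm (g z $ i - g z' $ i) \<le> C * \<kappa> / a ^ Suc (weight i))"

lemma weighted_lipschitz_mono: "weighted_lipschitz g B C a0 \<Longrightarrow> a0 \<le> a1 \<Longrightarrow> weighted_lipschitz g B C a1"
  unfolding weighted_lipschitz_def using order_trans by blast

lemma weighted_lipschitz_exists:
  fixes g :: "complex^4 \<Rightarrow> complex^4"
  assumes d: "\<And>i. pseries_on (d i) \<sigma> (\<lambda>z. g z $ i)" and \<sigma>: "\<sigma> > 0"
    and wt: "\<And>i \<alpha>. d i \<alpha> \<noteq> 0 \<Longrightarrow> Suc (weight i) \<le> weighted_order \<alpha>" and B: "B \<ge> 0"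
  shows "\<exists>C a0. C \<ge> 0 \<and> a0 \<ge> 1 \<and> B / a0 < \<sigma> \<and> weighted_lipschitz g B C a0"
proof -
  define lip_on where "lip_on i C a0 \<longleftrightarrow> (\<forall>a z z' \<kappa>. a0 \<le> a \<and> \<kappa> \<ge> 0 \<and> (\<forall>i. norm (z $ i) \<le> B / a ^ weight i) \<and>
        (\<forall>i. norm (z' $ i) \<le> B / a ^ weight i) \<and> (\<forall>i. norm (z $ i - z' $ i) \<le> \<kappa> / a ^ weight i) \<longrightarrow>
      norm (g z $ i - g z' $ i) \<le> C * \<kappa> / a ^ Suc (weight i))" for i C a0
  have "\<exists>C a0. C \<ge> 0 \<and> a0 \<ge> 1 \<and> B / a0 < \<sigma> \<and> lip_on i C a0" for i
    unfolding lip_on_def by (rule pseries_weighted_lipschitz[OF d \<sigma> wt])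
  then obtain Cf af where Cf: "\<And>i. Cf i \<ge> 0" and af: "\<And>i. af i \<ge> 1" "\<And>i. B / af i < \<sigma>"
    and lf: "\<And>i. lip_on i (Cf i) (af i)" by metis
  define C where "C = (\<Sum>i\<in>UNIV. Cf i)"
  define a0 where "a0 = (\<Sum>i\<in>UNIV. af i)"
  have Ci: "Cf i \<le> C" for i unfolding C_def by (rule member_le_sum) (use Cf in auto)
  have ai: "af i \<le> a0" for i
    unfolding a0_def by (rule member_le_sum) (use af(1) order_trans[OF zero_le_one] in auto)
  have "C \<ge> 0" using Cf[of 1] Ci[of 1] by linarith
  moreover have a01: "a0 \<ge> 1" using af(1)[of 1] ai[of 1] by linarith
  moreover have "B / a0 < \<sigma>"
  proof -
    have "B / a0 \<le> B / af 1" using B ai[of 1] af(1)[of 1] a01 by (intro divide_left_mono) auto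
    then show ?thesis using af(2)[of 1] by simp
  qed
  moreover have "weighted_lipschitz g B C a0"
    unfolding weighted_lipschitz_def
  proof (intro allI impI, elim conjE)
    fix a \<kappa> :: real and z z' :: "complex^4" and i
    assume *: "a0 \<le> a" "0 \<le> \<kappa>" "\<forall>i. norm (z $ i) \<le> B / a ^ weight i"
      "\<forall>i. norm (z' $ i) \<le> B / a ^ weight i" "\<forall>i. norm (z $ i - z' $ i) \<le> \<kappa> / a ^ weight i"
    have "af i \<le> a" using ai[of i] *(1) by simp
    then have "norm (g z $ i - g z' $ i) \<le> Cf i * \<kappa> / a ^ Suc (weight i)"
      using lf[of i] *(2-) unfolding lip_on_def by blast
    also have "\<dots> \<le> C * \<kappa> / a ^ Suc (weight i)"
      using Ci[of i] *(1,2) a01 by (intro divide_right_mono mult_right_mono) auto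
    finally show "norm (g z $ i - g z' $ i) \<le> C * \<kappa> / a ^ Suc (weight i)" .
  qed
  ultimately show ?thesis by blast
qed

section \<open>The linear rotation\<close>

text \<open>The linear field of -I_1 rotates (q_1,q_2) and (p_1,p_2) simultaneously. It is described by
  the index that enters the i-th component and by its sign, so that the four components can be
  treated uniformly.\<close>

definition rot_ix :: "4 \<Rightarrow> 4" where
  "rot_ix i = (if i = 1 then 2 else if i = 2 then 1 else if i = 3 then 4 else 3)"

definition rot_sg :: "4 \<Rightarrow> complex" where
  "rot_sg i = (if i = 1 \<or> i = 3 then -1 else 1)"

definition Jrot :: "complex^4 \<Rightarrow> complex^4" where
  "Jrot z = (\<chi> i. rot_sg i * z $ rot_ix i)"

text \<open>The flow e^(\<phi> J).\<close>

definition rot :: "complex \<Rightarrow> complex^4 \<Rightarrow> complex^4" where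
  "rot \<phi> z = (\<chi> i. cos \<phi> * z $ i + sin \<phi> * Jrot z $ i)"

lemma rot_ix_involution [simp]: "rot_ix (rot_ix i) = i"
  using exhaust_4[of i] by (auto simp: rot_ix_def)

lemma rot_sg_conj [simp]: "rot_sg i * rot_sg (rot_ix i) = -1"
  using exhaust_4[of i] by (auto simp: rot_ix_def rot_sg_def)

lemma weight_rot_ix [simp]: "weight (rot_ix i) = weight i"
  using exhaust_4[of i] by (auto simp: rot_ix_def weight_def)

lemma norm_rot_sg [simp]: "norm (rot_sg i) = 1"
  by (simp add: rot_sg_def)

lemma Jrot_nth: "Jrot z $ i = rot_sg i * z $ rot_ix i"
  by (simp add: Jrot_def)

lemma Jrot_Jrot [simp]: "Jrot (Jrot z) = - z"
  by (simp add: vec_eq_iff Jrot_nth flip: mult.assoc)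

lemma Jrot_rot: "Jrot (rot \<phi> z) = (\<chi> i. cos \<phi> * Jrot z $ i - sin \<phi> * z $ i)"
proof -
  have "Jrot (rot \<phi> z) $ i = cos \<phi> * Jrot z $ i - sin \<phi> * z $ i" for i
  proof -
    have "Jrot (rot \<phi> z) $ i = cos \<phi> * Jrot z $ i + sin \<phi> * Jrot (Jrot z) $ i"
      by (simp add: Jrot_nth rot_def algebra_simps del: Jrot_Jrot rot_ix_involution rot_sg_conj)
    then show ?thesis by simp
  qed
  then show ?thesis by (simp add: vec_eq_iff)
qed

lemma rot_inverse [simp]: "rot \<phi> (rot (-\<phi>) z) = z" "rot (-\<phi>) (rot \<phi> z) = z"
proof -
  have "rot \<phi> (rot (-\<phi>) z) $ i = z $ i" for \<phi> i
  proof -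
    have "rot \<phi> (rot (-\<phi>) z) $ i = cos \<phi> * (cos \<phi> * z $ i - sin \<phi> * Jrot z $ i)
        + sin \<phi> * (cos \<phi> * Jrot z $ i + sin \<phi> * z $ i)"
      by (subst rot_def) (simp only: vec_lambda_beta Jrot_rot, simp add: rot_def)
    also have "\<dots> = ((sin \<phi>)\<^sup>2 + (cos \<phi>)\<^sup>2) * z $ i" by algebra
    finally show ?thesis by simp
  qed
  then have *: "rot \<phi> (rot (-\<phi>) z) = z" for \<phi> by (simp add: vec_eq_iff)
  show "rot \<phi> (rot (-\<phi>) z) = z" by (rule *)
  show "rot (-\<phi>) (rot \<phi> z) = z" using *[of "-\<phi>"] by simp
qed

lemma rot_diff: "rot \<phi> (x - y) = rot \<phi> x - rot \<phi> y"
  by (simp add: vec_eq_iff rot_def Jrot_nth algebra_simps)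

text \<open>Rotation mixes only coordinates of equal weight and therefore respects the weighted norms.\<close>

lemma norm_rot_le:
  assumes "norm (cos \<phi>) \<le> E" "norm (sin \<phi>) \<le> E" and z: "\<And>i. norm (z $ i) \<le> K / a ^ (M + weight i)"
  shows "norm (rot \<phi> z $ i) \<le> 2 * E * K / a ^ (M + weight i)"
proof -
  have E0: "E \<ge> 0" using assms(1) norm_ge_zero order_trans by blast
  have "norm (rot \<phi> z $ i) \<le> norm (cos \<phi> * z $ i) + norm (sin \<phi> * Jrot z $ i)"
    by (simp add: rot_def norm_triangle_ineq)
  also have "\<dots> \<le> E * (K / a ^ (M + weight i)) + E * (K / a ^ (M + weight i))"
    unfolding norm_mult Jrot_nth using z[of i] z[of "rot_ix i"] E0 assms
    by (intro add_mono mult_mono) auto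
  finally show ?thesis by (simp add: algebra_simps)
qed

section \<open>A contraction principle with weights\<close>

text \<open>Banach's principle for the distance sup |u-v|/W. Distances are never formed as suprema; only
  pointwise bounds by multiples of W appear. The set S must contain the limits of sequences
  that converge at the geometric rate of the iteration.\<close>

lemma weighted_contraction_fixed_point:
  fixes T :: "('x \<Rightarrow> complex) \<Rightarrow> 'x \<Rightarrow> complex" and W :: "'x \<Rightarrow> real"
  assumes S0: "S u0" and ST: "\<And>u. S u \<Longrightarrow> S (T u)"
    and bd: "\<And>u x. S u \<Longrightarrow> x \<in> E \<Longrightarrow> norm (u x) \<le> W x"
    and contr: "\<And>u v \<kappa>. S u \<Longrightarrow> S v \<Longrightarrow> \<kappa> \<ge> 0 \<Longrightarrow> (\<And>x. x \<in> E \<Longrightarrow> norm (u x - v x) \<le> \<kappa> * W x) \<Longrightarrow>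
      (\<And>x. x \<in> E \<Longrightarrow> norm (T u x - T v x) \<le> (\<kappa> / 2) * W x)"
    and closed: "\<And>un u. (\<And>n. S (un n)) \<Longrightarrow> (\<And>n x. x \<in> E \<Longrightarrow> norm (un n x - u x) \<le> (4 / 2 ^ n) * W x) \<Longrightarrow> S u"
  shows "\<exists>u. S u \<and> (\<forall>x\<in>E. T u x = u x)"
proof -
  define un where "un n = (T ^^ n) u0" for n
  have Sn: "S (un n)" for n by (induction n) (auto simp: un_def S0 ST)
  have W0: "0 \<le> W x" if "x \<in> E" for x using bd[OF S0 that] norm_ge_zero order_trans by blast
  \<comment> \<open>The first two iterates are both bounded by W, so they are at most 2W apart.\<close>
  have step: "norm (un (Suc n) x - un n x) \<le> (2 / 2 ^ n) * W x" if "x \<in> E" for n x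
    using that
  proof (induction n arbitrary: x)
    case 0
    have "norm (un 1 x - un 0 x) \<le> norm (un 1 x) + norm (un 0 x)" by (rule norm_triangle_ineq4)
    then show ?case using bd[OF Sn[of 1] 0] bd[OF Sn[of 0] 0] by simp
  next
    case (Suc n)
    have "norm (T (un (Suc n)) x - T (un n) x) \<le> ((2 / 2 ^ n) / 2) * W x"
      by (rule contr[OF Sn Sn]) (use Suc in auto)
    then show ?case by (simp add: un_def)
  qed
  have diff: "norm (un (n + k) x - un n x) \<le> (4 / 2 ^ n) * W x" if "x \<in> E" for n k x
  proof -
    have "norm (un (n + k) x - un n x) \<le> (4 / 2 ^ n - 4 / 2 ^ (n + k)) * W x"
    proof (induction k)
      case 0
      then show ?case by simp
    next
      case (Suc k)
      have "norm (un (n + Suc k) x - un n x) \<le> norm (un (Suc (n + k)) x - un (n + k) x) + norm (un (n + k) x - un n x)"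
        using norm_triangle_ineq[of "un (Suc (n + k)) x - un (n + k) x" "un (n + k) x - un n x"] by simp
      also have "\<dots> \<le> (2 / 2 ^ (n + k)) * W x + (4 / 2 ^ n - 4 / 2 ^ (n + k)) * W x"
        using step[OF that, of "n + k"] Suc by (rule add_mono)
      also have "\<dots> = (4 / 2 ^ n - 4 / 2 ^ (n + Suc k)) * W x" by (simp add: field_simps)
      finally show ?case .
    qed
    also have "\<dots> \<le> (4 / 2 ^ n) * W x" using W0[OF that] by (intro mult_right_mono) auto
    finally show ?thesis .
  qed
  have small: "(\<lambda>n. (c / 2 ^ n) * W x) \<longlonglongrightarrow> 0" for c x
  proof -
    have "(\<lambda>n. (c * W x) * (1 / 2) ^ n) \<longlonglongrightarrow> (c * W x) * 0"
      by (intro tendsto_mult tendsto_const LIMSEQ_power_zero) auto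
    then show ?thesis by (simp add: power_divide mult_ac)
  qed
  have cauchy: "convergent (\<lambda>n. un n x)" if "x \<in> E" for x
  proof (rule Cauchy_convergent, rule metric_CauchyI)
    fix e :: real assume "e > 0"
    then have "\<forall>\<^sub>F n in sequentially. (8 / 2 ^ n) * W x < e" using small[of 8 x] by (rule order_tendstoD(2)[rotated])
    then obtain N where N: "(8 / 2 ^ N) * W x < e" by (auto simp: eventually_sequentially)
    show "\<exists>M. \<forall>m\<ge>M. \<forall>n\<ge>M. dist (un m x) (un n x) < e"
    proof (intro exI[of _ N] allI impI)
      fix m n assume "m \<ge> N" "n \<ge> N"
      then have "norm (un m x - un N x) \<le> (4 / 2 ^ N) * W x" "norm (un n x - un N x) \<le> (4 / 2 ^ N) * W x"
        using diff[OF that, of N "m - N"] diff[OF that, of N "n - N"] by auto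
      moreover have "dist (un m x) (un n x) \<le> norm (un m x - un N x) + norm (un n x - un N x)"
        using dist_triangle2[of "un m x" "un n x" "un N x"] by (simp add: dist_norm)
      ultimately show "dist (un m x) (un n x) < e" using N by simp
    qed
  qed
  define u where "u x = lim (\<lambda>n. un n x)" for x
  have lim: "(\<lambda>n. un n x) \<longlonglongrightarrow> u x" if "x \<in> E" for x
    using cauchy[OF that] by (simp add: u_def convergent_LIMSEQ_iff)
  have near: "norm (un n x - u x) \<le> (4 / 2 ^ n) * W x" if "x \<in> E" for n x
  proof (rule LIMSEQ_le_const2)
    have "(\<lambda>k. un (n + k) x) \<longlonglongrightarrow> u x" using LIMSEQ_ignore_initial_segment[OF lim[OF that], of n] by (simp add: add.commute)
    then show "(\<lambda>k. norm (un n x - un (n + k) x)) \<longlonglongrightarrow> norm (un n x - u x)"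
      by (intro tendsto_norm tendsto_diff tendsto_const)
    show "\<exists>N. \<forall>k\<ge>N. norm (un n x - un (n + k) x) \<le> (4 / 2 ^ n) * W x"
      using diff[OF that, of n] by (simp add: norm_minus_commute)
  qed
  have Su: "S u" by (rule closed[OF Sn near])
  have "T u x = u x" if "x \<in> E" for x
  proof -
    have "norm (T u x - u x) \<le> (6 / 2 ^ n) * W x" for n
    proof -
      have "norm (T (un n) x - T u x) \<le> ((4 / 2 ^ n) / 2) * W x"
        by (rule contr[OF Sn Su]) (use near that in auto)
      moreover have "norm (un (Suc n) x - u x) \<le> (4 / 2 ^ Suc n) * W x" by (rule near[OF that])
      moreover have "T (un n) x = un (Suc n) x" by (simp add: un_def)
      moreover have "norm (T u x - u x) \<le> norm (un (Suc n) x - T u x) + norm (un (Suc n) x - u x)"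
        using dist_triangle3[of "T u x" "u x" "un (Suc n) x"] by (simp add: dist_norm)
      ultimately have "norm (T u x - u x) \<le> ((4 / 2 ^ n) / 2) * W x + (4 / 2 ^ Suc n) * W x" by simp
      also have "\<dots> = (4 / 2 ^ n) * W x" by (simp add: field_simps)
      also have "\<dots> \<le> (6 / 2 ^ n) * W x" using W0[OF that] by (intro mult_right_mono divide_right_mono) auto
      finally show ?thesis .
    qed
    then have "norm (T u x - u x) \<le> 0"
      by (intro LIMSEQ_le_const[OF small[of 6 x]]) auto
    then show ?thesis by simp
  qed
  with Su show ?thesis by blast
qed

section \<open>Calculus of the transport operator\<close>

lemma sep_holo_differentiable:
  assumes "sep_holo A X u" "open A" "open X" "\<phi> \<in> A" "\<tau> \<in> X"
  shows "(\<lambda>x. u x \<tau>) field_differentiable (at \<phi>)" "(\<lambda>y. u \<phi> y) field_differentiable (at \<tau>)"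
proof -
  have 1: "(\<lambda>x. u x \<tau>) holomorphic_on A"
    using assms(1,5) unfolding sep_holo_def by simp
  have 2: "(\<lambda>y. u \<phi> y) holomorphic_on X"
    using assms(1,4) unfolding sep_holo_def by simp
  show "(\<lambda>x. u x \<tau>) field_differentiable (at \<phi>)"
    by (rule holomorphic_on_imp_differentiable_at[OF 1 assms(2,4)])
  show "(\<lambda>y. u \<phi> y) field_differentiable (at \<tau>)"
    by (rule holomorphic_on_imp_differentiable_at[OF 2 assms(3,5)])
qed

lemma transport_cong:
  assumes "open A" "open X" "\<phi> \<in> A" "\<tau> \<in> X" and eq: "\<And>\<phi> \<tau>. \<phi> \<in> A \<Longrightarrow> \<tau> \<in> X \<Longrightarrow> u \<phi> \<tau> = v \<phi> \<tau>"
  shows "transport u \<phi> \<tau> = transport v \<phi> \<tau>"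
proof -
  have "deriv (\<lambda>x. u x \<tau>) \<phi> = deriv (\<lambda>x. v x \<tau>) \<phi>"
    by (rule deriv_cong_ev) (use assms eventually_nhds_in_open[of A \<phi>] in \<open>auto elim!: eventually_mono\<close>)
  moreover have "deriv (\<lambda>y. u \<phi> y) \<tau> = deriv (\<lambda>y. v \<phi> y) \<tau>"
    by (rule deriv_cong_ev) (use assms eventually_nhds_in_open[of X \<tau>] in \<open>auto elim!: eventually_mono\<close>)
  ultimately show ?thesis by (simp add: transport_def)
qed

lemma transport_shift:
  assumes "\<And>\<phi> \<tau>. u (\<phi> + p) \<tau> = u \<phi> \<tau>"
  shows "transport u (\<phi> + p) \<tau> = transport u \<phi> \<tau>"
proof -
  have "deriv (\<lambda>x. u x \<tau>) (\<phi> + p) = deriv (\<lambda>x. u (x - p) \<tau>) (\<phi> + p)"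
    using assms[of "x - p" \<tau> for x] by simp
  also have "\<dots> = deriv (\<lambda>x. u x \<tau>) \<phi>"
    using deriv_shift[of "\<lambda>x. u x \<tau>" p "\<phi> + p"] by simp
  finally show ?thesis using assms by (simp add: transport_def)
qed

lemma transport_add:
  assumes "sep_holo A X u" "sep_holo A X v" "open A" "open X" "\<phi> \<in> A" "\<tau> \<in> X"
  shows "transport (\<lambda>\<phi> \<tau>. u \<phi> \<tau> + v \<phi> \<tau>) \<phi> \<tau> = transport u \<phi> \<tau> + transport v \<phi> \<tau>"
  unfolding transport_def
  using sep_holo_differentiable[OF assms(1,3-6)] sep_holo_differentiable[OF assms(2-6)] by simp

lemma transport_diff:
  assumes "sep_holo A X u" "sep_holo A X v" "open A" "open X" "\<phi> \<in> A" "\<tau> \<in> X"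
  shows "transport (\<lambda>\<phi> \<tau>. u \<phi> \<tau> - v \<phi> \<tau>) \<phi> \<tau> = transport u \<phi> \<tau> - transport v \<phi> \<tau>"
  unfolding transport_def
  using sep_holo_differentiable[OF assms(1,3-6)] sep_holo_differentiable[OF assms(2-6)] by simp

lemma sep_holo_transport:
  assumes A: "open A" and X: "open X" and u: "sep_holo A X u"
    and b: "\<And>\<phi> \<tau>. \<phi> \<in> A \<Longrightarrow> \<tau> \<in> X \<Longrightarrow> norm (u \<phi> \<tau>) \<le> b"
  shows "sep_holo A X (transport u)"
proof -
  have 1: "sep_holo A X (\<lambda>x y. deriv (\<lambda>x. u x y) x)" by (rule sep_holo_deriv_fst[OF A X u b])
  have 2: "sep_holo X A (\<lambda>y x. deriv (\<lambda>y. u x y) y)"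
    by (rule sep_holo_deriv_fst[OF X A sep_holo_swap[OF u], of b]) (rule b)
  show ?thesis using 1 2 unfolding sep_holo_def transport_def by (auto intro!: holomorphic_on_add)
qed

lemma sep_holo_uniform_limit:
  assumes A: "open A" and X: "open X" and u: "\<And>n. sep_holo A X (un n)"
    and e: "e \<longlonglongrightarrow> 0" and bd: "\<And>n \<phi> \<tau>. \<phi> \<in> A \<Longrightarrow> \<tau> \<in> X \<Longrightarrow> norm (un n \<phi> \<tau> - u \<phi> \<tau>) \<le> e n"
  shows "sep_holo A X u"
proof -
  have hol: "f holomorphic_on S" if S: "open S" and fn: "\<And>n. fn n holomorphic_on S"
    and b: "\<And>n x. x \<in> S \<Longrightarrow> norm (fn n x - f x) \<le> e n" for S fn and f :: "complex \<Rightarrow> complex"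
  proof (rule holomorphic_uniform_sequence[OF S fn])
    have ul: "uniform_limit S fn f sequentially"
    proof (rule uniform_limitI)
      fix c :: real assume "c > 0"
      then have "\<forall>\<^sub>F n in sequentially. e n < c" using order_tendstoD(2)[OF e] by blast
      then show "\<forall>\<^sub>F n in sequentially. \<forall>x\<in>S. dist (fn n x) (f x) < c"
      proof eventually_elim
        case (elim n)
        then show ?case using b[of _ n] le_less_trans unfolding dist_norm by blast
      qed
    qed
    fix x assume "x \<in> S"
    then obtain d where "d > 0" "cball x d \<subseteq> S" using S open_contains_cball by blast
    then show "\<exists>d>0. cball x d \<subseteq> S \<and> uniform_limit (cball x d) fn f sequentially"
      using uniform_limit_on_subset[OF ul] by blast
  qed
  show ?thesis unfolding sep_holo_def
  proof (intro conjI ballI)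
    fix \<tau> assume "\<tau> \<in> X"
    then show "(\<lambda>\<phi>. u \<phi> \<tau>) holomorphic_on A"
      using u bd unfolding sep_holo_def by - (rule hol[OF A, of "\<lambda>n \<phi>. un n \<phi> \<tau>"], simp_all)
  next
    fix \<phi> assume "\<phi> \<in> A"
    then show "(\<lambda>\<tau>. u \<phi> \<tau>) holomorphic_on X"
      using u bd unfolding sep_holo_def by - (rule hol[OF X, of "\<lambda>n \<tau>. un n \<phi> \<tau>"], simp_all)
  qed
qed

definition vec_holo :: "complex set \<Rightarrow> complex set \<Rightarrow> (complex \<Rightarrow> complex \<Rightarrow> complex^4) \<Rightarrow> bool" where
  "vec_holo A X w \<longleftrightarrow> (\<forall>i. sep_holo A X (\<lambda>\<phi> \<tau>. w \<phi> \<tau> $ i))"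

definition transport_vec :: "(complex \<Rightarrow> complex \<Rightarrow> complex^4) \<Rightarrow> complex \<Rightarrow> complex \<Rightarrow> complex^4" where
  "transport_vec w \<phi> \<tau> = (\<chi> i. transport (\<lambda>\<phi> \<tau>. w \<phi> \<tau> $ i) \<phi> \<tau>)"

lemma vec_holo_add: "vec_holo A X v \<Longrightarrow> vec_holo A X w \<Longrightarrow> vec_holo A X (\<lambda>\<phi> \<tau>. v \<phi> \<tau> + w \<phi> \<tau>)"
  and vec_holo_diff: "vec_holo A X v \<Longrightarrow> vec_holo A X w \<Longrightarrow> vec_holo A X (\<lambda>\<phi> \<tau>. v \<phi> \<tau> - w \<phi> \<tau>)"
  unfolding vec_holo_def sep_holo_def by (auto intro!: holomorphic_intros)

lemma vec_holo_Jrot: "vec_holo A X v \<Longrightarrow> vec_holo A X (\<lambda>\<phi> \<tau>. Jrot (v \<phi> \<tau>))"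
  unfolding vec_holo_def sep_holo_def Jrot_nth by (auto intro!: holomorphic_intros)

lemma vec_holo_rot: "vec_holo A X w \<Longrightarrow> vec_holo A X (\<lambda>\<phi> \<tau>. rot (k * \<phi>) (w \<phi> \<tau>))"
  unfolding vec_holo_def sep_holo_def rot_def Jrot_nth vec_lambda_beta by (auto intro!: holomorphic_intros)

text \<open>The product rule for a rotating frame. With k=1 or -1 it adds or removes the linear part J of the
  field.\<close>

lemma transport_vec_rot:
  assumes w: "vec_holo A X w" and A: "open A" "open X" and \<phi>: "\<phi> \<in> A" "\<tau> \<in> X"
  shows "transport_vec (\<lambda>\<phi> \<tau>. rot (k * \<phi>) (w \<phi> \<tau>)) \<phi> \<tau>
    = (\<chi> i. k * Jrot (rot (k * \<phi>) (w \<phi> \<tau>)) $ i) + rot (k * \<phi>) (transport_vec w \<phi> \<tau>)"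
proof -
  have "transport (\<lambda>\<phi> \<tau>. rot (k * \<phi>) (w \<phi> \<tau>) $ i) \<phi> \<tau>
    = k * Jrot (rot (k * \<phi>) (w \<phi> \<tau>)) $ i + rot (k * \<phi>) (transport_vec w \<phi> \<tau>) $ i" for i
  proof -
    have d1: "((\<lambda>x. w x \<tau> $ j) has_field_derivative deriv (\<lambda>x. w x \<tau> $ j) \<phi>) (at \<phi>)"
      and d2: "((\<lambda>y. w \<phi> y $ j) has_field_derivative deriv (\<lambda>y. w \<phi> y $ j) \<tau>) (at \<tau>)" for j
      using sep_holo_differentiable[of A X "\<lambda>\<phi> \<tau>. w \<phi> \<tau> $ j" \<phi> \<tau>] w A \<phi> unfolding vec_holo_def
      by (auto simp: field_differentiable_derivI)
    have 1: "((\<lambda>x. rot (k * x) (w x \<tau>) $ i) has_field_derivative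
        (- sin (k * \<phi>) * k * w \<phi> \<tau> $ i + cos (k * \<phi>) * deriv (\<lambda>x. w x \<tau> $ i) \<phi>
         + (cos (k * \<phi>) * k * (rot_sg i * w \<phi> \<tau> $ rot_ix i) + sin (k * \<phi>) * (rot_sg i * deriv (\<lambda>x. w x \<tau> $ rot_ix i) \<phi>)))) (at \<phi>)"
      unfolding rot_def Jrot_nth vec_lambda_beta
      by (rule derivative_eq_intros d1 refl | simp)+
    have 2: "((\<lambda>y. rot (k * \<phi>) (w \<phi> y) $ i) has_field_derivative
        (cos (k * \<phi>) * deriv (\<lambda>y. w \<phi> y $ i) \<tau>
         + sin (k * \<phi>) * (rot_sg i * deriv (\<lambda>y. w \<phi> y $ rot_ix i) \<tau>))) (at \<tau>)"
      unfolding rot_def Jrot_nth vec_lambda_beta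
      by (rule derivative_eq_intros d2 refl | simp)+
    show ?thesis
      unfolding transport_def DERIV_imp_deriv[OF 1] DERIV_imp_deriv[OF 2] Jrot_rot
      by (simp add: rot_def Jrot_nth transport_vec_def transport_def algebra_simps)
  qed
  then show ?thesis by (simp add: vec_eq_iff transport_vec_def)
qed

lemma transport_vec_add:
  assumes "vec_holo A X u" "vec_holo A X v" "open A" "open X" "\<phi> \<in> A" "\<tau> \<in> X"
  shows "transport_vec (\<lambda>\<phi> \<tau>. u \<phi> \<tau> + v \<phi> \<tau>) \<phi> \<tau> = transport_vec u \<phi> \<tau> + transport_vec v \<phi> \<tau>"
  using assms transport_add[of A X "\<lambda>\<phi> \<tau>. u \<phi> \<tau> $ i" "\<lambda>\<phi> \<tau>. v \<phi> \<tau> $ i" \<phi> \<tau> for i]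
  by (simp add: vec_eq_iff transport_vec_def vec_holo_def)

lemma transport_vec_diff:
  assumes "vec_holo A X u" "vec_holo A X v" "open A" "open X" "\<phi> \<in> A" "\<tau> \<in> X"
  shows "transport_vec (\<lambda>\<phi> \<tau>. u \<phi> \<tau> - v \<phi> \<tau>) \<phi> \<tau> = transport_vec u \<phi> \<tau> - transport_vec v \<phi> \<tau>"
  using assms transport_diff[of A X "\<lambda>\<phi> \<tau>. u \<phi> \<tau> $ i" "\<lambda>\<phi> \<tau>. v \<phi> \<tau> $ i" \<phi> \<tau> for i]
  by (simp add: vec_eq_iff transport_vec_def vec_holo_def)

lemma vec_holo_compose:
  assumes g: "\<And>i. pseries_on (d i) \<rho> (\<lambda>z. g z $ i)" and s: "0 \<le> s" "s < \<rho>" and A: "open A" "open X"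
    and w: "vec_holo A X w" and b: "\<And>\<phi> \<tau> i. \<phi> \<in> A \<Longrightarrow> \<tau> \<in> X \<Longrightarrow> norm (w \<phi> \<tau> $ i) \<le> s"
  shows "vec_holo A X (\<lambda>\<phi> \<tau>. g (w \<phi> \<tau>))"
  unfolding vec_holo_def sep_holo_def
proof (intro allI conjI ballI)
  fix i \<tau> assume "\<tau> \<in> X"
  then show "(\<lambda>\<phi>. g (w \<phi> \<tau>) $ i) holomorphic_on A"
    by (intro pseries_on_compose_holomorphic[OF g s A(1)]) (use w b in \<open>auto simp: vec_holo_def sep_holo_def\<close>)
next
  fix i \<phi> assume "\<phi> \<in> A"
  then show "(\<lambda>\<tau>. g (w \<phi> \<tau>) $ i) holomorphic_on X"
    by (intro pseries_on_compose_holomorphic[OF g s A(2)]) (use w b in \<open>auto simp: vec_holo_def sep_holo_def\<close>)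
qed

section \<open>The transport equation near an approximate solution\<close>

text \<open>The constant \<open>E\<close> bounds the rotation on the strip, \<open>B\<close> bounds the scaled coordinates of all
  solutions under consideration and \<open>M\<close> is the order to which solutions are compared. Passing to
  the rotating frame and back costs 4E^2, integration gains 1/M; the hypothesis on \<open>M\<close> says
  that the product with the Lipschitz constant \<open>C\<close> is at most 1/2.\<close>

locale contraction_domain = translation_domain A X a \<rho>
  for A X :: "complex set" and a :: "complex \<Rightarrow> real" and \<rho> :: real +
  fixes g :: "complex^4 \<Rightarrow> complex^4" and d :: "4 \<Rightarrow> nat^4 \<Rightarrow> complex" and \<sigma> B C E :: real and M :: nat
  assumes g: "\<And>i. pseries_on (d i) \<sigma> (\<lambda>z. g z $ i)"
    and lip: "weighted_lipschitz g B C \<rho>"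
    and trig: "\<And>\<phi>. \<phi> \<in> A \<Longrightarrow> norm (cos \<phi>) \<le> E" "\<And>\<phi>. \<phi> \<in> A \<Longrightarrow> norm (sin \<phi>) \<le> E"
    and E: "E \<ge> 1" and C: "C \<ge> 0" and M: "M \<ge> 1" "8 * E\<^sup>2 * C \<le> real M"
    and \<rho>1: "\<rho> \<ge> 1" and B: "1 \<le> B" "B / \<rho> < \<sigma>"
begin

lemma norm_le_of_weight_bound:
  fixes y :: "complex^4"
  assumes "\<tau> \<in> X" "norm (y $ i) \<le> B / a \<tau> ^ weight i"
  shows "norm (y $ i) \<le> B / \<rho>"
proof -
  have "\<rho> \<le> a \<tau> ^ 1" using a_lower[OF assms(1)] by simp
  also have "\<dots> \<le> a \<tau> ^ weight i"
    using a_lower[OF assms(1)] \<rho>1 by (intro power_increasing) (auto simp: weight_def)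
  finally have "B / a \<tau> ^ weight i \<le> B / \<rho>"
    using B rho_pos by (intro divide_left_mono) (auto intro: mult_pos_pos less_le_trans)
  then show ?thesis using assms(2) by linarith
qed

lemma compose_g:
  assumes w: "vec_holo A X w" and b: "\<And>\<phi> \<tau> i. \<phi> \<in> A \<Longrightarrow> \<tau> \<in> X \<Longrightarrow> norm (w \<phi> \<tau> $ i) \<le> B / a \<tau> ^ weight i"
  shows "vec_holo A X (\<lambda>\<phi> \<tau>. g (w \<phi> \<tau>))"
  by (rule vec_holo_compose[OF g _ B(2) open_A open_X w norm_le_of_weight_bound[OF _ b]])
    (use B rho_pos in auto)

text \<open>The three ingredients of one step before integration: rotate, apply the Lipschitz bound, rotate
  back.\<close>

lemma contraction_step:
  assumes \<phi>: "\<phi> \<in> A" and \<tau>: "\<tau> \<in> X" and k: "\<kappa> \<ge> 0"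
    and z: "\<And>j. norm (z $ j) \<le> B / a \<tau> ^ weight j" "\<And>j. norm (z' $ j) \<le> B / a \<tau> ^ weight j"
    and y: "z - z' = rot \<phi> y" "\<And>j. norm (y $ j) \<le> \<kappa> / a \<tau> ^ (M + weight j)"
  shows "norm (rot (-\<phi>) (g z - g z') $ i) \<le> (4 * E\<^sup>2 * C * \<kappa>) / a \<tau> ^ Suc (M + weight i)"
proof -
  have a: "a \<tau> > 0" "\<rho> \<le> a \<tau>" using a_pos[OF \<tau>] a_lower[OF \<tau>] by auto
  have d: "norm (z $ j - z' $ j) \<le> (2 * E * \<kappa> / a \<tau> ^ M) / a \<tau> ^ weight j" for j
  proof -
    have "norm (rot \<phi> y $ j) \<le> 2 * E * \<kappa> / a \<tau> ^ (M + weight j)"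
      by (rule norm_rot_le[OF trig[OF \<phi>] y(2)])
    then show ?thesis by (simp add: y(1)[symmetric] power_add)
  qed
  have "2 * E * \<kappa> / a \<tau> ^ M \<ge> 0" using k E a by simp
  then have "norm (g z $ j - g z' $ j) \<le> C * (2 * E * \<kappa> / a \<tau> ^ M) / a \<tau> ^ Suc (weight j)" for j
    using lip a(2) z d unfolding weighted_lipschitz_def by blast
  then have "norm ((g z - g z') $ j) \<le> (2 * E * C * \<kappa>) / a \<tau> ^ (Suc M + weight j)" for j
    by (simp add: power_add mult_ac)
  then have "norm (rot (-\<phi>) (g z - g z') $ i) \<le> 2 * E * (2 * E * C * \<kappa>) / a \<tau> ^ (Suc M + weight i)"
    by (rule norm_rot_le[rotated 2]) (use trig[OF \<phi>] in auto)
  then show ?thesis by (simp add: power2_eq_square mult_ac)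
qed

lemma half_gain:
  assumes k: "\<kappa> \<ge> 0" and x: "x > 0"
  shows "(4 * E\<^sup>2 * C * \<kappa>) / (real (M + n) * x) \<le> (\<kappa> / 2) / x"
proof -
  have "4 * E\<^sup>2 * C * \<kappa> \<le> (real M / 2) * \<kappa>" using M k by (intro mult_right_mono) auto
  also have "\<dots> \<le> (\<kappa> / 2) * real (M + n)" using k by (simp add: field_simps)
  finally have "4 * E\<^sup>2 * C * \<kappa> / real (M + n) \<le> \<kappa> / 2"
    using M by (simp add: pos_divide_le_eq)
  then have "4 * E\<^sup>2 * C * \<kappa> / real (M + n) / x \<le> (\<kappa> / 2) / x"
    using x by (intro divide_right_mono) auto
  then show ?thesis by (simp add: divide_divide_eq_left)
qed

text \<open>In the rotating frame the difference y of two solutions satisfies D y=e^(-\<phi> J)(g(w)-g(w')).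
  A bound \<kappa> a^(-M-w_i) for y implies the same bound with \<kappa>/2, hence y=0.\<close>

lemma solution_unique:
  assumes w: "vec_holo A X w" "vec_holo A X w'"
    and bw: "\<And>\<phi> \<tau> i. \<phi> \<in> A \<Longrightarrow> \<tau> \<in> X \<Longrightarrow> norm (w \<phi> \<tau> $ i) \<le> B / a \<tau> ^ weight i"
    and bw': "\<And>\<phi> \<tau> i. \<phi> \<in> A \<Longrightarrow> \<tau> \<in> X \<Longrightarrow> norm (w' \<phi> \<tau> $ i) \<le> B / a \<tau> ^ weight i"
    and eq: "\<And>\<phi> \<tau>. \<phi> \<in> A \<Longrightarrow> \<tau> \<in> X \<Longrightarrow> transport_vec w \<phi> \<tau> = Jrot (w \<phi> \<tau>) + g (w \<phi> \<tau>)"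
    and eq': "\<And>\<phi> \<tau>. \<phi> \<in> A \<Longrightarrow> \<tau> \<in> X \<Longrightarrow> transport_vec w' \<phi> \<tau> = Jrot (w' \<phi> \<tau>) + g (w' \<phi> \<tau>)"
    and near: "\<And>\<phi> \<tau> i. \<phi> \<in> A \<Longrightarrow> \<tau> \<in> X \<Longrightarrow> norm (w \<phi> \<tau> $ i - w' \<phi> \<tau> $ i) \<le> K / a \<tau> ^ (M + weight i)"
    and K: "K \<ge> 0" and \<phi>: "\<phi> \<in> A" and \<tau>: "\<tau> \<in> X"
  shows "w \<phi> \<tau> = w' \<phi> \<tau>"
proof -
  have gw: "vec_holo A X (\<lambda>\<phi> \<tau>. g (w \<phi> \<tau>))" "vec_holo A X (\<lambda>\<phi> \<tau>. g (w' \<phi> \<tau>))"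
    using compose_g[OF w(1) bw] compose_g[OF w(2) bw'] by auto
  define y where "y \<phi> \<tau> = rot (- \<phi>) (w \<phi> \<tau> - w' \<phi> \<tau>)" for \<phi> \<tau>
  define G where "G \<phi> \<tau> = rot (- \<phi>) (g (w \<phi> \<tau>) - g (w' \<phi> \<tau>))" for \<phi> \<tau>
  have yh: "vec_holo A X y"
    using vec_holo_rot[OF vec_holo_diff[OF w], of "-1"] by (simp add: y_def[abs_def])
  have Gh: "vec_holo A X G"
    using vec_holo_rot[OF vec_holo_diff[OF gw], of "-1"] by (simp add: G_def[abs_def])
  have ty: "transport_vec y \<phi> \<tau> = G \<phi> \<tau>" if "\<phi> \<in> A" "\<tau> \<in> X" for \<phi> \<tau>
  proof -
    have "transport_vec y \<phi> \<tau> = - Jrot (y \<phi> \<tau>) + rot (-\<phi>) (transport_vec (\<lambda>\<phi> \<tau>. w \<phi> \<tau> - w' \<phi> \<tau>) \<phi> \<tau>)"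
      using transport_vec_rot[OF vec_holo_diff[OF w] open_A open_X that, of "-1"]
      by (simp add: y_def[abs_def] vec_eq_iff)
    also have "transport_vec (\<lambda>\<phi> \<tau>. w \<phi> \<tau> - w' \<phi> \<tau>) \<phi> \<tau>
        = Jrot (w \<phi> \<tau> - w' \<phi> \<tau>) + (g (w \<phi> \<tau>) - g (w' \<phi> \<tau>))"
      unfolding transport_vec_diff[OF w open_A open_X that] eq[OF that] eq'[OF that]
      by (simp add: vec_eq_iff Jrot_nth algebra_simps)
    also have "- Jrot (y \<phi> \<tau>) + rot (-\<phi>) (Jrot (w \<phi> \<tau> - w' \<phi> \<tau>) + (g (w \<phi> \<tau>) - g (w' \<phi> \<tau>))) = G \<phi> \<tau>"
      by (simp add: y_def G_def vec_eq_iff rot_def Jrot_nth algebra_simps)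
    finally show ?thesis .
  qed
  have inv: "w \<phi> \<tau> - w' \<phi> \<tau> = rot \<phi> (y \<phi> \<tau>)" for \<phi> \<tau> by (simp add: y_def)
  have half: "norm (y \<phi> \<tau> $ i) \<le> (\<kappa> / 2) / a \<tau> ^ (M + weight i)"
    if k: "\<kappa> \<ge> 0" and yk: "\<And>\<phi> \<tau> i. \<phi> \<in> A \<Longrightarrow> \<tau> \<in> X \<Longrightarrow> norm (y \<phi> \<tau> $ i) \<le> \<kappa> / a \<tau> ^ (M + weight i)"
      and \<phi>: "\<phi> \<in> A" and \<tau>: "\<tau> \<in> X" for \<kappa> \<phi> \<tau> i
  proof -
    have "norm (y \<phi> \<tau> $ i) \<le> (4 * E\<^sup>2 * C * \<kappa>) / (real (M + weight i) * a \<tau> ^ (M + weight i))"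
    proof (rule transport_decay[where v = "\<lambda>\<phi> \<tau>. y \<phi> \<tau> $ i" and u = "\<lambda>\<phi> \<tau>. G \<phi> \<tau> $ i" and n = "M + weight i" and K' = \<kappa>])
      show "sep_holo A X (\<lambda>\<phi> \<tau>. y \<phi> \<tau> $ i)" "sep_holo A X (\<lambda>\<phi> \<tau>. G \<phi> \<tau> $ i)"
        using yh Gh by (auto simp: vec_holo_def)
      show "transport (\<lambda>\<phi> \<tau>. y \<phi> \<tau> $ i) \<phi> \<tau> = G \<phi> \<tau> $ i" if "\<phi> \<in> A" "\<tau> \<in> X" for \<phi> \<tau>
        using ty[OF that] by (simp add: transport_vec_def vec_eq_iff)
      show "norm (G \<phi> \<tau> $ i) \<le> 4 * E\<^sup>2 * C * \<kappa> / a \<tau> ^ Suc (M + weight i)" if "\<phi> \<in> A" "\<tau> \<in> X" for \<phi> \<tau>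
        unfolding G_def
        by (rule contraction_step[OF that k bw[OF that] bw'[OF that] inv yk[OF that]])
      show "norm (y \<phi> \<tau> $ i) \<le> \<kappa> / a \<tau> ^ (M + weight i)" if "\<phi> \<in> A" "\<tau> \<in> X" for \<phi> \<tau>
        by (rule yk[OF that])
    qed (use k C E M \<phi> \<tau> in auto)
    also have "\<dots> \<le> (\<kappa> / 2) / a \<tau> ^ (M + weight i)"
      by (rule half_gain[OF k]) (use a_pos[OF \<tau>] in simp)
    finally show ?thesis .
  qed
  have "norm (y \<phi> \<tau> $ i) \<le> (2 * E * K / 2 ^ n) / a \<tau> ^ (M + weight i)" if "\<phi> \<in> A" "\<tau> \<in> X" for n \<phi> \<tau> i
    using that
  proof (induction n arbitrary: \<phi> \<tau> i)
    case 0
    have "norm (y \<phi> \<tau> $ i) \<le> 2 * E * K / a \<tau> ^ (M + weight i)"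
      unfolding y_def by (rule norm_rot_le) (use trig[OF 0(1)] near[OF 0] in auto)
    then show ?case by simp
  next
    case (Suc n)
    have "norm (y \<phi> \<tau> $ i) \<le> ((2 * E * K / 2 ^ n) / 2) / a \<tau> ^ (M + weight i)"
      by (rule half[OF _ Suc.IH Suc.prems]) (use E K in auto)
    then show ?case by (simp add: mult_ac)
  qed
  note shrink = this[OF \<phi> \<tau>]
  have "norm (y \<phi> \<tau> $ i) \<le> 0" for i
  proof (rule LIMSEQ_le_const)
    have "(\<lambda>n. (2 * E * K / a \<tau> ^ (M + weight i)) * (1 / 2) ^ n) \<longlonglongrightarrow> (2 * E * K / a \<tau> ^ (M + weight i)) * 0"
      by (intro tendsto_mult tendsto_const LIMSEQ_power_zero) auto
    then show "(\<lambda>n. (2 * E * K / 2 ^ n) / a \<tau> ^ (M + weight i)) \<longlonglongrightarrow> 0"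
      by (simp add: power_divide mult_ac)
  qed (use shrink[where i = i] in auto)
  then have "y \<phi> \<tau> = 0" by (simp add: vec_eq_iff)
  then have "w \<phi> \<tau> - w' \<phi> \<tau> = rot \<phi> 0" using inv by simp
  then show ?thesis by (simp add: vec_eq_iff rot_def Jrot_nth)
qed

text \<open>Fixed point of \<delta>\<mapsto>\<integral> e^(-\<phi> J)(g(P+e^(\<phi> J)\<delta>)+JP-DP) in the ball
  |\<delta>_i|\<le> a^(-M-w_i). The residual of P is assumed to decay one power faster than needed,
  so that it becomes small when \<rho> is large.\<close>

lemma solution_exists:
  assumes B3: "2 * E \<le> \<rho> ^ M"
    and P: "vec_holo A X P"
    and bP: "\<And>\<phi> \<tau> i. \<phi> \<in> A \<Longrightarrow> \<tau> \<in> X \<Longrightarrow> norm (P \<phi> \<tau> $ i) \<le> (B - 1) / a \<tau> ^ weight i"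
    and res: "\<And>\<phi> \<tau> i. \<phi> \<in> A \<Longrightarrow> \<tau> \<in> X \<Longrightarrow>
      norm ((g (P \<phi> \<tau>) + (Jrot (P \<phi> \<tau>) - transport_vec P \<phi> \<tau>)) $ i) \<le> K / a \<tau> ^ (M + weight i + 2)"
    and K: "K \<ge> 0" "4 * E * K \<le> \<rho>"
    and per: "\<And>\<phi> \<tau>. P (\<phi> + p) \<tau> = P \<phi> \<tau>" "\<And>\<phi>. \<phi> \<in> A \<Longrightarrow> \<phi> + p \<in> A"
      "\<And>\<phi>. cos (\<phi> + p) = cos \<phi>" "\<And>\<phi>. sin (\<phi> + p) = sin \<phi>"
  shows "\<exists>w. vec_holo A X w \<and> (\<forall>\<phi>\<in>A. \<forall>\<tau>\<in>X. transport_vec w \<phi> \<tau> = Jrot (w \<phi> \<tau>) + g (w \<phi> \<tau>)) \<and>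
    (\<forall>\<phi>\<in>A. \<forall>\<tau>\<in>X. \<forall>i. norm (w \<phi> \<tau> $ i - P \<phi> \<tau> $ i) \<le> 2 * E / a \<tau> ^ (M + weight i)) \<and>
    (\<forall>\<phi>\<in>A. \<forall>\<tau>\<in>X. \<forall>i. norm (w \<phi> \<tau> $ i) \<le> B / a \<tau> ^ weight i) \<and>
    (\<forall>\<phi>\<in>A. \<forall>\<tau>\<in>X. w (\<phi> + p) \<tau> = w \<phi> \<tau>)"
proof -
  \<comment> \<open>An unknown u collects the components of \<delta> as one scalar function, which v turns back into a vector; G is the candidate solution and N the integrand of the operator T.\<close>
  define Dom where "Dom = (UNIV :: 4 set) \<times> A \<times> X"
  define W where "W x = (case x of (i, \<phi>, \<tau>) \<Rightarrow> 1 / a \<tau> ^ (M + weight i))" for x :: "4 \<times> complex \<times> complex"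
  define S where "S u \<longleftrightarrow> (\<forall>i. sep_holo A X (\<lambda>\<phi> \<tau>. u (i, \<phi>, \<tau>))) \<and> (\<forall>x\<in>Dom. norm (u x) \<le> W x)
      \<and> (\<forall>i. \<forall>\<phi>\<in>A. \<forall>\<tau>\<in>X. u (i, \<phi> + p, \<tau>) = u (i, \<phi>, \<tau>))" for u :: "4 \<times> complex \<times> complex \<Rightarrow> complex"
  define v where "v u \<phi> \<tau> = (\<chi> i. u (i, \<phi>, \<tau>))" for u :: "4 \<times> complex \<times> complex \<Rightarrow> complex" and \<phi> \<tau>
  define G where "G u \<phi> \<tau> = P \<phi> \<tau> + rot \<phi> (v u \<phi> \<tau>)" for u \<phi> \<tau>
  define R where "R \<phi> \<tau> = Jrot (P \<phi> \<tau>) - transport_vec P \<phi> \<tau>" for \<phi> \<tau>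
  define N where "N u \<phi> \<tau> = rot (-\<phi>) (g (G u \<phi> \<tau>) + R \<phi> \<tau>)" for u \<phi> \<tau>
  define T where "T u x = (case x of (i, \<phi>, \<tau>) \<Rightarrow> char_integral (\<lambda>\<phi> \<tau>. N u \<phi> \<tau> $ i) \<phi> \<tau>)"
    for u and x :: "4 \<times> complex \<times> complex"
  have vb: "norm (v u \<phi> \<tau> $ i) \<le> 1 / a \<tau> ^ (M + weight i)" if "S u" "\<phi> \<in> A" "\<tau> \<in> X" for u \<phi> \<tau> i
  proof -
    have "(i, \<phi>, \<tau>) \<in> Dom" using that by (simp add: Dom_def)
    then have "norm (u (i, \<phi>, \<tau>)) \<le> W (i, \<phi>, \<tau>)" using that(1) unfolding S_def by blast
    then show ?thesis by (simp add: v_def W_def)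
  qed
  have rb: "norm (rot \<phi> (v u \<phi> \<tau>) $ i) \<le> 2 * E / a \<tau> ^ (M + weight i)" if "S u" "\<phi> \<in> A" "\<tau> \<in> X" for u \<phi> \<tau> i
    using norm_rot_le[OF trig[OF that(2)] vb[OF that]] by simp
  have Gb: "norm (G u \<phi> \<tau> $ i) \<le> B / a \<tau> ^ weight i" if "S u" "\<phi> \<in> A" "\<tau> \<in> X" for u \<phi> \<tau> i
  proof -
    have "2 * E \<le> a \<tau> ^ M" using B3 power_mono[of \<rho> "a \<tau>" M] a_lower[OF that(3)] rho_pos by linarith
    then have "2 * E / a \<tau> ^ M \<le> 1" using a_pos[OF that(3)] by (simp add: pos_divide_le_eq)
    then have "(2 * E / a \<tau> ^ M) / a \<tau> ^ weight i \<le> 1 / a \<tau> ^ weight i"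
      using a_pos[OF that(3)] by (intro divide_right_mono) auto
    then have "norm (rot \<phi> (v u \<phi> \<tau>) $ i) \<le> 1 / a \<tau> ^ weight i"
      using rb[OF that, of i] by (simp add: power_add)
    moreover have "norm (G u \<phi> \<tau> $ i) \<le> norm (P \<phi> \<tau> $ i) + norm (rot \<phi> (v u \<phi> \<tau>) $ i)"
      by (simp add: G_def norm_triangle_ineq)
    ultimately have "norm (G u \<phi> \<tau> $ i) \<le> (B - 1) / a \<tau> ^ weight i + 1 / a \<tau> ^ weight i"
      using bP[OF that(2,3), of i] by linarith
    then show ?thesis by (simp add: diff_divide_distrib)
  qed
  have Pb: "norm (P \<phi> \<tau> $ i) \<le> B / a \<tau> ^ weight i" if "\<phi> \<in> A" "\<tau> \<in> X" for \<phi> \<tau> i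
    using bP[OF that, of i] divide_right_mono[of "B - 1" B "a \<tau> ^ weight i"] a_pos[OF that(2)] by simp
  have Ph: "sep_holo A X (\<lambda>\<phi> \<tau>. P \<phi> \<tau> $ i)" for i using P by (simp add: vec_holo_def)
  have Rh: "vec_holo A X R"
  proof -
    have "vec_holo A X (transport_vec P)"
      unfolding vec_holo_def transport_vec_def vec_lambda_beta
      using sep_holo_transport[OF open_A open_X Ph norm_le_of_weight_bound[OF _ Pb]] by simp
    then show ?thesis unfolding R_def[abs_def] by (intro vec_holo_diff vec_holo_Jrot P)
  qed
  have vh: "vec_holo A X (v u)" if "S u" for u
    using that by (simp add: S_def vec_holo_def v_def)
  have Gh: "vec_holo A X (G u)" if "S u" for u
    using vec_holo_add[OF P vec_holo_rot[OF vh[OF that], of 1]] by (simp add: G_def[abs_def])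
  have Nh: "vec_holo A X (N u)" if "S u" for u
  proof -
    have "vec_holo A X (\<lambda>\<phi> \<tau>. g (G u \<phi> \<tau>))"
      by (rule compose_g[OF Gh[OF that] Gb[OF that]])
    from vec_holo_rot[OF vec_holo_add[OF this Rh], of "-1"] show ?thesis by (simp add: N_def[abs_def])
  qed
  have Nh': "sep_holo A X (\<lambda>\<phi> \<tau>. N u \<phi> \<tau> $ i)" if "S u" for u i
    using Nh[OF that] by (simp add: vec_holo_def)
  have res': "norm (rot (-\<phi>) (g (P \<phi> \<tau>) + R \<phi> \<tau>) $ i) \<le> (1 / 2) / a \<tau> ^ Suc (M + weight i)"
    if "\<phi> \<in> A" "\<tau> \<in> X" for \<phi> \<tau> i
  proof -
    have r: "norm ((g (P \<phi> \<tau>) + R \<phi> \<tau>) $ j) \<le> K / a \<tau> ^ ((M + 2) + weight j)" for j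
      using res[OF that, of j] unfolding R_def by (simp add: add_ac)
    have "norm (rot (-\<phi>) (g (P \<phi> \<tau>) + R \<phi> \<tau>) $ i) \<le> 2 * E * K / a \<tau> ^ ((M + 2) + weight i)"
      by (rule norm_rot_le[OF _ _ r]) (use trig that in auto)
    also have "\<dots> = (2 * E * K / a \<tau>) / a \<tau> ^ Suc (M + weight i)" by (simp add: power_add mult_ac)
    also have "\<dots> \<le> (1 / 2) / a \<tau> ^ Suc (M + weight i)"
    proof (intro divide_right_mono)
      have "2 * E * K \<le> 1 / 2 * a \<tau>" using K a_lower[OF that(2)] by linarith
      then show "2 * E * K / a \<tau> \<le> 1 / 2" using a_pos[OF that(2)] by (simp add: pos_divide_le_eq)
    qed (use a_pos[OF that(2)] in auto)
    finally show ?thesis .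
  qed
  \<comment> \<open>Half of the ball is reserved for the residual, the other half for the nonlinear difference.\<close>
  have Nsplit: "N u \<phi> \<tau> = rot (-\<phi>) (g (G u \<phi> \<tau>) - g (P \<phi> \<tau>)) + rot (-\<phi>) (g (P \<phi> \<tau>) + R \<phi> \<tau>)" for u \<phi> \<tau>
    by (simp add: N_def vec_eq_iff rot_def Jrot_nth algebra_simps)
  have Nb: "norm (N u \<phi> \<tau> $ i) \<le> (4 * E\<^sup>2 * C + 1 / 2) / a \<tau> ^ Suc (M + weight i)"
    if "S u" "\<phi> \<in> A" "\<tau> \<in> X" for u \<phi> \<tau> i
  proof -
    have 1: "norm (rot (-\<phi>) (g (G u \<phi> \<tau>) - g (P \<phi> \<tau>)) $ i) \<le> (4 * E\<^sup>2 * C * 1) / a \<tau> ^ Suc (M + weight i)"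
      by (rule contraction_step[OF that(2,3) _ Gb[OF that] Pb[OF that(2,3)] _ vb[OF that]])
        (auto simp: G_def)
    have "norm (N u \<phi> \<tau> $ i) \<le> norm (rot (-\<phi>) (g (G u \<phi> \<tau>) - g (P \<phi> \<tau>)) $ i) + norm (rot (-\<phi>) (g (P \<phi> \<tau>) + R \<phi> \<tau>) $ i)"
      unfolding Nsplit vector_add_component by (rule norm_triangle_ineq)
    also have "\<dots> \<le> (4 * E\<^sup>2 * C * 1) / a \<tau> ^ Suc (M + weight i) + (1 / 2) / a \<tau> ^ Suc (M + weight i)"
      by (intro add_mono 1 res' that)
    finally show ?thesis by (simp add: add_divide_distrib)
  qed
  have c0: "4 * E\<^sup>2 * C + 1 / 2 \<ge> 0" using C by simp
  have m1: "M + weight i \<ge> 1" for i using M by simp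
  have Tprop: "sep_holo A X (\<lambda>\<phi> \<tau>. T u (i, \<phi>, \<tau>))"
     "\<phi> \<in> A \<Longrightarrow> \<tau> \<in> X \<Longrightarrow> norm (T u (i, \<phi>, \<tau>)) \<le> 1 / a \<tau> ^ (M + weight i)"
     "\<phi> \<in> A \<Longrightarrow> \<tau> \<in> X \<Longrightarrow> transport (\<lambda>\<phi> \<tau>. T u (i, \<phi>, \<tau>)) \<phi> \<tau> = N u \<phi> \<tau> $ i" if S: "S u" for u i \<phi> \<tau>
  proof -
    have Teq: "(\<lambda>\<phi> \<tau>. T u (i, \<phi>, \<tau>)) = char_integral (\<lambda>\<phi> \<tau>. N u \<phi> \<tau> $ i)"
      by (simp add: T_def fun_eq_iff)
    show "sep_holo A X (\<lambda>\<phi> \<tau>. T u (i, \<phi>, \<tau>))" unfolding Teq by (rule char_integral_properties(1)[OF Nh'[OF S] m1 c0 Nb[OF S]])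
    show "transport (\<lambda>\<phi> \<tau>. T u (i, \<phi>, \<tau>)) \<phi> \<tau> = N u \<phi> \<tau> $ i" if "\<phi> \<in> A" "\<tau> \<in> X"
      unfolding Teq by (rule char_integral_properties(2)[OF Nh'[OF S] m1 c0 Nb[OF S] that])
    show "norm (T u (i, \<phi>, \<tau>)) \<le> 1 / a \<tau> ^ (M + weight i)" if "\<phi> \<in> A" "\<tau> \<in> X"
    proof -
      have "norm (T u (i, \<phi>, \<tau>)) \<le> (4 * E\<^sup>2 * C + 1 / 2) / (real (M + weight i) * a \<tau> ^ (M + weight i))"
        using char_integrable(3)[OF Nh'[OF S] m1 c0 Nb[OF S] that] by (simp add: T_def)
      also have "\<dots> = ((4 * E\<^sup>2 * C + 1 / 2) / real (M + weight i)) / a \<tau> ^ (M + weight i)" by simp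
      also have "\<dots> \<le> 1 / a \<tau> ^ (M + weight i)"
      proof (intro divide_right_mono)
        have "4 * E\<^sup>2 * C + 1 / 2 \<le> real M" using M by simp
        then show "(4 * E\<^sup>2 * C + 1 / 2) / real (M + weight i) \<le> 1" using M by (simp add: pos_divide_le_eq)
      qed (use a_pos[OF that(2)] in auto)
      finally show ?thesis .
    qed
  qed
  have "\<exists>u. S u \<and> (\<forall>x\<in>Dom. T u x = u x)"
  proof (rule weighted_contraction_fixed_point[where W = W])
    show "S (\<lambda>_. 0)"
      unfolding S_def sep_holo_def using a_pos by (auto simp: W_def Dom_def less_imp_le)
    show "norm (u x) \<le> W x" if "S u" "x \<in> Dom" for u x using that by (simp add: S_def)
    show "S (T u)" if u: "S u" for u
      unfolding S_def
    proof (intro conjI allI ballI)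
      show "sep_holo A X (\<lambda>\<phi> \<tau>. T u (i, \<phi>, \<tau>))" for i by (rule Tprop(1)[OF u])
      show "norm (T u x) \<le> W x" if "x \<in> Dom" for x
        using that Tprop(2)[OF u] by (auto simp: Dom_def W_def)
      fix i \<phi> \<tau> assume \<phi>: "\<phi> \<in> A" "\<tau> \<in> X"
      have Rp: "R (\<phi> + p) \<tau> = R \<phi> \<tau>" for \<phi> \<tau>
      proof -
        have "transport_vec P (\<phi> + p) \<tau> = transport_vec P \<phi> \<tau>"
          unfolding transport_vec_def
          using transport_shift[of "\<lambda>\<phi> \<tau>. P \<phi> \<tau> $ i" p \<phi> \<tau> for i] per(1) by simp
        then show ?thesis by (simp add: R_def per(1))
      qed
      have rotp: "rot (\<phi> + p) z = rot \<phi> z" "rot (- (\<phi> + p)) z = rot (- \<phi>) z" for \<phi> z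
        by (simp_all only: rot_def per(3,4) cos_minus sin_minus)
      have Np: "N u (\<phi> + p) \<tau> = N u \<phi> \<tau>" if "\<phi> \<in> A" "\<tau> \<in> X" for \<phi> \<tau>
      proof -
        have "v u (\<phi> + p) \<tau> = v u \<phi> \<tau>" using u that by (simp add: S_def v_def vec_eq_iff)
        then show ?thesis unfolding N_def G_def rotp Rp per(1) by simp
      qed
      have "char_integral (\<lambda>\<phi> \<tau>. N u \<phi> \<tau> $ i) (\<phi> + p) \<tau> = char_integral (\<lambda>\<phi> \<tau>. N u \<phi> \<tau> $ i) \<phi> \<tau>"
        unfolding char_integral_def
      proof (rule Bochner_Integration.integral_cong[OF refl])
        fix s assume s: "s \<in> space half_line"
        have "N u ((\<phi> - of_real s) + p) (\<tau> - of_real s) = N u (\<phi> - of_real s) (\<tau> - of_real s)"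
          by (rule Np) (use A_shift \<phi> X_shift s in auto)
        then show "N u (\<phi> + p - of_real s) (\<tau> - of_real s) $ i = N u (\<phi> - of_real s) (\<tau> - of_real s) $ i"
          by (simp add: algebra_simps)
      qed
      then show "T u (i, \<phi> + p, \<tau>) = T u (i, \<phi>, \<tau>)" by (simp add: T_def)
    qed
    show "norm (T u x - T u' x) \<le> (\<kappa> / 2) * W x"
      if u: "S u" and u': "S u'" and k: "\<kappa> \<ge> 0" and c: "\<And>x. x \<in> Dom \<Longrightarrow> norm (u x - u' x) \<le> \<kappa> * W x" and x: "x \<in> Dom"
      for u u' \<kappa> x
    proof -
      obtain i \<phi> \<tau> where x_eq: "x = (i, \<phi>, \<tau>)" by (cases x) auto
      with x have \<phi>: "\<phi> \<in> A" "\<tau> \<in> X" by (auto simp: Dom_def)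
      have cc: "norm ((v u \<phi> \<tau> - v u' \<phi> \<tau>) $ j) \<le> \<kappa> / a \<tau> ^ (M + weight j)" if "\<phi> \<in> A" "\<tau> \<in> X" for \<phi> \<tau> j
        using c[of "(j, \<phi>, \<tau>)"] that by (simp add: Dom_def v_def W_def)
      have "norm (T u (i, \<phi>, \<tau>) - T u' (i, \<phi>, \<tau>)) \<le> (4 * E\<^sup>2 * C * \<kappa>) / (real (M + weight i) * a \<tau> ^ (M + weight i))"
      proof (rule transport_decay[where v = "\<lambda>\<phi> \<tau>. T u (i, \<phi>, \<tau>) - T u' (i, \<phi>, \<tau>)"
            and u = "\<lambda>\<phi> \<tau>. N u \<phi> \<tau> $ i - N u' \<phi> \<tau> $ i" and n = "M + weight i" and K' = 2])
        show "sep_holo A X (\<lambda>\<phi> \<tau>. T u (i, \<phi>, \<tau>) - T u' (i, \<phi>, \<tau>))"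
          using Tprop(1)[OF u, of i] Tprop(1)[OF u', of i] unfolding sep_holo_def by (auto intro!: holomorphic_on_diff)
        show "sep_holo A X (\<lambda>\<phi> \<tau>. N u \<phi> \<tau> $ i - N u' \<phi> \<tau> $ i)"
          using Nh'[OF u, of i] Nh'[OF u', of i] unfolding sep_holo_def by (auto intro!: holomorphic_on_diff)
        show "transport (\<lambda>\<phi> \<tau>. T u (i, \<phi>, \<tau>) - T u' (i, \<phi>, \<tau>)) \<phi> \<tau> = N u \<phi> \<tau> $ i - N u' \<phi> \<tau> $ i"
          if "\<phi> \<in> A" "\<tau> \<in> X" for \<phi> \<tau>
          using transport_diff[OF Tprop(1)[OF u] Tprop(1)[OF u'] open_A open_X that] Tprop(3)[OF u that] Tprop(3)[OF u' that]
          by simp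
        show "norm (T u (i, \<phi>, \<tau>) - T u' (i, \<phi>, \<tau>)) \<le> 2 / a \<tau> ^ (M + weight i)" if "\<phi> \<in> A" "\<tau> \<in> X" for \<phi> \<tau>
          using norm_triangle_ineq4[of "T u (i, \<phi>, \<tau>)" "T u' (i, \<phi>, \<tau>)"] Tprop(2)[OF u that, of i] Tprop(2)[OF u' that, of i]
          by simp
        show "norm (N u \<phi> \<tau> $ i - N u' \<phi> \<tau> $ i) \<le> 4 * E\<^sup>2 * C * \<kappa> / a \<tau> ^ Suc (M + weight i)" if "\<phi> \<in> A" "\<tau> \<in> X" for \<phi> \<tau>
        proof -
          have "norm (rot (-\<phi>) (g (G u \<phi> \<tau>) - g (G u' \<phi> \<tau>)) $ i) \<le> 4 * E\<^sup>2 * C * \<kappa> / a \<tau> ^ Suc (M + weight i)"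
            by (rule contraction_step[OF that k Gb[OF u that] Gb[OF u' that] _ cc[OF that]])
              (simp add: G_def rot_diff)
          moreover have "N u \<phi> \<tau> - N u' \<phi> \<tau> = rot (-\<phi>) (g (G u \<phi> \<tau>) - g (G u' \<phi> \<tau>))"
            by (simp add: N_def flip: rot_diff)
          ultimately show ?thesis by (metis vector_minus_component)
        qed
      qed (use k C E M \<phi> in auto)
      also have "\<dots> \<le> (\<kappa> / 2) * W x"
        using half_gain[OF k, of "a \<tau> ^ (M + weight i)" "weight i"] a_pos[OF \<phi>(2)] by (simp add: W_def x_eq)
      finally show ?thesis by (simp add: x_eq)
    qed
    show "S u" if Sn: "\<And>n. S (un n)" and near: "\<And>n x. x \<in> Dom \<Longrightarrow> norm (un n x - u x) \<le> (4 / 2 ^ n) * W x" for un u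
    proof -
      have c: "(\<lambda>n. (4 / 2 ^ n) * k) \<longlonglongrightarrow> 0" for k :: real
      proof -
        have "(\<lambda>n. (4 * k) * (1 / 2) ^ n) \<longlonglongrightarrow> (4 * k) * 0"
          by (intro tendsto_mult tendsto_const LIMSEQ_power_zero) auto
        then show ?thesis by (simp add: power_divide mult_ac)
      qed
      have lim: "(\<lambda>n. un n x) \<longlonglongrightarrow> u x" if "x \<in> Dom" for x
      proof -
        have "(\<lambda>n. un n x - u x) \<longlonglongrightarrow> 0"
          by (rule Lim_null_comparison[OF _ c[of "W x"]]) (use near[OF that] in auto)
        then show ?thesis using Lim_null by blast
      qed
      show "S u" unfolding S_def
      proof (intro conjI allI ballI)
        show "sep_holo A X (\<lambda>\<phi> \<tau>. u (i, \<phi>, \<tau>))" for i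
        proof (rule sep_holo_uniform_limit[OF open_A open_X _ c[of 1]])
          show "sep_holo A X (\<lambda>\<phi> \<tau>. un n (i, \<phi>, \<tau>))" for n using Sn[of n] by (simp add: S_def)
          show "norm (un n (i, \<phi>, \<tau>) - u (i, \<phi>, \<tau>)) \<le> 4 / 2 ^ n * 1" if "\<phi> \<in> A" "\<tau> \<in> X" for n \<phi> \<tau>
          proof -
            have "1 \<le> a \<tau> ^ (M + weight i)" using a_lower[OF that(2)] \<rho>1 by (intro one_le_power) auto
            then have "W (i, \<phi>, \<tau>) \<le> 1" by (simp add: W_def)
            then have "4 / 2 ^ n * W (i, \<phi>, \<tau>) \<le> 4 / 2 ^ n * 1" by (intro mult_left_mono) auto
            then show ?thesis using near[of "(i, \<phi>, \<tau>)" n] that by (simp add: Dom_def)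
          qed
        qed
        show "norm (u x) \<le> W x" if "x \<in> Dom" for x
          by (rule LIMSEQ_le_const2[OF tendsto_norm[OF lim[OF that]]]) (use Sn that in \<open>auto simp: S_def\<close>)
        fix i \<phi> \<tau> assume \<phi>: "\<phi> \<in> A" "\<tau> \<in> X"
        have "(\<lambda>n. un n (i, \<phi> + p, \<tau>)) = (\<lambda>n. un n (i, \<phi>, \<tau>))"
          using Sn \<phi> by (auto simp: S_def)
        then show "u (i, \<phi> + p, \<tau>) = u (i, \<phi>, \<tau>)"
          using lim[of "(i, \<phi> + p, \<tau>)"] lim[of "(i, \<phi>, \<tau>)"] \<phi> per(2) by (auto simp: Dom_def intro: LIMSEQ_unique)
      qed
    qed
  qed
  then obtain u where u: "S u" and fp: "\<And>x. x \<in> Dom \<Longrightarrow> T u x = u x" by blast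
  show ?thesis
  proof (intro exI[of _ "G u"] conjI ballI allI)
    show "vec_holo A X (G u)" by (rule Gh[OF u])
    fix \<phi> \<tau> assume \<phi>: "\<phi> \<in> A" "\<tau> \<in> X"
    show "norm (G u \<phi> \<tau> $ i) \<le> B / a \<tau> ^ weight i" for i by (rule Gb[OF u \<phi>])
    show "norm (G u \<phi> \<tau> $ i - P \<phi> \<tau> $ i) \<le> 2 * E / a \<tau> ^ (M + weight i)" for i
      using rb[OF u \<phi>, of i] by (simp add: G_def)
    show "G u (\<phi> + p) \<tau> = G u \<phi> \<tau>"
    proof -
      have "v u (\<phi> + p) \<tau> = v u \<phi> \<tau>" using u \<phi> by (simp add: S_def v_def vec_eq_iff)
      then show ?thesis by (simp add: G_def per rot_def)
    qed
    have tv: "transport_vec (v u) \<phi> \<tau> = N u \<phi> \<tau>"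
    proof -
      have "transport (\<lambda>\<phi> \<tau>. v u \<phi> \<tau> $ i) \<phi> \<tau> = transport (\<lambda>\<phi> \<tau>. T u (i, \<phi>, \<tau>)) \<phi> \<tau>" for i
        by (rule transport_cong[OF open_A open_X \<phi>]) (simp add: v_def fp Dom_def)
      then show ?thesis using Tprop(3)[OF u \<phi>] by (simp add: transport_vec_def vec_eq_iff)
    qed
    have "transport_vec (G u) \<phi> \<tau> = transport_vec P \<phi> \<tau> + (Jrot (rot \<phi> (v u \<phi> \<tau>)) + rot \<phi> (N u \<phi> \<tau>))"
      using transport_vec_add[OF P vec_holo_rot[OF vh[OF u], of 1] open_A open_X \<phi>]
        transport_vec_rot[OF vh[OF u] open_A open_X \<phi>, of 1] tv
      by (simp add: G_def[abs_def])
    also have "\<dots> = Jrot (G u \<phi> \<tau>) + g (G u \<phi> \<tau>)"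
      unfolding N_def by (simp add: G_def R_def vec_eq_iff Jrot_nth algebra_simps)
    finally show "transport_vec (G u) \<phi> \<tau> = Jrot (G u \<phi> \<tau>) + g (G u \<phi> \<tau>)" .
  qed
qed

end

section \<open>Substitution into truncated expansions\<close>

text \<open>Agreement with a formal series up to order N in x, uniformly in the parameter. The bounds on
  all coefficients are part of the notion because products mix them.\<close>

definition expands :: "complex set \<Rightarrow> nat \<Rightarrow> (complex \<Rightarrow> complex \<Rightarrow> complex) \<Rightarrow> (complex \<Rightarrow> complex fps) \<Rightarrow> bool" where
  "expands \<Phi> N u g \<longleftrightarrow> (\<forall>n. \<exists>b. \<forall>\<phi>\<in>\<Phi>. norm (fps_nth (g \<phi>) n) \<le> b) \<and>
    (\<exists>C. \<forall>\<phi>\<in>\<Phi>. \<forall>x. norm x \<le> 1 \<longrightarrow> norm (u \<phi> x - (\<Sum>n\<le>N. fps_nth (g \<phi>) n * x ^ n)) \<le> C * norm x ^ Suc N)"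

lemma expands_polynomial:
  assumes "\<And>n. \<exists>b. \<forall>\<phi>\<in>\<Phi>. norm (fps_nth (g \<phi>) n) \<le> b"
  shows "expands \<Phi> N (\<lambda>\<phi> x. \<Sum>n\<le>N. fps_nth (g \<phi>) n * x ^ n) g"
  using assms unfolding expands_def by (auto intro!: exI[of _ 0])

lemma expandsE:
  assumes "expands \<Phi> N u g"
  obtains b C where "\<And>n \<phi>. \<phi> \<in> \<Phi> \<Longrightarrow> norm (fps_nth (g \<phi>) n) \<le> b n"
    and "\<And>\<phi> x. \<phi> \<in> \<Phi> \<Longrightarrow> norm x \<le> 1 \<Longrightarrow>
      norm (u \<phi> x - (\<Sum>n\<le>N. fps_nth (g \<phi>) n * x ^ n)) \<le> C * norm x ^ Suc N"
  using assms unfolding expands_def by metis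

lemma expands_bounded:
  assumes "expands \<Phi> N u g"
  shows "\<exists>b\<ge>0. \<forall>\<phi>\<in>\<Phi>. \<forall>x. norm x \<le> 1 \<longrightarrow>
    norm (u \<phi> x) \<le> b \<and> norm (\<Sum>n\<le>N. fps_nth (g \<phi>) n * x ^ n) \<le> b"
proof -
  obtain b C where b: "\<And>n \<phi>. \<phi> \<in> \<Phi> \<Longrightarrow> norm (fps_nth (g \<phi>) n) \<le> b n"
    and C: "\<And>\<phi> x. \<phi> \<in> \<Phi> \<Longrightarrow> norm x \<le> 1 \<Longrightarrow>
      norm (u \<phi> x - (\<Sum>n\<le>N. fps_nth (g \<phi>) n * x ^ n)) \<le> C * norm x ^ Suc N"
    using expandsE[OF assms] by metis
  have P: "norm (\<Sum>n\<le>N. fps_nth (g \<phi>) n * x ^ n) \<le> (\<Sum>n\<le>N. \<bar>b n\<bar>)" if "\<phi> \<in> \<Phi>" "norm x \<le> 1" for \<phi> x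
  proof (rule sum_norm_le)
    fix n
    have "norm (fps_nth (g \<phi>) n * x ^ n) \<le> norm (fps_nth (g \<phi>) n) * 1"
      unfolding norm_mult norm_power using that by (intro mult_left_mono power_le_one) auto
    then show "norm (fps_nth (g \<phi>) n * x ^ n) \<le> \<bar>b n\<bar>" using b[OF that(1), of n] by simp
  qed
  have U: "norm (u \<phi> x) \<le> \<bar>C\<bar> + (\<Sum>n\<le>N. \<bar>b n\<bar>)" if "\<phi> \<in> \<Phi>" "norm x \<le> 1" for \<phi> x
  proof -
    have "C * norm x ^ Suc N \<le> \<bar>C\<bar> * 1"
      using that by (intro mult_mono power_le_one) auto
    then have "norm (u \<phi> x - (\<Sum>n\<le>N. fps_nth (g \<phi>) n * x ^ n)) \<le> \<bar>C\<bar>" using C[OF that] by simp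
    then show ?thesis using P[OF that] norm_triangle_sub[of "u \<phi> x" "\<Sum>n\<le>N. fps_nth (g \<phi>) n * x ^ n"] by simp
  qed
  show ?thesis
  proof (intro exI[of _ "\<bar>C\<bar> + (\<Sum>n\<le>N. \<bar>b n\<bar>)"] conjI ballI allI impI)
    show "0 \<le> \<bar>C\<bar> + (\<Sum>n\<le>N. \<bar>b n\<bar>)" by (intro add_nonneg_nonneg sum_nonneg) auto
    fix \<phi> x assume "\<phi> \<in> \<Phi>" "norm (x::complex) \<le> 1"
    then show "norm (u \<phi> x) \<le> \<bar>C\<bar> + (\<Sum>n\<le>N. \<bar>b n\<bar>)" by (rule U)
    show "norm (\<Sum>n\<le>N. fps_nth (g \<phi>) n * x ^ n) \<le> \<bar>C\<bar> + (\<Sum>n\<le>N. \<bar>b n\<bar>)"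
      using P[OF \<open>\<phi> \<in> \<Phi>\<close> \<open>norm x \<le> 1\<close>] by simp
  qed
qed

text \<open>The terms that are not part of the truncated product have total exponent at least N+1.\<close>

lemma fps_truncated_product:
  fixes g h :: "complex fps"
  assumes b: "\<And>n. norm (fps_nth g n) \<le> b n" "\<And>n. norm (fps_nth h n) \<le> b' n" and x: "norm x \<le> 1"
  shows "norm ((\<Sum>n\<le>N. fps_nth g n * x ^ n) * (\<Sum>n\<le>N. fps_nth h n * x ^ n) - (\<Sum>n\<le>N. fps_nth (g * h) n * x ^ n))
    \<le> (\<Sum>i\<le>N. \<Sum>j\<le>N. b i * b' j) * norm x ^ Suc N"
proof -
  let ?t = "\<lambda>(i, j). fps_nth g i * fps_nth h j * x ^ (i + j)"
  let ?S = "{..N} \<times> {..N}" and ?L = "{(i, j). i + j \<le> N}"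
  have LS: "?L \<subseteq> ?S" by auto
  have b0: "0 \<le> b n" "0 \<le> b' n" for n using b[of n] norm_ge_zero order_trans by blast+
  have "(\<Sum>n\<le>N. fps_nth g n * x ^ n) * (\<Sum>n\<le>N. fps_nth h n * x ^ n) = (\<Sum>p\<in>?S. ?t p)"
    by (simp add: sum_product sum.cartesian_product power_add mult_ac)
  moreover have "(\<Sum>n\<le>N. fps_nth (g * h) n * x ^ n) = (\<Sum>p\<in>?L. ?t p)"
    unfolding sum.triangle_reindex_eq
    by (intro sum.cong refl) (simp add: fps_mult_nth sum_distrib_right atMost_atLeast0)
  ultimately have "(\<Sum>n\<le>N. fps_nth g n * x ^ n) * (\<Sum>n\<le>N. fps_nth h n * x ^ n) - (\<Sum>n\<le>N. fps_nth (g * h) n * x ^ n)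
      = (\<Sum>p\<in>?S - ?L. ?t p)"
    using sum_diff[OF _ LS, of ?t] by simp
  also have "norm \<dots> \<le> (\<Sum>p\<in>?S - ?L. (case p of (i, j) \<Rightarrow> b i * b' j) * norm x ^ Suc N)"
  proof (rule sum_norm_le)
    fix p assume p: "p \<in> ?S - ?L"
    obtain i j where ij: "p = (i, j)" "Suc N \<le> i + j" using p by (cases p) auto
    have "norm (?t p) = norm (fps_nth g i) * norm (fps_nth h j) * norm x ^ (i + j)"
      by (simp add: ij norm_mult norm_power)
    also have "\<dots> \<le> b i * b' j * norm x ^ Suc N"
      using b b0 x ij by (intro mult_mono power_decreasing) auto
    finally show "norm (?t p) \<le> (case p of (i, j) \<Rightarrow> b i * b' j) * norm x ^ Suc N" by (simp add: ij)
  qed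
  also have "\<dots> \<le> (\<Sum>p\<in>?S. (case p of (i, j) \<Rightarrow> b i * b' j) * norm x ^ Suc N)"
    using b0 by (intro sum_mono2) auto
  also have "\<dots> = (\<Sum>i\<le>N. \<Sum>j\<le>N. b i * b' j) * norm x ^ Suc N"
    by (simp add: sum.cartesian_product sum_distrib_right case_prod_unfold)
  finally show ?thesis .
qed

lemma expands_mult:
  assumes u: "expands \<Phi> N u g" and v: "expands \<Phi> N v h"
  shows "expands \<Phi> N (\<lambda>\<phi> x. u \<phi> x * v \<phi> x) (\<lambda>\<phi>. g \<phi> * h \<phi>)"
proof -
  obtain b C where b: "\<And>n \<phi>. \<phi> \<in> \<Phi> \<Longrightarrow> norm (fps_nth (g \<phi>) n) \<le> b n"
    and C: "\<And>\<phi> x. \<phi> \<in> \<Phi> \<Longrightarrow> norm x \<le> 1 \<Longrightarrow>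
      norm (u \<phi> x - (\<Sum>n\<le>N. fps_nth (g \<phi>) n * x ^ n)) \<le> C * norm x ^ Suc N"
    using expandsE[OF u] by metis
  obtain b' C' where b': "\<And>n \<phi>. \<phi> \<in> \<Phi> \<Longrightarrow> norm (fps_nth (h \<phi>) n) \<le> b' n"
    and C': "\<And>\<phi> x. \<phi> \<in> \<Phi> \<Longrightarrow> norm x \<le> 1 \<Longrightarrow>
      norm (v \<phi> x - (\<Sum>n\<le>N. fps_nth (h \<phi>) n * x ^ n)) \<le> C' * norm x ^ Suc N"
    using expandsE[OF v] by metis
  obtain B where B: "B \<ge> 0" "\<And>\<phi> x. \<phi> \<in> \<Phi> \<Longrightarrow> norm x \<le> 1 \<Longrightarrow> norm (\<Sum>n\<le>N. fps_nth (g \<phi>) n * x ^ n) \<le> B"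
    using expands_bounded[OF u] by metis
  obtain B' where B': "B' \<ge> 0" "\<And>\<phi> x. \<phi> \<in> \<Phi> \<Longrightarrow> norm x \<le> 1 \<Longrightarrow> norm (v \<phi> x) \<le> B'"
    using expands_bounded[OF v] by metis
  let ?K = "\<bar>C\<bar> * B' + B * \<bar>C'\<bar> + (\<Sum>i\<le>N. \<Sum>j\<le>N. b i * b' j)"
  have "norm (fps_nth (g \<phi> * h \<phi>) n) \<le> (\<Sum>i=0..n. b i * b' (n - i))" if "\<phi> \<in> \<Phi>" for \<phi> n
    unfolding fps_mult_nth
  proof (rule sum_norm_le)
    fix i
    have "0 \<le> b i" using b[OF that, of i] norm_ge_zero order_trans by blast
    then show "norm (fps_nth (g \<phi>) i * fps_nth (h \<phi>) (n - i)) \<le> b i * b' (n - i)"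
      unfolding norm_mult using b[OF that] b'[OF that] by (intro mult_mono) auto
  qed
  then have 1: "\<forall>n. \<exists>b. \<forall>\<phi>\<in>\<Phi>. norm (fps_nth (g \<phi> * h \<phi>) n) \<le> b" by blast
  have 2: "norm (u \<phi> x * v \<phi> x - (\<Sum>n\<le>N. fps_nth (g \<phi> * h \<phi>) n * x ^ n)) \<le> ?K * norm x ^ Suc N"
    if \<phi>: "\<phi> \<in> \<Phi>" and x: "norm x \<le> 1" for \<phi> x
  proof -
    let ?U = "\<Sum>n\<le>N. fps_nth (g \<phi>) n * x ^ n" and ?V = "\<Sum>n\<le>N. fps_nth (h \<phi>) n * x ^ n"
    have x0: "0 \<le> norm x ^ Suc N" by simp
    have e1: "norm ((u \<phi> x - ?U) * v \<phi> x) \<le> (\<bar>C\<bar> * norm x ^ Suc N) * B'"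
      unfolding norm_mult
    proof (intro mult_mono)
      show "norm (u \<phi> x - ?U) \<le> \<bar>C\<bar> * norm x ^ Suc N"
        using C[OF \<phi> x] mult_right_mono[OF abs_ge_self[of C] x0] by linarith
    qed (use B'(1) B'(2)[OF \<phi> x] in auto)
    have e2: "norm (?U * (v \<phi> x - ?V)) \<le> B * (\<bar>C'\<bar> * norm x ^ Suc N)"
      unfolding norm_mult
    proof (intro mult_mono)
      show "norm (v \<phi> x - ?V) \<le> \<bar>C'\<bar> * norm x ^ Suc N"
        using C'[OF \<phi> x] mult_right_mono[OF abs_ge_self[of C'] x0] by linarith
    qed (use B(1) B(2)[OF \<phi> x] in auto)
    have e3: "norm (?U * ?V - (\<Sum>n\<le>N. fps_nth (g \<phi> * h \<phi>) n * x ^ n)) \<le> (\<Sum>i\<le>N. \<Sum>j\<le>N. b i * b' j) * norm x ^ Suc N"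
      by (rule fps_truncated_product[OF b[OF \<phi>] b'[OF \<phi>] x])
    have "u \<phi> x * v \<phi> x - (\<Sum>n\<le>N. fps_nth (g \<phi> * h \<phi>) n * x ^ n)
        = (u \<phi> x - ?U) * v \<phi> x + ?U * (v \<phi> x - ?V) + (?U * ?V - (\<Sum>n\<le>N. fps_nth (g \<phi> * h \<phi>) n * x ^ n))"
      by (simp add: algebra_simps)
    also have "norm \<dots> \<le> (\<bar>C\<bar> * norm x ^ Suc N) * B' + B * (\<bar>C'\<bar> * norm x ^ Suc N) + (\<Sum>i\<le>N. \<Sum>j\<le>N. b i * b' j) * norm x ^ Suc N"
      by (rule norm_triangle_le[OF add_mono[OF norm_triangle_le[OF add_mono[OF e1 e2]] e3]])
    also have "\<dots> = ?K * norm x ^ Suc N" by (simp only: ring_distribs mult_ac)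
    finally show ?thesis .
  qed
  show ?thesis unfolding expands_def using 1 2 by blast
qed

lemma expands_add:
  assumes u: "expands \<Phi> N u g" and v: "expands \<Phi> N v h"
  shows "expands \<Phi> N (\<lambda>\<phi> x. u \<phi> x + v \<phi> x) (\<lambda>\<phi>. g \<phi> + h \<phi>)"
proof -
  obtain b C where b: "\<And>n \<phi>. \<phi> \<in> \<Phi> \<Longrightarrow> norm (fps_nth (g \<phi>) n) \<le> b n"
    and C: "\<And>\<phi> x. \<phi> \<in> \<Phi> \<Longrightarrow> norm x \<le> 1 \<Longrightarrow>
      norm (u \<phi> x - (\<Sum>n\<le>N. fps_nth (g \<phi>) n * x ^ n)) \<le> C * norm x ^ Suc N"
    using expandsE[OF u] by metis
  obtain b' C' where b': "\<And>n \<phi>. \<phi> \<in> \<Phi> \<Longrightarrow> norm (fps_nth (h \<phi>) n) \<le> b' n"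
    and C': "\<And>\<phi> x. \<phi> \<in> \<Phi> \<Longrightarrow> norm x \<le> 1 \<Longrightarrow>
      norm (v \<phi> x - (\<Sum>n\<le>N. fps_nth (h \<phi>) n * x ^ n)) \<le> C' * norm x ^ Suc N"
    using expandsE[OF v] by metis
  have 1: "norm (fps_nth (g \<phi> + h \<phi>) n) \<le> b n + b' n" if "\<phi> \<in> \<Phi>" for \<phi> n
    using norm_triangle_le[OF add_mono[OF b[OF that] b'[OF that]]] by simp
  have 2: "norm (u \<phi> x + v \<phi> x - (\<Sum>n\<le>N. fps_nth (g \<phi> + h \<phi>) n * x ^ n)) \<le> (C + C') * norm x ^ Suc N"
    if "\<phi> \<in> \<Phi>" "norm x \<le> 1" for \<phi> x
  proof -
    have "u \<phi> x + v \<phi> x - (\<Sum>n\<le>N. fps_nth (g \<phi> + h \<phi>) n * x ^ n)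
      = (u \<phi> x - (\<Sum>n\<le>N. fps_nth (g \<phi>) n * x ^ n)) + (v \<phi> x - (\<Sum>n\<le>N. fps_nth (h \<phi>) n * x ^ n))"
      by (simp add: sum.distrib distrib_right)
    also have "norm \<dots> \<le> C * norm x ^ Suc N + C' * norm x ^ Suc N"
      by (rule norm_triangle_le[OF add_mono[OF C[OF that] C'[OF that]]])
    finally show ?thesis by (simp add: distrib_right)
  qed
  show ?thesis unfolding expands_def using 1 2 by blast
qed

lemma expands_const: "expands \<Phi> N (\<lambda>\<phi> x. c) (\<lambda>\<phi>. fps_const c)"
proof -
  have "(\<Sum>n\<le>N. fps_nth (fps_const c) n * x ^ n) = c" for x
    by (simp add: sum.atMost_shift)
  then show ?thesis unfolding expands_def by (auto intro!: exI[of _ 0] exI[of _ "norm c"])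
qed

lemma expands_power: "expands \<Phi> N u g \<Longrightarrow> expands \<Phi> N (\<lambda>\<phi> x. u \<phi> x ^ k) (\<lambda>\<phi>. g \<phi> ^ k)"
proof (induction k)
  case 0
  then show ?case using expands_const[of \<Phi> N 1] by simp
next
  case (Suc k)
  then show ?case using expands_mult[of \<Phi> N u g] by simp
qed

lemma expands_prod:
  assumes "finite I" "\<And>i. expands \<Phi> N (u i) (g i)"
  shows "expands \<Phi> N (\<lambda>\<phi> x. \<Prod>i\<in>I. u i \<phi> x) (\<lambda>\<phi>. \<Prod>i\<in>I. g i \<phi>)"
  using assms(1)
proof induction
  case empty
  then show ?case using expands_const[of \<Phi> N 1] by simp
next
  case (insert i I)
  then show ?case using expands_mult[OF assms(2)[of i]] by simp
qed

lemma expands_sum: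
  assumes "finite I" "\<And>i. expands \<Phi> N (u i) (g i)"
  shows "expands \<Phi> N (\<lambda>\<phi> x. \<Sum>i\<in>I. u i \<phi> x) (\<lambda>\<phi>. \<Sum>i\<in>I. g i \<phi>)"
  using assms(1)
proof induction
  case empty
  then show ?case using expands_const[of \<Phi> N 0] by simp
next
  case (insert i I)
  then show ?case using expands_add[OF assms(2)[of i]] by simp
qed

lemma finite_tdeg_le: "finite {\<alpha> :: nat^'n. tdeg \<alpha> \<le> N}"
proof (rule finite_subset)
  show "{\<alpha> :: nat^'n. tdeg \<alpha> \<le> N} \<subseteq> vec_lambda ` (PiE UNIV (\<lambda>_. {..N}))"
  proof
    fix \<alpha> :: "nat^'n" assume "\<alpha> \<in> {\<alpha>. tdeg \<alpha> \<le> N}"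
    then have "\<alpha> $ i \<le> N" for i
      using member_le_sum[of i UNIV "\<lambda>i. \<alpha> $ i"] by (auto simp: tdeg_def)
    then have "(\<lambda>i. \<alpha> $ i) \<in> PiE UNIV (\<lambda>_. {..N})" by auto
    moreover have "\<alpha> = vec_lambda (\<lambda>i. \<alpha> $ i)" by simp
    ultimately show "\<alpha> \<in> vec_lambda ` (PiE UNIV (\<lambda>_. {..N}))" by blast
  qed
  show "finite (vec_lambda ` (PiE UNIV (\<lambda>_. {..N})) :: (nat^'n) set)"
    by (intro finite_imageI finite_PiE) auto
qed

text \<open>Each factor without constant term contributes at least one power of the indeterminate.\<close>

lemma fps_monomial_nth_eq_0:
  fixes G :: "(complex fps)^'n"
  assumes "\<And>i. fps_nth (G $ i) 0 = 0" "n < tdeg \<alpha>"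
  shows "fps_nth (\<Prod>i\<in>UNIV. (G $ i) ^ (\<alpha> $ i)) n = 0"
proof -
  have eq: "G $ i = fps_X * fps_shift 1 (G $ i)" for i
    by (rule fps_ext) (use assms(1)[of i] in \<open>auto simp: fps_X_mult_nth\<close>)
  have "(\<Prod>i\<in>UNIV. (G $ i) ^ (\<alpha> $ i)) = (\<Prod>i\<in>UNIV. (fps_X * fps_shift 1 (G $ i)) ^ (\<alpha> $ i))"
    by (simp only: eq[symmetric])
  also have "\<dots> = fps_X ^ tdeg \<alpha> * (\<Prod>i\<in>UNIV. (fps_shift 1 (G $ i)) ^ (\<alpha> $ i))"
    by (simp add: power_mult_distrib prod.distrib tdeg_def power_sum)
  finally show ?thesis using assms(2) by (simp add: fps_X_power_mult_nth)
qed

text \<open>Monomials of total degree at most N are finitely many and are covered by the calculus of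
  \<open>expands\<close>. The remaining ones are O(x^(N+1)) together, since every component of the
  substituted point is O(x), and formally they do not contribute to the first N coefficients.\<close>

lemma formal_subst_expansion:
  fixes f :: "complex^'n \<Rightarrow> complex" and G :: "complex \<Rightarrow> (complex fps)^'n"
  assumes f: "pseries_on c \<rho> f" and \<rho>: "\<rho> > 0"
    and G0: "\<And>\<phi> i. \<phi> \<in> \<Phi> \<Longrightarrow> fps_nth (G \<phi> $ i) 0 = 0"
    and Gb: "\<And>i n. \<exists>b. \<forall>\<phi>\<in>\<Phi>. norm (fps_nth (G \<phi> $ i) n) \<le> b"
  shows "\<exists>K x0. x0 > 0 \<and> (\<forall>\<phi>\<in>\<Phi>. \<forall>x. norm x \<le> x0 \<longrightarrow>
    norm (f (\<chi> i. \<Sum>n\<le>N. fps_nth (G \<phi> $ i) n * x ^ n) - (\<Sum>n\<le>N. fps_nth (formal_subst c (G \<phi>)) n * x ^ n))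
      \<le> K * norm x ^ Suc N)"
proof -
  define z where "z \<phi> x = (\<chi> i. \<Sum>n\<le>N. fps_nth (G \<phi> $ i) n * x ^ n)" for \<phi> x
  define Fin where "Fin = {\<alpha> :: nat^'n. tdeg \<alpha> \<le> N}"
  have fin: "finite Fin" unfolding Fin_def by (rule finite_tdeg_le)
  have E: "expands \<Phi> N (\<lambda>\<phi> x. \<Sum>\<alpha>\<in>Fin. c \<alpha> * vmon \<alpha> (z \<phi> x))
      (\<lambda>\<phi>. \<Sum>\<alpha>\<in>Fin. fps_const (c \<alpha>) * (\<Prod>i\<in>UNIV. (G \<phi> $ i) ^ (\<alpha> $ i)))"
    unfolding z_def vmon_def vec_lambda_beta
    by (intro expands_sum expands_mult expands_prod expands_power expands_const expands_polynomial fin Gb finite)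
  from E obtain C where C: "\<forall>\<phi>\<in>\<Phi>. \<forall>x. norm x \<le> 1 \<longrightarrow> norm ((\<Sum>\<alpha>\<in>Fin. c \<alpha> * vmon \<alpha> (z \<phi> x))
     - (\<Sum>n\<le>N. fps_nth (\<Sum>\<alpha>\<in>Fin. fps_const (c \<alpha>) * (\<Prod>i\<in>UNIV. (G \<phi> $ i) ^ (\<alpha> $ i))) n * x ^ n)) \<le> C * norm x ^ Suc N"
    unfolding expands_def by (elim conjE exE)
  have coeff: "fps_nth (\<Sum>\<alpha>\<in>Fin. fps_const (c \<alpha>) * (\<Prod>i\<in>UNIV. (G \<phi> $ i) ^ (\<alpha> $ i))) n = fps_nth (formal_subst c (G \<phi>)) n"
    if "n \<le> N" "\<phi> \<in> \<Phi>" for n \<phi>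
  proof -
    have "fps_nth (\<Sum>\<alpha>\<in>Fin. fps_const (c \<alpha>) * (\<Prod>i\<in>UNIV. (G \<phi> $ i) ^ (\<alpha> $ i))) n
        = (\<Sum>\<alpha>\<in>Fin. c \<alpha> * fps_nth (\<Prod>i\<in>UNIV. (G \<phi> $ i) ^ (\<alpha> $ i)) n)"
      by (simp add: fps_sum_nth)
    also have "\<dots> = (\<Sum>\<alpha> | tdeg \<alpha> \<le> n. c \<alpha> * fps_nth (\<Prod>i\<in>UNIV. (G \<phi> $ i) ^ (\<alpha> $ i)) n)"
      by (rule sum.mono_neutral_right)
        (use that fin fps_monomial_nth_eq_0[OF G0] in \<open>auto simp: Fin_def\<close>)
    finally show ?thesis by (simp add: formal_subst_def tdeg_def)
  qed
  obtain B where B: "B > 0" "\<And>\<phi> x i. \<phi> \<in> \<Phi> \<Longrightarrow> norm x \<le> 1 \<Longrightarrow> norm (z \<phi> x $ i) \<le> B * norm x"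
  proof -
    obtain b where b: "\<And>i n \<phi>. \<phi> \<in> \<Phi> \<Longrightarrow> norm (fps_nth (G \<phi> $ i) n) \<le> b i n"
      using Gb by metis
    define B where "B = 1 + (\<Sum>i\<in>UNIV. \<Sum>n\<le>N. \<bar>b i n\<bar>)"
    have "B > 0" unfolding B_def by (intro add_pos_nonneg sum_nonneg) auto
    moreover have "norm (z \<phi> x $ i) \<le> B * norm x" if \<phi>: "\<phi> \<in> \<Phi>" "norm x \<le> 1" for \<phi> x i
    proof -
      have "norm (z \<phi> x $ i) \<le> (\<Sum>n\<le>N. \<bar>b i n\<bar> * norm x)"
        unfolding z_def vec_lambda_beta
      proof (rule sum_norm_le)
        fix n
        show "norm (fps_nth (G \<phi> $ i) n * x ^ n) \<le> \<bar>b i n\<bar> * norm x"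
        proof (cases n)
          case 0
          then show ?thesis using G0[OF \<phi>(1)] by simp
        next
          case (Suc m)
          have "norm x ^ n \<le> norm x ^ 1" using \<phi>(2) Suc by (intro power_decreasing) auto
          then show ?thesis unfolding norm_mult norm_power using b[OF \<phi>(1), of i n] by (intro mult_mono) auto
        qed
      qed
      also have "\<dots> = (\<Sum>n\<le>N. \<bar>b i n\<bar>) * norm x" by (simp add: sum_distrib_right)
      also have "\<dots> \<le> B * norm x"
      proof (rule mult_right_mono)
        have "(\<Sum>n\<le>N. \<bar>b i n\<bar>) \<le> (\<Sum>i\<in>UNIV. \<Sum>n\<le>N. \<bar>b i n\<bar>)"
          by (rule member_le_sum[of i UNIV "\<lambda>i. \<Sum>n\<le>N. \<bar>b i n\<bar>"]) (auto intro: sum_nonneg)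
        then show "(\<Sum>n\<le>N. \<bar>b i n\<bar>) \<le> B" by (simp add: B_def)
      qed simp
      finally show ?thesis .
    qed
    ultimately show ?thesis using that by blast
  qed
  define s where "s = \<rho> / 2"
  have s: "0 < s" "s < \<rho>" using \<rho> by (auto simp: s_def)
  have sm: "(\<lambda>\<alpha>. norm (c \<alpha>) * s ^ tdeg \<alpha>) summable_on UNIV"
    by (rule pseries_on_summable[OF f]) (use s in auto)
  then have sm': "(\<lambda>\<alpha>. norm (c \<alpha>) * s ^ tdeg \<alpha>) summable_on (UNIV - Fin)"
    by (rule summable_on_subset_banach) auto
  define T where "T = infsum (\<lambda>\<alpha>. norm (c \<alpha>) * s ^ tdeg \<alpha>) (UNIV - Fin)"
  have T: "((\<lambda>\<alpha>. norm (c \<alpha>) * s ^ tdeg \<alpha>) has_sum T) (UNIV - Fin)" using sm' by (simp add: T_def)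
  define x0 where "x0 = min 1 (s / B)"
  have x0: "x0 > 0" "x0 \<le> 1" "x0 \<le> s / B" using s B by (auto simp: x0_def)
  have main: "norm (f (z \<phi> x) - (\<Sum>n\<le>N. fps_nth (formal_subst c (G \<phi>)) n * x ^ n))
      \<le> (C + T * (B / s) ^ Suc N) * norm x ^ Suc N" if \<phi>: "\<phi> \<in> \<Phi>" and x: "norm x \<le> x0" for \<phi> x
  proof -
    have x1: "norm x \<le> 1" using x x0 by simp
    \<comment> \<open>The components are bounded by s t with t\<le> 1; the surplus power t^(N+1) is taken out of every term of high degree.\<close>
    define t where "t = norm x * B / s"
    have t: "0 \<le> t" "t \<le> 1" "B * norm x = s * t"
    proof -
      have "B * norm x \<le> B * x0" using B(1) x by simp
      also have "\<dots> \<le> s" using x0(3) B(1) by (simp add: pos_le_divide_eq mult.commute)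
      finally show "0 \<le> t" "t \<le> 1" "B * norm x = s * t" using s B(1) by (auto simp: t_def mult.commute)
    qed
    have zs: "norm (z \<phi> x $ i) \<le> s * t" for i using B(2)[OF \<phi> x1, of i] t by simp
    have "s * t \<le> s" using t s by (simp add: mult_left_le)
    then have "\<forall>i. norm (z \<phi> x $ i) < \<rho>" using zs s(2) by (meson le_less_trans order_trans)
    then have fs: "((\<lambda>\<alpha>. c \<alpha> * vmon \<alpha> (z \<phi> x)) has_sum f (z \<phi> x)) UNIV"
      using f by (simp add: pseries_on_def)
    have "((\<lambda>\<alpha>. c \<alpha> * vmon \<alpha> (z \<phi> x)) has_sum (\<Sum>\<alpha>\<in>Fin. c \<alpha> * vmon \<alpha> (z \<phi> x))) Fin"
      using fin by simp
    from has_sum_Diff[OF fs this]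
    have rest: "((\<lambda>\<alpha>. c \<alpha> * vmon \<alpha> (z \<phi> x)) has_sum (f (z \<phi> x) - (\<Sum>\<alpha>\<in>Fin. c \<alpha> * vmon \<alpha> (z \<phi> x)))) (UNIV - Fin)"
      by simp
    have "norm (f (z \<phi> x) - (\<Sum>\<alpha>\<in>Fin. c \<alpha> * vmon \<alpha> (z \<phi> x))) \<le> T * t ^ Suc N"
    proof (rule norm_infsum_le[OF rest has_sum_cmult_left[OF T]])
      fix \<alpha> assume "\<alpha> \<in> UNIV - Fin"
      then have deg: "Suc N \<le> tdeg \<alpha>" by (auto simp: Fin_def)
      have "norm (vmon \<alpha> (z \<phi> x)) \<le> (s * t) ^ tdeg \<alpha>" by (rule norm_vmon_le[OF zs])
      also have "\<dots> \<le> s ^ tdeg \<alpha> * t ^ Suc N"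
        unfolding power_mult_distrib using t s deg by (intro mult_left_mono power_decreasing) auto
      finally show "norm (c \<alpha> * vmon \<alpha> (z \<phi> x)) \<le> norm (c \<alpha>) * s ^ tdeg \<alpha> * t ^ Suc N"
        unfolding norm_mult mult.assoc by (intro mult_left_mono) auto
    qed
    also have "T * t ^ Suc N = T * (B / s) ^ Suc N * norm x ^ Suc N"
      by (simp add: t_def power_mult_distrib power_divide mult_ac)
    finally have e1: "norm (f (z \<phi> x) - (\<Sum>\<alpha>\<in>Fin. c \<alpha> * vmon \<alpha> (z \<phi> x))) \<le> T * (B / s) ^ Suc N * norm x ^ Suc N" .
    have e2: "norm ((\<Sum>\<alpha>\<in>Fin. c \<alpha> * vmon \<alpha> (z \<phi> x)) - (\<Sum>n\<le>N. fps_nth (formal_subst c (G \<phi>)) n * x ^ n)) \<le> C * norm x ^ Suc N"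
      using C[rule_format, OF \<phi> x1] coeff[OF _ \<phi>] by simp
    show ?thesis
      using norm_triangle_le[OF add_mono[OF e1 e2]] by (simp add: distrib_right)
  qed
  show ?thesis using main x0(1) unfolding z_def by blast
qed

section \<open>Trigonometric polynomials on a strip\<close>

lemma trig_poly_holomorphic: "trig_poly f \<Longrightarrow> f holomorphic_on S"
proof -
  assume "trig_poly f"
  then obtain K :: nat and a :: "int \<Rightarrow> complex"
    where "f = (\<lambda>\<phi>. \<Sum>k\<in>{- int K..int K}. a k * exp (\<i> * of_int k * \<phi>))"
    unfolding trig_poly_def by (auto simp: fun_eq_iff)
  then show ?thesis by (auto intro!: holomorphic_intros)
qed

lemma trig_poly_periodic: "trig_poly f \<Longrightarrow> f (\<phi> + 2 * of_real pi) = f \<phi>"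
proof -
  assume "trig_poly f"
  then obtain K :: nat and a :: "int \<Rightarrow> complex"
    where f: "\<And>\<phi>. f \<phi> = (\<Sum>k\<in>{- int K..int K}. a k * exp (\<i> * of_int k * \<phi>))"
    unfolding trig_poly_def by blast
  have "exp (\<i> * of_int k * (\<phi> + 2 * of_real pi)) = exp (\<i> * of_int k * \<phi>)" for k :: int
  proof -
    have "exp (\<i> * of_int k * (\<phi> + 2 * of_real pi)) = exp (\<i> * of_int k * \<phi>) * exp (2 * of_int k * of_real pi * \<i>)"
      by (simp add: exp_add[symmetric] algebra_simps)
    also have "exp (2 * of_int k * of_real pi * \<i>) = 1"
      using exp_integer_2pi[of "of_int k"] by (simp add: mult_ac)
    finally show ?thesis by simp
  qed
  then show ?thesis by (simp add: f)
qed

lemma trig_poly_bounded_strip: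
  assumes "trig_poly f"
  shows "\<exists>b. \<forall>\<phi>\<in>strip h. norm (f \<phi>) \<le> b"
proof -
  obtain K :: nat and a :: "int \<Rightarrow> complex"
    where f: "\<And>\<phi>. f \<phi> = (\<Sum>k\<in>{- int K..int K}. a k * exp (\<i> * of_int k * \<phi>))"
    using assms unfolding trig_poly_def by blast
  have "norm (f \<phi>) \<le> (\<Sum>k\<in>{- int K..int K}. norm (a k) * exp (\<bar>of_int k\<bar> * h))" if "\<phi> \<in> strip h" for \<phi>
    unfolding f
  proof (rule sum_norm_le)
    fix k :: int
    have "- (of_int k * Im \<phi>) \<le> \<bar>of_int k\<bar> * \<bar>Im \<phi>\<bar>"
      by (metis abs_ge_minus_self abs_mult)
    also have "\<dots> \<le> \<bar>of_int k\<bar> * h" using that by (intro mult_left_mono) (auto simp: strip_def)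
    finally show "norm (a k * exp (\<i> * of_int k * \<phi>)) \<le> norm (a k) * exp (\<bar>of_int k\<bar> * h)"
      by (auto simp: norm_mult norm_exp_eq_Re intro!: mult_left_mono)
  qed
  then show ?thesis by blast
qed

lemma trig_poly_0: "trig_poly (\<lambda>_. 0)"
  unfolding trig_poly_def by (rule exI[of _ 0], rule exI[of _ "\<lambda>_. 0"]) simp

lemma cos_sin_bounded_strip:
  assumes "\<phi> \<in> strip h"
  shows "norm (cos \<phi>) \<le> exp h" "norm (sin \<phi>) \<le> exp h"
proof -
  have e: "norm (exp (\<i> * \<phi>)) \<le> exp h" "norm (exp (- (\<i> * \<phi>))) \<le> exp h"
    using assms by (auto simp: norm_exp_eq_Re strip_def)
  have "norm (exp (\<i> * \<phi>) + exp (- (\<i> * \<phi>))) \<le> exp h + exp h"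
    by (rule norm_triangle_le[OF add_mono[OF e]])
  then show "norm (cos \<phi>) \<le> exp h" by (simp add: cos_exp_eq norm_divide)
  have "norm (exp (\<i> * \<phi>) - exp (- (\<i> * \<phi>))) \<le> exp h + exp h"
    by (rule order_trans[OF norm_triangle_ineq4 add_mono[OF e]])
  then show "norm (sin \<phi>) \<le> exp h" by (simp add: sin_exp_eq norm_divide norm_mult)
qed

section \<open>The Hamiltonian field near the origin\<close>

lemma vector_4:
  "(vector [w, x, y, z] :: 'a::zero^4) $ 1 = w" "(vector [w, x, y, z] :: 'a::zero^4) $ 2 = x"
  "(vector [w, x, y, z] :: 'a::zero^4) $ 3 = y" "(vector [w, x, y, z] :: 'a::zero^4) $ 4 = z"
  unfolding vector_def by simp_all

lemma vmon_4: "vmon \<alpha> z = z$1 ^ \<alpha>$1 * z$2 ^ \<alpha>$2 * z$3 ^ \<alpha>$3 * z$4 ^ \<alpha>$4" for z :: "complex^4"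
  unfolding vmon_def UNIV_4 by (simp add: mult.assoc)

lemma weighted_order_4: "weighted_order \<alpha> = 2 * \<alpha>$1 + 2 * \<alpha>$2 + \<alpha>$3 + \<alpha>$4"
  unfolding weighted_order_def UNIV_4 by (simp add: weight_def)

text \<open>The Hamiltonian without -I_1, that is, without its only term of weighted order 3.\<close>

definition nonlinear_part :: "complex \<Rightarrow> (complex^4 \<Rightarrow> complex) \<Rightarrow> complex^4 \<Rightarrow> complex" where
  "nonlinear_part \<eta> F z = I2 z + \<eta> * (I3 z)\<^sup>2 + F z"

lemma pseries_on_nonlinear_part:
  assumes F: "pseries_on cF \<rho> F" and wF: "\<And>\<alpha>. cF \<alpha> \<noteq> 0 \<Longrightarrow> weighted_order \<alpha> \<ge> 5"
  shows "\<exists>c. pseries_on c \<rho> (nonlinear_part \<eta> F) \<and> (\<forall>\<alpha>. c \<alpha> \<noteq> 0 \<longrightarrow> weighted_order \<alpha> \<ge> 4)"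
proof -
  define m where "m \<beta> \<alpha> = (if \<alpha> = \<beta> then 1 else 0 :: complex)" for \<alpha> \<beta> :: "nat^4"
  let ?a = "vector [2,0,0,0] :: nat^4" and ?b = "vector [0,2,0,0] :: nat^4"
    and ?c = "vector [0,0,4,0] :: nat^4" and ?d = "vector [0,0,2,2] :: nat^4" and ?e = "vector [0,0,0,4] :: nat^4"
  have M: "pseries_on (m \<beta>) \<rho> (vmon \<beta>)" for \<beta>
    using pseries_on_vmon[of \<beta> \<rho>] by (simp add: m_def[abs_def])
  let ?co = "\<lambda>\<alpha>. 1/2 * m ?a \<alpha> + 1/2 * m ?b \<alpha> + \<eta>/4 * m ?c \<alpha> + \<eta>/2 * m ?d \<alpha> + \<eta>/4 * m ?e \<alpha> + cF \<alpha>"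
  have "pseries_on ?co \<rho>
    (\<lambda>z. 1/2 * vmon ?a z + 1/2 * vmon ?b z + \<eta>/4 * vmon ?c z + \<eta>/2 * vmon ?d z + \<eta>/4 * vmon ?e z + F z)"
    by (intro pseries_on_add pseries_on_cmult M F)
  also have "(\<lambda>z. 1/2 * vmon ?a z + 1/2 * vmon ?b z + \<eta>/4 * vmon ?c z + \<eta>/2 * vmon ?d z + \<eta>/4 * vmon ?e z + F z)
      = nonlinear_part \<eta> F"
    by (simp add: fun_eq_iff nonlinear_part_def I2_def I3_def vmon_4 vector_4 field_simps power2_eq_square power4_eq_xxxx)
  finally have "pseries_on ?co \<rho> (nonlinear_part \<eta> F)" .
  moreover have "weighted_order \<alpha> \<ge> 4" if "?co \<alpha> \<noteq> 0" for \<alpha>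
  proof -
    have "\<alpha> = ?a \<or> \<alpha> = ?b \<or> \<alpha> = ?c \<or> \<alpha> = ?d \<or> \<alpha> = ?e \<or> cF \<alpha> \<noteq> 0"
      using that by (auto simp: m_def split: if_splits)
    then show ?thesis using wF[of \<alpha>] by (auto simp: weighted_order_4 vector_4)
  qed
  ultimately show ?thesis by blast
qed

definition nonlinear_field :: "(complex^4 \<Rightarrow> complex) \<Rightarrow> complex^4 \<Rightarrow> complex^4" where
  "nonlinear_field \<Psi> z = vector [partial_deriv 3 \<Psi> z, partial_deriv 4 \<Psi> z, - partial_deriv 1 \<Psi> z, - partial_deriv 2 \<Psi> z]"

lemma weighted_order_add_axis: "weighted_order (\<beta> + axis i 1) = weighted_order \<beta> + weight i"
proof -
  have "weight j * (\<beta> + axis i 1) $ j = weight j * \<beta> $ j + (if j = i then weight i else 0)" for j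
    by (simp add: axis_def algebra_simps)
  then show ?thesis by (simp add: weighted_order_def sum.distrib)
qed

text \<open>The i-th component of the field is a derivative with respect to the coordinate conjugate to
  i. Conjugate coordinates have weights adding up to 3, so a Hamiltonian of weighted order at
  least 4 yields order at least 4-(3-w_i)=w_i+1.\<close>

lemma pseries_on_nonlinear_field:
  assumes \<Psi>: "pseries_on c \<rho> \<Psi>" and wt: "\<And>\<alpha>. c \<alpha> \<noteq> 0 \<Longrightarrow> weighted_order \<alpha> \<ge> 4"
  shows "\<exists>d. (\<forall>i. pseries_on (d i) \<rho> (\<lambda>z. nonlinear_field \<Psi> z $ i)) \<and>
    (\<forall>i \<alpha>. d i \<alpha> \<noteq> 0 \<longrightarrow> Suc (weight i) \<le> weighted_order \<alpha>)"
proof -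
  define d where "d i = (if i = 1 then shift_coeff 3 c else if i = 2 then shift_coeff 4 c
    else if i = 3 then (\<lambda>\<alpha>. (-1) * shift_coeff 1 c \<alpha>) else (\<lambda>\<alpha>. (-1) * shift_coeff 2 c \<alpha>))" for i :: 4
  have pd: "pseries_on (shift_coeff j c) \<rho> (partial_deriv j \<Psi>)" for j by (rule pseries_on_partial_deriv[OF \<Psi>])
  have pd': "pseries_on (\<lambda>\<alpha>. (-1) * shift_coeff j c \<alpha>) \<rho> (\<lambda>z. - partial_deriv j \<Psi> z)" for j
    using pseries_on_cmult[OF pd[of j], of "-1"] by simp
  have "pseries_on (d i) \<rho> (\<lambda>z. nonlinear_field \<Psi> z $ i)" for i
    using exhaust_4[of i] pd pd' by (auto simp: d_def nonlinear_field_def vector_4)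
  moreover have "Suc (weight i) \<le> weighted_order \<alpha>" if "d i \<alpha> \<noteq> 0" for i \<alpha>
  proof -
    have s: "4 \<le> weighted_order \<alpha> + weight j" if "shift_coeff j c \<alpha> \<noteq> 0" for j
      using wt[of "\<alpha> + axis j 1"] that by (auto simp: shift_coeff_def weighted_order_add_axis simp del: One_nat_def)
    show ?thesis
      using exhaust_4[of i] that s[of 1] s[of 2] s[of 3] s[of 4] by (auto simp: d_def weight_def)
  qed
  ultimately show ?thesis by blast
qed

lemma ham_field_split:
  assumes \<Psi>: "pseries_on c \<rho> (nonlinear_part \<eta> F)" and z: "\<forall>i. norm (z $ i) < \<rho>"
  shows "ham_field (hamiltonian \<eta> F) z = Jrot z + nonlinear_field (nonlinear_part \<eta> F) z"
proof -
  define \<Psi> where "\<Psi> = nonlinear_part \<eta> F"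
  have H: "hamiltonian \<eta> F w = \<Psi> w - I1 w" for w
    by (simp add: hamiltonian_def \<Psi>_def nonlinear_part_def)
  have dH: "partial_deriv k (hamiltonian \<eta> F) z = partial_deriv k \<Psi> z - D"
    if "((\<lambda>t. I1 (update_coord k t z)) has_field_derivative D) (at (z $ k))" for k D
  proof -
    have "(\<lambda>t. \<Psi> (update_coord k t z)) field_differentiable (at (z $ k))"
      using pseries_on_partial_deriv(2)[OF assms] by (simp add: \<Psi>_def)
    then have "((\<lambda>t. \<Psi> (update_coord k t z)) has_field_derivative partial_deriv k \<Psi> z) (at (z $ k))"
      unfolding partial_deriv_def update_coord_def[symmetric] by (simp add: field_differentiable_derivI)
    from DERIV_diff[OF this that] show ?thesis
      unfolding partial_deriv_def update_coord_def[symmetric] H by (rule DERIV_imp_deriv)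
  qed
  have 1: "partial_deriv 1 (hamiltonian \<eta> F) z = partial_deriv 1 \<Psi> z - (- z$4)"
    by (rule dH) (auto simp: I1_def update_coord_nth intro!: derivative_eq_intros)
  have 2: "partial_deriv 2 (hamiltonian \<eta> F) z = partial_deriv 2 \<Psi> z - z$3"
    by (rule dH) (auto simp: I1_def update_coord_nth intro!: derivative_eq_intros)
  have 3: "partial_deriv 3 (hamiltonian \<eta> F) z = partial_deriv 3 \<Psi> z - z$2"
    by (rule dH) (auto simp: I1_def update_coord_nth intro!: derivative_eq_intros)
  have 4: "partial_deriv 4 (hamiltonian \<eta> F) z = partial_deriv 4 \<Psi> z - (- z$1)"
    by (rule dH) (auto simp: I1_def update_coord_nth intro!: derivative_eq_intros)
  show ?thesis
    unfolding ham_field_def nonlinear_field_def 1 2 3 4 \<Psi>_def[symmetric]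
    by (simp add: vec_eq_iff forall_4 Jrot_nth rot_ix_def rot_sg_def vector_4)
qed

lemma norm_less_if_components_less:
  fixes z :: "complex^4"
  assumes "\<forall>i. norm (z $ i) < e / 4"
  shows "norm z < e"
proof -
  have "norm z \<le> (\<Sum>i\<in>UNIV. norm (z $ i))" unfolding norm_vec_def by (rule L2_set_le_sum) simp
  also have "\<dots> < (\<Sum>i\<in>(UNIV::4 set). e / 4)" using assms by (intro sum_strict_mono) auto
  finally show ?thesis by simp
qed

lemma taylor_coeff_ham_field:
  assumes \<Psi>: "pseries_on c \<rho> (nonlinear_part \<eta> F)" and \<rho>: "\<rho> > 0"
    and d: "pseries_on d \<rho> (\<lambda>z. nonlinear_field (nonlinear_part \<eta> F) z $ i)"
  shows "pseries_on (taylor_coeff (\<lambda>z. ham_field (hamiltonian \<eta> F) z $ i) 0) \<rho>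
     (\<lambda>z. (Jrot z + nonlinear_field (nonlinear_part \<eta> F) z) $ i)"
proof -
  let ?f = "\<lambda>z. (Jrot z + nonlinear_field (nonlinear_part \<eta> F) z) $ i"
  let ?e = "axis (rot_ix i) 1 :: nat^4"
  have v: "vmon ?e z = z $ rot_ix i" for z :: "complex^4"
  proof -
    have "z $ j ^ (?e $ j) = (if j = rot_ix i then z $ rot_ix i else 1)" for j
      by (simp add: axis_def)
    then show ?thesis by (simp add: vmon_def)
  qed
  have "pseries_on (\<lambda>\<alpha>. rot_sg i * (if \<alpha> = ?e then 1 else 0) + d \<alpha>) \<rho>
     (\<lambda>z. rot_sg i * vmon ?e z + nonlinear_field (nonlinear_part \<eta> F) z $ i)"
    by (intro pseries_on_add pseries_on_cmult pseries_on_vmon d)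
  then have p: "pseries_on (\<lambda>\<alpha>. rot_sg i * (if \<alpha> = ?e then 1 else 0) + d \<alpha>) \<rho> ?f"
    by (simp only: v Jrot_nth vector_add_component)
  then have "pseries_on (\<lambda>\<alpha>. rot_sg i * (if \<alpha> = ?e then 1 else 0) + d \<alpha>) \<rho> (\<lambda>z. ham_field (hamiltonian \<eta> F) z $ i)"
    by (rule pseries_on_cong) (simp add: ham_field_split[OF \<Psi>])
  then have "has_power_series_at (\<lambda>z. ham_field (hamiltonian \<eta> F) z $ i) 0 (\<lambda>\<alpha>. rot_sg i * (if \<alpha> = ?e then 1 else 0) + d \<alpha>)"
    using \<rho> has_power_series_at_0_iff by blast
  from taylor_coeff_eq[OF this] p show ?thesis by simp
qed

section \<open>Truncations of a formal separatrix\<close>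

definition truncation :: "nat \<Rightarrow> (complex \<Rightarrow> (complex fps)^4) \<Rightarrow> complex \<Rightarrow> complex \<Rightarrow> complex^4" where
  "truncation N G \<phi> \<tau> = (\<chi> i. \<Sum>n\<le>N. fps_nth (G \<phi> $ i) n / \<tau> ^ n)"

lemma vec_holo_truncation:
  assumes "\<And>i n. (\<lambda>\<phi>. fps_nth (G \<phi> $ i) n) holomorphic_on A" "0 \<notin> X"
  shows "vec_holo A X (truncation N G)"
proof -
  have "\<tau> \<noteq> 0" if "\<tau> \<in> X" for \<tau> using that assms(2) by blast
  then show ?thesis
    unfolding vec_holo_def sep_holo_def truncation_def vec_lambda_beta
    using assms(1) by (auto intro!: holomorphic_intros)
qed

text \<open>Here x=1/\<tau>. The derivative in \<tau> is -x^2 d/dx, and truncation at order N loses its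
  last term.\<close>

lemma fps_tau_derivative_sum:
  fixes g :: "complex fps"
  shows "(\<Sum>n\<le>N. - (of_nat n * fps_nth g n * x ^ Suc n))
    = (\<Sum>n\<le>N. - fps_nth (fps_X^2 * fps_deriv g) n * x ^ n) - of_nat N * fps_nth g N * x ^ Suc N"
proof (induction N)
  case 0
  then show ?case by (simp add: fps_X_power_mult_nth)
next
  case (Suc N)
  have "fps_nth (fps_X^2 * fps_deriv g) (Suc N) = of_nat N * fps_nth g N"
    by (cases N) (auto simp: fps_X_power_mult_nth)
  then show ?case using Suc by (simp add: algebra_simps)
qed

lemma transport_truncation:
  assumes hol: "\<And>i n. (\<lambda>\<phi>. fps_nth (G \<phi> $ i) n) holomorphic_on UNIV" and \<tau>: "\<tau> \<noteq> 0"
  shows "transport_vec (truncation N G) \<phi> \<tau> $ i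
    = (\<Sum>n\<le>N. fps_nth (formal_D (\<lambda>\<psi>. G \<psi> $ i) \<phi>) n / \<tau> ^ n) - of_nat N * fps_nth (G \<phi> $ i) N / \<tau> ^ Suc N"
proof -
  let ?d = "\<lambda>n. deriv (\<lambda>\<phi>. fps_nth (G \<phi> $ i) n) \<phi>"
  have d: "((\<lambda>\<phi>. fps_nth (G \<phi> $ i) n) has_field_derivative ?d n) (at \<phi>)" for n
    using hol by (auto intro: holomorphic_derivI)
  have 1: "((\<lambda>x. \<Sum>n\<le>N. fps_nth (G x $ i) n / \<tau> ^ n) has_field_derivative (\<Sum>n\<le>N. ?d n / \<tau> ^ n)) (at \<phi>)"
    by (intro DERIV_sum DERIV_cdivide d)
  have inv: "((\<lambda>y. inverse y ^ n) has_field_derivative - (of_nat n * inverse \<tau> ^ Suc n)) (at \<tau>)" for n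
  proof -
    have "((\<lambda>y. inverse y) has_field_derivative - (inverse \<tau> * inverse \<tau>)) (at \<tau>)"
      using \<tau> by (auto intro!: derivative_eq_intros)
    from DERIV_power[OF this, of n] show ?thesis by (cases n) (auto simp: mult_ac)
  qed
  have 2: "((\<lambda>y. \<Sum>n\<le>N. fps_nth (G \<phi> $ i) n * inverse y ^ n) has_field_derivative
      (\<Sum>n\<le>N. fps_nth (G \<phi> $ i) n * - (of_nat n * inverse \<tau> ^ Suc n))) (at \<tau>)"
    by (intro DERIV_sum DERIV_cmult inv)
  then have 2: "((\<lambda>y. \<Sum>n\<le>N. fps_nth (G \<phi> $ i) n / y ^ n) has_field_derivative
      (\<Sum>n\<le>N. - (of_nat n * fps_nth (G \<phi> $ i) n * inverse \<tau> ^ Suc n))) (at \<tau>)"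
    by (simp add: divide_inverse power_inverse mult_ac)
  have "transport_vec (truncation N G) \<phi> \<tau> $ i = (\<Sum>n\<le>N. ?d n * inverse \<tau> ^ n)
     + (\<Sum>n\<le>N. - (of_nat n * fps_nth (G \<phi> $ i) n * inverse \<tau> ^ Suc n))"
    unfolding transport_vec_def transport_def truncation_def vec_lambda_beta DERIV_imp_deriv[OF 1] DERIV_imp_deriv[OF 2]
    by (simp add: divide_inverse power_inverse)
  also have "\<dots> = (\<Sum>n\<le>N. fps_nth (formal_D (\<lambda>\<psi>. G \<psi> $ i) \<phi>) n * inverse \<tau> ^ n)
      - of_nat N * fps_nth (G \<phi> $ i) N * inverse \<tau> ^ Suc N"
    unfolding fps_tau_derivative_sum by (simp add: formal_D_def left_diff_distrib sum_subtractf sum_negf)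
  finally show ?thesis by (simp add: divide_inverse power_inverse)
qed

lemma truncation_diff_bound:
  assumes b: "\<And>i n. \<exists>b. \<forall>\<phi>\<in>\<Phi>. norm (fps_nth (G \<phi> $ i) n) \<le> b" and N: "N \<le> N'"
  shows "\<exists>K\<ge>0. \<forall>\<phi>\<in>\<Phi>. \<forall>\<tau> i. norm \<tau> \<ge> 1 \<longrightarrow>
    norm (truncation N' G \<phi> \<tau> $ i - truncation N G \<phi> \<tau> $ i) \<le> K / norm \<tau> ^ Suc N"
proof -
  obtain b where b: "\<And>i n \<phi>. \<phi> \<in> \<Phi> \<Longrightarrow> norm (fps_nth (G \<phi> $ i) n) \<le> b i n"
    using b by metis
  define K where "K = (\<Sum>i\<in>UNIV. \<Sum>n\<in>{N<..N'}. \<bar>b i n\<bar>)"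
  have "norm (truncation N' G \<phi> \<tau> $ i - truncation N G \<phi> \<tau> $ i) \<le> K / norm \<tau> ^ Suc N"
    if \<phi>: "\<phi> \<in> \<Phi>" and \<tau>: "norm \<tau> \<ge> 1" for \<phi> \<tau> i
  proof -
    have "{..N'} - {..N} = {N<..N'}" by auto
    then have "truncation N' G \<phi> \<tau> $ i - truncation N G \<phi> \<tau> $ i = (\<Sum>n\<in>{N<..N'}. fps_nth (G \<phi> $ i) n / \<tau> ^ n)"
      unfolding truncation_def vec_lambda_beta using N
      by (subst sum_diff[symmetric]) auto
    also have "norm \<dots> \<le> (\<Sum>n\<in>{N<..N'}. \<bar>b i n\<bar> / norm \<tau> ^ Suc N)"
    proof (rule sum_norm_le)
      fix n assume "n \<in> {N<..N'}"
      then have "norm \<tau> ^ Suc N \<le> norm \<tau> ^ n" using \<tau> by (intro power_increasing) auto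
      then show "norm (fps_nth (G \<phi> $ i) n / \<tau> ^ n) \<le> \<bar>b i n\<bar> / norm \<tau> ^ Suc N"
        unfolding norm_divide norm_power using b[OF \<phi>, of i n] \<tau>
        by (intro frac_le zero_less_power) auto
    qed
    also have "\<dots> = (\<Sum>n\<in>{N<..N'}. \<bar>b i n\<bar>) / norm \<tau> ^ Suc N" by (simp add: sum_divide_distrib)
    also have "\<dots> \<le> K / norm \<tau> ^ Suc N"
      unfolding K_def using member_le_sum[of i UNIV "\<lambda>i. \<Sum>n\<in>{N<..N'}. \<bar>b i n\<bar>"] \<tau>
      by (intro divide_right_mono) (auto intro: sum_nonneg)
    finally show ?thesis .
  qed
  moreover have "K \<ge> 0" unfolding K_def by (intro sum_nonneg) auto
  ultimately show ?thesis by blast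
qed

text \<open>Only the coefficient of \<tau>^(-w_i) enters the bound, which is therefore the same for all
  truncation orders; the later terms are absorbed by taking |\<tau>| large, depending on N.
  From N=2 on, the leading term is present for both weights.\<close>

lemma truncation_leading_bound:
  assumes b: "\<And>i n. \<exists>b. \<forall>\<phi>\<in>\<Phi>. norm (fps_nth (G \<phi> $ i) n) \<le> b"
    and low: "\<And>\<phi> i n. n < weight i \<Longrightarrow> fps_nth (G \<phi> $ i) n = 0"
  shows "\<exists>b\<ge>0. \<forall>N\<ge>2. \<exists>R\<ge>1. \<forall>\<phi>\<in>\<Phi>. \<forall>\<tau> i. norm \<tau> \<ge> R \<longrightarrow>
    norm (truncation N G \<phi> \<tau> $ i) \<le> b / norm \<tau> ^ weight i"
proof -
  obtain b where b': "\<And>i n \<phi>. \<phi> \<in> \<Phi> \<Longrightarrow> norm (fps_nth (G \<phi> $ i) n) \<le> b i n"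
    using b by metis
  define B where "B = 1 + (\<Sum>i\<in>UNIV. \<bar>b i (weight i)\<bar>)"
  have B: "\<bar>b i (weight i)\<bar> + 1 \<le> B" for i
    unfolding B_def using member_le_sum[of i UNIV "\<lambda>i. \<bar>b i (weight i)\<bar>"] by auto
  have "\<exists>R\<ge>1. \<forall>\<phi>\<in>\<Phi>. \<forall>\<tau> i. norm \<tau> \<ge> R \<longrightarrow> norm (truncation N G \<phi> \<tau> $ i) \<le> B / norm \<tau> ^ weight i"
    if N: "N \<ge> 2" for N
  proof -
    have wN: "weight i \<le> N" for i using N by (simp add: weight_def)
    have "\<forall>i. \<exists>K\<ge>0. \<forall>\<phi>\<in>\<Phi>. \<forall>\<tau> j. norm \<tau> \<ge> 1 \<longrightarrow>
      norm (truncation N G \<phi> \<tau> $ j - truncation (weight i) G \<phi> \<tau> $ j) \<le> K / norm \<tau> ^ Suc (weight i)"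
      using truncation_diff_bound[OF b wN] by blast
    then obtain K where K: "\<And>i. K i \<ge> 0" "\<And>i \<phi> \<tau> j. \<phi> \<in> \<Phi> \<Longrightarrow> norm \<tau> \<ge> 1 \<Longrightarrow>
      norm (truncation N G \<phi> \<tau> $ j - truncation (weight i) G \<phi> \<tau> $ j) \<le> K i / norm \<tau> ^ Suc (weight i)"
      by metis
    define R where "R = 1 + (\<Sum>i\<in>UNIV. K i)"
    have R: "K i \<le> R" for i unfolding R_def using member_le_sum[of i UNIV K] K(1) by fastforce
    have R1: "R \<ge> 1" unfolding R_def using K(1) by (simp add: sum_nonneg)
    have "norm (truncation N G \<phi> \<tau> $ i) \<le> B / norm \<tau> ^ weight i"
      if \<phi>: "\<phi> \<in> \<Phi>" and \<tau>: "norm \<tau> \<ge> R" for \<phi> \<tau> i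
    proof -
      have \<tau>1: "norm \<tau> \<ge> 1" using \<tau> R1 by simp
      have "truncation (weight i) G \<phi> \<tau> $ i = fps_nth (G \<phi> $ i) (weight i) / \<tau> ^ weight i"
        unfolding truncation_def vec_lambda_beta
        by (subst sum.remove[of _ "weight i"]) (auto intro!: sum.neutral simp: low)
      then have 1: "norm (truncation (weight i) G \<phi> \<tau> $ i) \<le> \<bar>b i (weight i)\<bar> / norm \<tau> ^ weight i"
        using b'[OF \<phi>, of i "weight i"] by (simp add: norm_divide norm_power divide_right_mono)
      have "K i / norm \<tau> ^ Suc (weight i) = (K i / norm \<tau>) / norm \<tau> ^ weight i" by simp
      also have "\<dots> \<le> 1 / norm \<tau> ^ weight i"
      proof (intro divide_right_mono)
        show "K i / norm \<tau> \<le> 1" using R[of i] \<tau> \<tau>1 by (simp add: divide_le_eq)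
      qed simp
      finally have 2: "norm (truncation N G \<phi> \<tau> $ i - truncation (weight i) G \<phi> \<tau> $ i) \<le> 1 / norm \<tau> ^ weight i"
        using K(2)[OF \<phi> \<tau>1, of i i] by linarith
      have "norm (truncation N G \<phi> \<tau> $ i) \<le> \<bar>b i (weight i)\<bar> / norm \<tau> ^ weight i + 1 / norm \<tau> ^ weight i"
        using norm_triangle_le[OF add_mono[OF 1 2]] by simp
      also have "\<dots> = (\<bar>b i (weight i)\<bar> + 1) / norm \<tau> ^ weight i" by (simp add: add_divide_distrib)
      also have "\<dots> \<le> B / norm \<tau> ^ weight i" using B by (intro divide_right_mono) auto
      finally show ?thesis .
    qed
    then show ?thesis using R1 by blast
  qed
  moreover have "B \<ge> 0" unfolding B_def by (simp add: sum_nonneg)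
  ultimately show ?thesis by blast
qed

text \<open>Substituting the truncation into the field agrees with formal substitution to order N, and the
  formal equation identifies the result with the formal transport derivative. The transport
  derivative of the truncation differs from that by the single term
  -N G_N \<tau>^(-N-1).\<close>

lemma truncation_residual:
  fixes g :: "complex^4 \<Rightarrow> complex^4" and c :: "4 \<Rightarrow> nat^4 \<Rightarrow> complex"
  assumes hol: "\<And>i n. (\<lambda>\<phi>. fps_nth (G \<phi> $ i) n) holomorphic_on UNIV"
    and b: "\<And>i n. \<exists>b. \<forall>\<phi>\<in>\<Phi>. norm (fps_nth (G \<phi> $ i) n) \<le> b"
    and G0: "\<And>\<phi> i. fps_nth (G \<phi> $ i) 0 = 0"
    and f: "\<And>i. pseries_on (c i) \<rho> (\<lambda>z. (Jrot z + g z) $ i)" and \<rho>: "\<rho> > 0"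
    and eq: "\<And>\<phi> i. formal_D (\<lambda>\<psi>. G \<psi> $ i) \<phi> = formal_subst (c i) (G \<phi>)"
  shows "\<exists>K\<ge>0. \<exists>R\<ge>1. \<forall>\<phi>\<in>\<Phi>. \<forall>\<tau> i. norm \<tau> \<ge> R \<longrightarrow>
    norm ((g (truncation N G \<phi> \<tau>) + (Jrot (truncation N G \<phi> \<tau>) - transport_vec (truncation N G) \<phi> \<tau>)) $ i) \<le> K / norm \<tau> ^ Suc N"
proof -
  obtain b where b': "\<And>i n \<phi>. \<phi> \<in> \<Phi> \<Longrightarrow> norm (fps_nth (G \<phi> $ i) n) \<le> b i n"
    using b by metis
  define bnd where "bnd i K x0 \<longleftrightarrow> (\<forall>\<phi>\<in>\<Phi>. \<forall>x. norm x \<le> x0 \<longrightarrow>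
    norm ((\<lambda>z. (Jrot z + g z) $ i) (\<chi> i. \<Sum>n\<le>N. fps_nth (G \<phi> $ i) n * x ^ n) - (\<Sum>n\<le>N. fps_nth (formal_subst (c i) (G \<phi>)) n * x ^ n))
      \<le> K * norm x ^ Suc N)" for i K x0
  have "\<exists>K x0. x0 > 0 \<and> bnd i K x0" for i
    using formal_subst_expansion[OF f[of i] \<rho> G0 b, of N] unfolding bnd_def .
  then obtain K x0 where x0: "\<And>i. x0 i > 0" and bnd: "\<And>i. bnd i (K i) (x0 i)"
    by metis
  note K = bnd[unfolded bnd_def, rule_format]
  define Q where "Q = (\<Sum>i\<in>UNIV. \<bar>K i\<bar> + real N * \<bar>b i N\<bar>)"
  have Q: "\<bar>K i\<bar> + real N * \<bar>b i N\<bar> \<le> Q" for i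
    unfolding Q_def by (rule member_le_sum[of i UNIV "\<lambda>i. \<bar>K i\<bar> + real N * \<bar>b i N\<bar>"]) auto
  define R where "R = 1 + (\<Sum>i\<in>UNIV. 1 / x0 i)"
  have R: "1 / x0 i \<le> R" for i
    unfolding R_def using member_le_sum[of i UNIV "\<lambda>i. 1 / x0 i"] x0 by (fastforce simp: less_imp_le)
  have R1: "R \<ge> 1" unfolding R_def using x0 by (simp add: sum_nonneg less_imp_le)
  have "norm ((g (truncation N G \<phi> \<tau>) + (Jrot (truncation N G \<phi> \<tau>) - transport_vec (truncation N G) \<phi> \<tau>)) $ i) \<le> Q / norm \<tau> ^ Suc N"
    if \<phi>: "\<phi> \<in> \<Phi>" and \<tau>: "norm \<tau> \<ge> R" for \<phi> \<tau> i
  proof -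
    have \<tau>0: "\<tau> \<noteq> 0" "norm \<tau> > 0" using \<tau> R1 by auto
    define x where "x = inverse \<tau>"
    have "1 / x0 i \<le> norm \<tau>" using R[of i] \<tau> by simp
    then have x: "norm x \<le> x0 i"
      using x0[of i] \<tau>0 by (simp add: x_def norm_inverse inverse_eq_divide[of "norm \<tau>"] pos_divide_le_eq mult.commute)
    have tr: "truncation N G \<phi> \<tau> = (\<chi> i. \<Sum>n\<le>N. fps_nth (G \<phi> $ i) n * x ^ n)"
      by (simp add: truncation_def x_def divide_inverse power_inverse)
    have "(g (truncation N G \<phi> \<tau>) + (Jrot (truncation N G \<phi> \<tau>) - transport_vec (truncation N G) \<phi> \<tau>)) $ i
       = ((Jrot (truncation N G \<phi> \<tau>) + g (truncation N G \<phi> \<tau>)) $ i - (\<Sum>n\<le>N. fps_nth (formal_subst (c i) (G \<phi>)) n * x ^ n))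
         + of_nat N * fps_nth (G \<phi> $ i) N * x ^ Suc N"
      using transport_truncation[OF hol \<tau>0(1), of N \<phi> i]
      by (simp add: eq x_def divide_inverse power_inverse)
    also have "norm \<dots> \<le> \<bar>K i\<bar> * norm x ^ Suc N + real N * \<bar>b i N\<bar> * norm x ^ Suc N"
    proof (rule norm_triangle_le[OF add_mono])
      have "K i * norm x ^ Suc N \<le> \<bar>K i\<bar> * norm x ^ Suc N" by (intro mult_right_mono) auto
      then show "norm ((Jrot (truncation N G \<phi> \<tau>) + g (truncation N G \<phi> \<tau>)) $ i - (\<Sum>n\<le>N. fps_nth (formal_subst (c i) (G \<phi>)) n * x ^ n)) \<le> \<bar>K i\<bar> * norm x ^ Suc N"
        using K[OF \<phi> x] unfolding tr by linarith
      have "norm (fps_nth (G \<phi> $ i) N) \<le> \<bar>b i N\<bar>" using b'[OF \<phi>, of i N] by simp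
      then show "norm (of_nat N * fps_nth (G \<phi> $ i) N * x ^ Suc N) \<le> real N * \<bar>b i N\<bar> * norm x ^ Suc N"
        unfolding norm_mult norm_power norm_of_nat by (intro mult_right_mono mult_left_mono) auto
    qed
    also have "\<dots> \<le> Q * norm x ^ Suc N"
      unfolding distrib_right[symmetric] by (intro mult_right_mono Q) auto
    also have "\<dots> = Q / norm \<tau> ^ Suc N" by (simp add: x_def norm_inverse divide_inverse power_inverse)
    finally show ?thesis .
  qed
  moreover have "Q \<ge> 0" unfolding Q_def by (intro sum_nonneg) auto
  ultimately show ?thesis using R1 by blast
qed

section \<open>Sectorial domains\<close>

text \<open>The slope is k=cot \<theta> for the sector itself and 2k for the weight. With slope k
  the weight would degenerate along the boundary rays.\<close>

definition slant :: "real \<Rightarrow> complex \<Rightarrow> real" where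
  "slant k \<tau> = k * \<bar>Im \<tau>\<bar> - Re \<tau>"

definition region :: "real \<Rightarrow> real \<Rightarrow> real \<Rightarrow> complex set" where
  "region k r \<rho> = {\<tau>. r < slant k \<tau> \<and> \<rho> < slant (2 * k) \<tau>}"

lemma region_mono: "\<rho> \<le> \<rho>' \<Longrightarrow> region k r \<rho>' \<subseteq> region k r \<rho>"
  by (auto simp: region_def)

lemma slant_mono: "0 \<le> k \<Longrightarrow> slant k \<tau> \<le> slant (2 * k) \<tau>"
proof -
  assume "0 \<le> k"
  then have "k * \<bar>Im \<tau>\<bar> \<le> 2 * k * \<bar>Im \<tau>\<bar>" by (intro mult_right_mono) auto
  then show ?thesis by (simp add: slant_def)
qed

text \<open>In polar form the quantity is |z|sin (|Arg z|-\<theta>)/sin \<theta>.\<close>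

lemma slant_pos_iff_Arg:
  assumes "0 < \<theta>" "\<theta> < pi / 2"
  shows "0 < slant (cot \<theta>) z \<longleftrightarrow> \<theta> < \<bar>Arg z\<bar>"
proof (cases "z = 0")
  case True
  then show ?thesis using assms by (simp add: slant_def Arg_zero)
next
  case False
  define A where "A = Arg z"
  have A: "- pi < A" "A \<le> pi" using Arg_bounded[of z] by (auto simp: A_def)
  have s: "sin \<theta> > 0" using assms by (intro sin_gt_zero) auto
  have z: "z = of_real (norm z) * exp (\<i> * of_real A)" using Arg_eq[OF False] by (simp add: A_def)
  have re: "Re z = norm z * cos \<bar>A\<bar>"
    by (subst z) (simp add: Re_exp cos_abs_real)
  have im: "\<bar>Im z\<bar> = norm z * sin \<bar>A\<bar>"
  proof -
    have "Im z = norm z * sin A" by (subst z) (simp add: Im_exp)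
    moreover have "\<bar>sin A\<bar> = sin \<bar>A\<bar>"
      using A sin_ge_zero[of A] sin_ge_zero[of "-A"] by (cases "A \<ge> 0") auto
    ultimately show ?thesis by (simp add: abs_mult)
  qed
  have "slant (cot \<theta>) z = norm z / sin \<theta> * sin (\<bar>A\<bar> - \<theta>)"
    using s unfolding slant_def re im cot_def sin_diff by (simp add: field_simps)
  then have "0 < slant (cot \<theta>) z \<longleftrightarrow> 0 < sin (\<bar>A\<bar> - \<theta>)"
    using s False by (simp add: zero_less_mult_iff zero_less_divide_iff)
  also have "\<dots> \<longleftrightarrow> \<theta> < \<bar>A\<bar>"
  proof
    show "\<theta> < \<bar>A\<bar> \<Longrightarrow> 0 < sin (\<bar>A\<bar> - \<theta>)" using A assms by (intro sin_gt_zero) auto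
    show "0 < sin (\<bar>A\<bar> - \<theta>) \<Longrightarrow> \<theta> < \<bar>A\<bar>"
    proof (rule ccontr)
      assume *: "0 < sin (\<bar>A\<bar> - \<theta>)" "\<not> \<theta> < \<bar>A\<bar>"
      have "0 \<le> sin (\<theta> - \<bar>A\<bar>)" using * assms by (intro sin_ge_zero) auto
      moreover have "sin (\<theta> - \<bar>A\<bar>) = - sin (\<bar>A\<bar> - \<theta>)" using sin_minus[of "\<bar>A\<bar> - \<theta>"] by simp
      ultimately show False using * by simp
    qed
  qed
  finally show ?thesis by (simp add: A_def)
qed

lemma D_minus_eq_region:
  assumes "0 < \<theta>" "\<theta> < pi / 2"
  shows "D_minus \<theta> r = region (cot \<theta>) r r"
proof -
  have c: "0 \<le> cot \<theta>" using assms cot_gt_zero[of \<theta>] by simp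
  have "\<tau> \<in> D_minus \<theta> r \<longleftrightarrow> r < slant (cot \<theta>) \<tau>" for \<tau>
  proof -
    have "\<tau> \<in> D_minus \<theta> r \<longleftrightarrow> 0 < slant (cot \<theta>) (\<tau> + of_real r)"
      by (simp add: D_minus_def slant_pos_iff_Arg[OF assms])
    then show ?thesis by (simp add: slant_def algebra_simps)
  qed
  moreover have "\<tau> \<in> region (cot \<theta>) r r \<longleftrightarrow> r < slant (cot \<theta>) \<tau>" for \<tau>
    using slant_mono[OF c, of \<tau>] by (auto simp: region_def)
  ultimately show ?thesis by blast
qed

lemma open_strip: "open (strip h)"
  unfolding strip_def by (intro open_Collect_less continuous_intros)

lemma open_region: "open (region k r \<rho>)"
  unfolding region_def slant_def by (intro open_Collect_conj open_Collect_less continuous_intros)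

lemma translation_domain_region:
  assumes "0 < \<rho>" "0 \<le> k"
  shows "translation_domain (strip h) (region k r \<rho>) (slant (2 * k)) \<rho>"
proof
  show "open (strip h)" "open (region k r \<rho>)" by (rule open_strip open_region)+
  show "\<phi> - of_real s \<in> strip h" if "\<phi> \<in> strip h" for \<phi> s using that by (simp add: strip_def)
  show "\<tau> - of_real s \<in> region k r \<rho>" if "\<tau> \<in> region k r \<rho>" "s \<ge> 0" for \<tau> s
    using that by (auto simp: region_def slant_def)
qed (use assms in \<open>auto simp: region_def slant_def\<close>)

lemma slant_le_norm: "0 \<le> k \<Longrightarrow> slant (2 * k) \<tau> \<le> (2 * k + 1) * norm \<tau>"
proof -
  assume "0 \<le> k"
  then have "2 * k * \<bar>Im \<tau>\<bar> \<le> 2 * k * norm \<tau>" by (intro mult_left_mono abs_Im_le_cmod) auto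
  moreover have "- Re \<tau> \<le> norm \<tau>" using abs_Re_le_cmod[of \<tau>] by linarith
  ultimately show ?thesis by (simp add: slant_def algebra_simps)
qed

lemma norm_le_slant:
  assumes "0 < k" "0 \<le> slant k \<tau>"
  shows "norm \<tau> \<le> (1 + 1 / k) * slant (2 * k) \<tau>"
proof -
  have ki: "0 \<le> k * \<bar>Im \<tau>\<bar>" using assms by simp
  have 1: "k * \<bar>Im \<tau>\<bar> \<le> slant (2 * k) \<tau>" using assms by (simp add: slant_def)
  have 2: "\<bar>Re \<tau>\<bar> \<le> slant (2 * k) \<tau>" using assms ki by (auto simp: slant_def abs_if)
  have 3: "\<bar>Im \<tau>\<bar> \<le> slant (2 * k) \<tau> / k" using 1 assms by (simp add: pos_le_divide_eq mult.commute)
  have "norm \<tau> \<le> \<bar>Re \<tau>\<bar> + \<bar>Im \<tau>\<bar>" by (rule cmod_le)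
  also have "\<dots> \<le> slant (2 * k) \<tau> + slant (2 * k) \<tau> / k" using 2 3 by linarith
  finally show ?thesis by (simp add: algebra_simps)
qed

lemma power_ratio_bound:
  fixes a t c \<kappa> :: real
  assumes "0 < a" "a \<le> \<kappa> * t" "0 \<le> c" "0 < \<kappa>"
  shows "c / t ^ n \<le> c * \<kappa> ^ n / a ^ n"
proof -
  have "0 < \<kappa> * t" using assms by linarith
  then have t: "0 < t" using zero_less_mult_pos assms(4) by blast
  have "c * a ^ n \<le> c * (\<kappa> * t) ^ n" using assms by (intro mult_left_mono power_mono) auto
  then have "c \<le> c * (\<kappa> * t) ^ n / a ^ n" using assms(1) by (simp add: pos_le_divide_eq)
  then have "c / t ^ n \<le> (c * (\<kappa> * t) ^ n / a ^ n) / t ^ n"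
    using t by (intro divide_right_mono) auto
  also have "\<dots> = c * \<kappa> ^ n / a ^ n" using t by (simp add: power_mult_distrib)
  finally show ?thesis .
qed

text \<open>A union of two half-planes that both contain the far negative real axis.\<close>

lemma connected_D_region:
  assumes "0 < k"
  shows "connected (region k r r)"
proof -
  have eq: "region k r r = {\<tau>. inner (Complex (-1) k) \<tau> > r} \<union> {\<tau>. inner (Complex (-1) (-k)) \<tau> > r}"
    (is "_ = ?P \<union> ?Q")
  proof -
    have "\<tau> \<in> region k r r \<longleftrightarrow> r < slant k \<tau>" for \<tau>
      using slant_mono[of k \<tau>] assms by (auto simp: region_def)
    moreover have "r < slant k \<tau> \<longleftrightarrow> r < - Re \<tau> + k * Im \<tau> \<or> r < - Re \<tau> - k * Im \<tau>" for \<tau>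
    proof -
      have "k * \<bar>Im \<tau>\<bar> = \<bar>k * Im \<tau>\<bar>" using assms by (simp add: abs_mult)
      then show ?thesis unfolding slant_def by linarith
    qed
    ultimately show ?thesis by (auto simp: inner_complex_def)
  qed
  have "of_real (- r - 1) \<in> ?P \<inter> ?Q" by (simp add: inner_complex_def)
  then have "?P \<inter> ?Q \<noteq> {}" by blast
  moreover have "connected ?P" "connected ?Q"
    by (intro convex_connected convex_halfspace_gt)+
  ultimately show ?thesis unfolding eq by (intro connected_Un)
qed

section \<open>From the formal to the analytic separatrix\<close>

text \<open>The data of a formal separatrix after the Hamiltonian field has been split. The bound \<open>B\<close> is
  made from the leading coefficients only, so that the Lipschitz constant \<open>C\<close>, and with it the
  starting order \<open>M0\<close>, can be fixed before any truncation order is chosen. The factor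
  (2k+1)^2 converts powers of |\<tau>| into powers of the weight.\<close>

locale formal_solution =
  fixes h k \<sigma> b0 B C a0 E :: real and M0 :: nat
    and g :: "complex^4 \<Rightarrow> complex^4" and d cc :: "4 \<Rightarrow> nat^4 \<Rightarrow> complex"
    and G :: "complex \<Rightarrow> (complex fps)^4"
  assumes k: "k > 0" and \<sigma>: "\<sigma> > 0"
    and g_series: "\<And>i. pseries_on (d i) \<sigma> (\<lambda>z. g z $ i)"
    and f_series: "\<And>i. pseries_on (cc i) \<sigma> (\<lambda>z. (Jrot z + g z) $ i)"
    and formal_eq: "\<And>\<phi> i. formal_D (\<lambda>\<psi>. G \<psi> $ i) \<phi> = formal_subst (cc i) (G \<phi>)"
    and coeff_trig: "\<And>i n. trig_poly (\<lambda>\<phi>. fps_nth (G \<phi> $ i) n)"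
    and low: "\<And>\<phi> i n. n < weight i \<Longrightarrow> fps_nth (G \<phi> $ i) n = 0"
    and lip: "weighted_lipschitz g B C a0"
    and a0: "a0 \<ge> 1" "B / a0 < \<sigma>" and C: "C \<ge> 0"
    and b0: "b0 \<ge> 0" "\<And>N. N \<ge> 2 \<Longrightarrow> \<exists>R\<ge>1. \<forall>\<phi>\<in>strip h. \<forall>\<tau> i. norm \<tau> \<ge> R \<longrightarrow>
      norm (truncation N G \<phi> \<tau> $ i) \<le> b0 / norm \<tau> ^ weight i"
    and B: "B = b0 * (2 * k + 1)\<^sup>2 + 1"
    and E: "E \<ge> 1" "\<And>\<phi>. \<phi> \<in> strip h \<Longrightarrow> norm (cos \<phi>) \<le> E" "\<And>\<phi>. \<phi> \<in> strip h \<Longrightarrow> norm (sin \<phi>) \<le> E"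
    and M0: "M0 \<ge> 1" "8 * E\<^sup>2 * C \<le> real M0"
begin

abbreviation a :: "complex \<Rightarrow> real" where "a \<equiv> slant (2 * k)"

abbreviation \<kappa> :: real where "\<kappa> \<equiv> 2 * k + 1"

definition solution_on :: "real \<Rightarrow> real \<Rightarrow> (complex \<Rightarrow> complex \<Rightarrow> complex^4) \<Rightarrow> bool" where
  "solution_on r \<rho> w \<longleftrightarrow> vec_holo (strip h) (region k r \<rho>) w \<and>
    (\<forall>\<phi>\<in>strip h. \<forall>\<tau>\<in>region k r \<rho>. transport_vec w \<phi> \<tau> = Jrot (w \<phi> \<tau>) + g (w \<phi> \<tau>)) \<and>
    (\<forall>\<phi>\<in>strip h. \<forall>\<tau>\<in>region k r \<rho>. \<forall>i. norm (w \<phi> \<tau> $ i) \<le> B / a \<tau> ^ weight i)"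

text \<open>Three more terms than the order \<open>M\<close> are kept: the residual of the truncation is then
  O(a^(-M-4)), as \<open>solution_exists\<close> requires for weights up to 2.\<close>

definition near_truncation :: "nat \<Rightarrow> real \<Rightarrow> real \<Rightarrow> (complex \<Rightarrow> complex \<Rightarrow> complex^4) \<Rightarrow> bool" where
  "near_truncation M r \<rho> w \<longleftrightarrow> (\<exists>K\<ge>0. \<forall>\<phi>\<in>strip h. \<forall>\<tau>\<in>region k r \<rho>. \<forall>i.
     norm (w \<phi> \<tau> $ i - truncation (M + 3) G \<phi> \<tau> $ i) \<le> K / a \<tau> ^ (M + weight i))"

lemma B_ge_1: "B \<ge> 1" using b0 by (simp add: B)

lemma coeff_bounded: "\<exists>b. \<forall>\<phi>\<in>strip h. norm (fps_nth (G \<phi> $ i) n) \<le> b"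
  by (rule trig_poly_bounded_strip[OF coeff_trig])

lemma coeff_holomorphic: "(\<lambda>\<phi>. fps_nth (G \<phi> $ i) n) holomorphic_on S"
  by (rule trig_poly_holomorphic[OF coeff_trig])

lemma region_large:
  assumes "\<tau> \<in> region k r \<rho>" "\<kappa> * R \<le> \<rho>" "0 < \<rho>"
  shows "R \<le> norm \<tau>" "0 < a \<tau>" "a \<tau> \<le> \<kappa> * norm \<tau>" "\<rho> < a \<tau>"
proof -
  show "\<rho> < a \<tau>" using assms by (simp add: region_def)
  then show "0 < a \<tau>" using assms by simp
  show l: "a \<tau> \<le> \<kappa> * norm \<tau>" using slant_le_norm[of k \<tau>] k by simp
  have "\<kappa> * R \<le> \<kappa> * norm \<tau>" using l \<open>\<rho> < a \<tau>\<close> assms by linarith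
  then show "R \<le> norm \<tau>" using k by (simp add: mult_le_cancel_left_pos)
qed

lemma contraction_domain_region:
  assumes \<rho>: "\<rho> \<ge> a0" and M: "M0 \<le> M"
  shows "contraction_domain (strip h) (region k r \<rho>) (slant (2 * k)) \<rho> g d \<sigma> B C E M"
proof -
  have pos: "0 < \<rho>" "0 \<le> k" using \<rho> a0 k by auto
  interpret translation_domain "strip h" "region k r \<rho>" a \<rho>
    by (rule translation_domain_region[OF pos])
  show ?thesis
  proof
    have "B / \<rho> \<le> B / a0" using B_ge_1 a0 \<rho> pos by (intro divide_left_mono) auto
    then show "B / \<rho> < \<sigma>" using a0 by simp
    show "weighted_lipschitz g B C \<rho>" by (rule weighted_lipschitz_mono[OF lip \<rho>])
    show "M \<ge> 1" "8 * E\<^sup>2 * C \<le> real M" using M M0 by auto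
    show "\<rho> \<ge> 1" using \<rho> a0 by simp
  qed (fact g_series E C B_ge_1)+
qed

lemma truncation_scaled_bound:
  assumes "N \<ge> 2"
  obtains R where "R \<ge> 1" "\<And>\<phi> \<tau> i. \<phi> \<in> strip h \<Longrightarrow> R \<le> norm \<tau> \<Longrightarrow> 0 < a \<tau> \<Longrightarrow>
    norm (truncation N G \<phi> \<tau> $ i) \<le> (B - 1) / a \<tau> ^ weight i"
proof -
  obtain R where R: "R \<ge> 1" and lead: "\<And>\<phi> \<tau> i. \<phi> \<in> strip h \<Longrightarrow> norm \<tau> \<ge> R \<Longrightarrow>
      norm (truncation N G \<phi> \<tau> $ i) \<le> b0 / norm \<tau> ^ weight i"
    using b0(2)[OF assms] by auto
  have "norm (truncation N G \<phi> \<tau> $ i) \<le> (B - 1) / a \<tau> ^ weight i"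
    if "\<phi> \<in> strip h" "R \<le> norm \<tau>" "0 < a \<tau>" for \<phi> \<tau> i
  proof -
    have le: "a \<tau> \<le> \<kappa> * norm \<tau>" using slant_le_norm[of k \<tau>] k by simp
    have "norm (truncation N G \<phi> \<tau> $ i) \<le> b0 / norm \<tau> ^ weight i" by (rule lead[OF that(1,2)])
    also have "\<dots> \<le> b0 * \<kappa> ^ weight i / a \<tau> ^ weight i"
      by (rule power_ratio_bound[OF that(3) le]) (use b0 k in auto)
    also have "\<dots> \<le> (B - 1) / a \<tau> ^ weight i"
    proof (intro divide_right_mono)
      have "\<kappa> ^ weight i \<le> \<kappa>\<^sup>2" using k by (intro power_increasing) (auto simp: weight_def)
      then show "b0 * \<kappa> ^ weight i \<le> B - 1" using b0 by (simp add: B mult_left_mono)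
    qed (use that(3) in auto)
    finally show ?thesis .
  qed
  with R that show ?thesis by blast
qed

lemma solution_on_mono: "solution_on r \<rho> w \<Longrightarrow> \<rho> \<le> \<rho>' \<Longrightarrow> solution_on r \<rho>' w"
proof -
  assume s: "solution_on r \<rho> w" and le: "\<rho> \<le> \<rho>'"
  note sub = region_mono[OF le, of k r]
  have "vec_holo (strip h) (region k r \<rho>') w"
    using s sub unfolding solution_on_def vec_holo_def sep_holo_def
    by (meson holomorphic_on_subset subsetD)
  then show ?thesis using s sub unfolding solution_on_def by blast
qed

lemma near_truncation_mono: "near_truncation M r \<rho> w \<Longrightarrow> \<rho> \<le> \<rho>' \<Longrightarrow> near_truncation M r \<rho>' w"
  using region_mono[of \<rho> \<rho>' k r] unfolding near_truncation_def by blast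

lemma exists_near:
  assumes M: "M \<ge> M0"
  shows "\<exists>\<rho>0\<ge>1. \<forall>\<rho>\<ge>\<rho>0. \<forall>r. \<exists>w. solution_on r \<rho> w \<and> near_truncation M r \<rho> w \<and>
    (\<forall>\<phi>\<in>strip h. \<forall>\<tau>\<in>region k r \<rho>. w (\<phi> + 2 * of_real pi) \<tau> = w \<phi> \<tau>)"
proof -
  have M1: "M \<ge> 1" "8 * E\<^sup>2 * C \<le> real M" using M M0 by auto
  obtain K R where K: "K \<ge> 0" and R: "R \<ge> 1" and res: "\<And>\<phi> \<tau> i. \<phi> \<in> strip h \<Longrightarrow> norm \<tau> \<ge> R \<Longrightarrow>
    norm ((g (truncation (M + 3) G \<phi> \<tau>) + (Jrot (truncation (M + 3) G \<phi> \<tau>) - transport_vec (truncation (M + 3) G) \<phi> \<tau>)) $ i)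
      \<le> K / norm \<tau> ^ Suc (M + 3)"
  proof -
    have low0: "fps_nth (G \<phi> $ i) 0 = 0" for \<phi> i by (rule low) (simp add: weight_def)
    have "\<exists>K\<ge>0. \<exists>R\<ge>1. \<forall>\<phi>\<in>strip h. \<forall>\<tau> i. norm \<tau> \<ge> R \<longrightarrow>
      norm ((g (truncation (M + 3) G \<phi> \<tau>) + (Jrot (truncation (M + 3) G \<phi> \<tau>) - transport_vec (truncation (M + 3) G) \<phi> \<tau>)) $ i)
      \<le> K / norm \<tau> ^ Suc (M + 3)"
      by (rule truncation_residual[OF coeff_holomorphic coeff_bounded low0 f_series \<sigma> formal_eq])
    then show ?thesis using that by blast
  qed
  obtain R' where R': "R' \<ge> 1" "\<And>\<phi> \<tau> i. \<phi> \<in> strip h \<Longrightarrow> R' \<le> norm \<tau> \<Longrightarrow> 0 < a \<tau> \<Longrightarrow>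
      norm (truncation (M + 3) G \<phi> \<tau> $ i) \<le> (B - 1) / a \<tau> ^ weight i"
    by (rule truncation_scaled_bound[of "M + 3"]) auto
  define K' where "K' = K * \<kappa> ^ Suc (M + 3)"
  have K': "K' \<ge> 0" using K k by (simp add: K'_def)
  \<comment> \<open>Far enough out for the Lipschitz bound, for both estimates of the truncation, for the fixed-point ball to be small, and for the residual to use at most half of it.\<close>
  define \<rho>0 where "\<rho>0 = Max {a0, \<kappa> * R, \<kappa> * R', 2 * E, 4 * E * K'}"
  have \<rho>0: "a0 \<le> \<rho>0" "\<kappa> * R \<le> \<rho>0" "\<kappa> * R' \<le> \<rho>0" "2 * E \<le> \<rho>0" "4 * E * K' \<le> \<rho>0"
    by (auto simp: \<rho>0_def)
  have "\<exists>w. solution_on r \<rho> w \<and> near_truncation M r \<rho> w \<and>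
    (\<forall>\<phi>\<in>strip h. \<forall>\<tau>\<in>region k r \<rho>. w (\<phi> + 2 * of_real pi) \<tau> = w \<phi> \<tau>)" if \<rho>: "\<rho> \<ge> \<rho>0" for \<rho> r
  proof -
    have \<rho>1: "\<rho> \<ge> 1" using \<rho> \<rho>0(1) a0 by simp
    have lt: "0 < \<rho>" using \<rho>1 by simp
    have \<rho>a: "\<rho> \<ge> a0" using \<rho> \<rho>0(1) by simp
    interpret dom: contraction_domain "strip h" "region k r \<rho>" a \<rho> g d \<sigma> B C E M
      by (rule contraction_domain_region[OF \<rho>a M])
    have tb: "norm (truncation (M + 3) G \<phi> \<tau> $ i) \<le> (B - 1) / a \<tau> ^ weight i"
      if "\<phi> \<in> strip h" "\<tau> \<in> region k r \<rho>" for \<phi> \<tau> i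
    proof -
      have big: "\<kappa> * R' \<le> \<rho>" using \<rho> \<rho>0 by simp
      note L = region_large[OF that(2) big lt]
      show ?thesis by (rule R'(2)[OF that(1) L(1,2)])
    qed
    have rb: "norm ((g (truncation (M + 3) G \<phi> \<tau>) + (Jrot (truncation (M + 3) G \<phi> \<tau>) - transport_vec (truncation (M + 3) G) \<phi> \<tau>)) $ i)
        \<le> K' / a \<tau> ^ (M + weight i + 2)"
      if "\<phi> \<in> strip h" "\<tau> \<in> region k r \<rho>" for \<phi> \<tau> i
    proof -
      have big: "\<kappa> * R \<le> \<rho>" using \<rho> \<rho>0 by simp
      note L = region_large[OF that(2) big lt]
      note res[OF that(1) L(1), of i]
      also have "K / norm \<tau> ^ Suc (M + 3) \<le> K * \<kappa> ^ Suc (M + 3) / a \<tau> ^ Suc (M + 3)"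
        by (rule power_ratio_bound[OF L(2,3) K]) (use k in auto)
      also have "\<dots> \<le> K' / a \<tau> ^ (M + weight i + 2)"
        unfolding K'_def[symmetric]
      proof (intro divide_left_mono power_increasing)
        show "M + weight i + 2 \<le> Suc (M + 3)" by (simp add: weight_def)
        show "1 \<le> a \<tau>" using L(4) \<rho>1 by simp
      qed (use K' L in auto)
      finally show ?thesis .
    qed
    have P: "vec_holo (strip h) (region k r \<rho>) (truncation (M + 3) G)"
      by (rule vec_holo_truncation[OF coeff_holomorphic]) (use dom.a_pos[of 0] in \<open>auto simp: slant_def\<close>)
    have BE: "2 * E \<le> \<rho> ^ M"
    proof -
      have "2 * E \<le> \<rho> ^ 1" using \<rho> \<rho>0 by simp
      also have "\<dots> \<le> \<rho> ^ M" using \<rho>1 M1 by (intro power_increasing) auto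
      finally show ?thesis .
    qed
    have per: "truncation (M + 3) G (\<phi> + 2 * of_real pi) \<tau> = truncation (M + 3) G \<phi> \<tau>" for \<phi> \<tau>
      using trig_poly_periodic[OF coeff_trig] by (simp add: truncation_def)
    have perc: "cos (\<phi> + 2 * of_real pi) = cos \<phi>" "sin (\<phi> + 2 * of_real pi) = sin \<phi>" for \<phi> :: complex
    proof -
      have e: "2 * of_real pi = (of_real (2 * pi) :: complex)" by simp
      have "cos (of_real (2 * pi) :: complex) = 1" "sin (of_real (2 * pi) :: complex) = 0"
        unfolding cos_of_real sin_of_real by simp_all
      then show "cos (\<phi> + 2 * of_real pi) = cos \<phi>" "sin (\<phi> + 2 * of_real pi) = sin \<phi>"
        unfolding e cos_add sin_add by simp_all
    qed
    have "\<exists>w. vec_holo (strip h) (region k r \<rho>) w \<and> (\<forall>\<phi>\<in>strip h. \<forall>\<tau>\<in>region k r \<rho>. transport_vec w \<phi> \<tau> = Jrot (w \<phi> \<tau>) + g (w \<phi> \<tau>)) \<and>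
    (\<forall>\<phi>\<in>strip h. \<forall>\<tau>\<in>region k r \<rho>. \<forall>i. norm (w \<phi> \<tau> $ i - truncation (M + 3) G \<phi> \<tau> $ i) \<le> 2 * E / a \<tau> ^ (M + weight i)) \<and>
    (\<forall>\<phi>\<in>strip h. \<forall>\<tau>\<in>region k r \<rho>. \<forall>i. norm (w \<phi> \<tau> $ i) \<le> B / a \<tau> ^ weight i) \<and>
    (\<forall>\<phi>\<in>strip h. \<forall>\<tau>\<in>region k r \<rho>. w (\<phi> + 2 * of_real pi) \<tau> = w \<phi> \<tau>)"
    proof (rule dom.solution_exists[OF BE P tb rb K' _ per _ perc])
      show "4 * E * K' \<le> \<rho>" using \<rho> \<rho>0 by simp
      show "\<phi> + 2 * of_real pi \<in> strip h" if "\<phi> \<in> strip h" for \<phi> using that by (simp add: strip_def)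
    qed
    then obtain w where w: "vec_holo (strip h) (region k r \<rho>) w"
      "\<forall>\<phi>\<in>strip h. \<forall>\<tau>\<in>region k r \<rho>. transport_vec w \<phi> \<tau> = Jrot (w \<phi> \<tau>) + g (w \<phi> \<tau>)"
      "\<forall>\<phi>\<in>strip h. \<forall>\<tau>\<in>region k r \<rho>. \<forall>i. norm (w \<phi> \<tau> $ i - truncation (M + 3) G \<phi> \<tau> $ i) \<le> 2 * E / a \<tau> ^ (M + weight i)"
      "\<forall>\<phi>\<in>strip h. \<forall>\<tau>\<in>region k r \<rho>. \<forall>i. norm (w \<phi> \<tau> $ i) \<le> B / a \<tau> ^ weight i"
      "\<forall>\<phi>\<in>strip h. \<forall>\<tau>\<in>region k r \<rho>. w (\<phi> + 2 * of_real pi) \<tau> = w \<phi> \<tau>"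
      by (elim exE conjE)
    have "2 * E \<ge> 0" using E by simp
    then have "near_truncation M r \<rho> w" unfolding near_truncation_def using w(3) by (intro exI[of _ "2 * E"] conjI)
    moreover have "solution_on r \<rho> w" unfolding solution_on_def by (intro conjI w(1,2,4))
    ultimately show ?thesis using w(5) by (intro exI[of _ w] conjI)
  qed
  moreover have "\<rho>0 \<ge> 1" using \<rho>0 a0 by simp
  ultimately show ?thesis by blast
qed

lemma unique_near:
  assumes w: "solution_on r \<rho> w" "solution_on r \<rho> w'" and \<rho>: "\<rho> \<ge> a0"
    and n: "near_truncation M0 r \<rho> w" "near_truncation M0 r \<rho> w'" and \<phi>: "\<phi> \<in> strip h" and \<tau>: "\<tau> \<in> region k r \<rho>"
  shows "w \<phi> \<tau> = w' \<phi> \<tau>"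
proof -
  interpret dom: contraction_domain "strip h" "region k r \<rho>" a \<rho> g d \<sigma> B C E M0
    by (rule contraction_domain_region[OF \<rho> order_refl])
  obtain K where K: "K \<ge> 0" "\<And>\<phi> \<tau> i. \<phi> \<in> strip h \<Longrightarrow> \<tau> \<in> region k r \<rho> \<Longrightarrow>
     norm (w \<phi> \<tau> $ i - truncation (M0 + 3) G \<phi> \<tau> $ i) \<le> K / a \<tau> ^ (M0 + weight i)"
    using n(1) unfolding near_truncation_def by blast
  obtain K' where K': "K' \<ge> 0" "\<And>\<phi> \<tau> i. \<phi> \<in> strip h \<Longrightarrow> \<tau> \<in> region k r \<rho> \<Longrightarrow>
     norm (w' \<phi> \<tau> $ i - truncation (M0 + 3) G \<phi> \<tau> $ i) \<le> K' / a \<tau> ^ (M0 + weight i)"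
    using n(2) unfolding near_truncation_def by blast
  have close: "norm (w \<phi> \<tau> $ i - w' \<phi> \<tau> $ i) \<le> (K + K') / a \<tau> ^ (M0 + weight i)"
    if "\<phi> \<in> strip h" "\<tau> \<in> region k r \<rho>" for \<phi> \<tau> i
    using norm_triangle_ineq4[of "w \<phi> \<tau> $ i - truncation (M0 + 3) G \<phi> \<tau> $ i" "w' \<phi> \<tau> $ i - truncation (M0 + 3) G \<phi> \<tau> $ i"]
      K(2)[OF that, of i] K'(2)[OF that, of i] by (simp add: add_divide_distrib)
  show ?thesis
    by (rule dom.solution_unique[OF _ _ _ _ _ _ close _ \<phi> \<tau>])
      (use w K K' in \<open>auto simp: solution_on_def\<close>)
qed

text \<open>A solution that is close to a long truncation is close to the short one, because the two
  truncations differ by O(\<tau>^(-M_0-4)).\<close>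

lemma near_weaken:
  assumes n: "near_truncation M r \<rho> w" and M: "M0 \<le> M" and \<rho>: "\<kappa> \<le> \<rho>"
  shows "near_truncation M0 r \<rho> w"
proof -
  have \<rho>1: "1 \<le> \<rho>" "0 < \<rho>" using \<rho> k by auto
  obtain K where K: "K \<ge> 0" "\<And>\<phi> \<tau> i. \<phi> \<in> strip h \<Longrightarrow> \<tau> \<in> region k r \<rho> \<Longrightarrow>
     norm (w \<phi> \<tau> $ i - truncation (M + 3) G \<phi> \<tau> $ i) \<le> K / a \<tau> ^ (M + weight i)"
    using n unfolding near_truncation_def by blast
  obtain L where L: "L \<ge> 0" "\<And>\<phi> \<tau> i. \<phi> \<in> strip h \<Longrightarrow> norm \<tau> \<ge> 1 \<Longrightarrow>
    norm (truncation (M + 3) G \<phi> \<tau> $ i - truncation (M0 + 3) G \<phi> \<tau> $ i) \<le> L / norm \<tau> ^ Suc (M0 + 3)"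
    using truncation_diff_bound[OF coeff_bounded, of "M0 + 3" "M + 3"] M by auto
  define L' where "L' = L * \<kappa> ^ Suc (M0 + 3)"
  have L': "L' \<ge> 0" using L k by (simp add: L'_def)
  have "norm (w \<phi> \<tau> $ i - truncation (M0 + 3) G \<phi> \<tau> $ i) \<le> (K + L') / a \<tau> ^ (M0 + weight i)"
    if "\<phi> \<in> strip h" "\<tau> \<in> region k r \<rho>" for \<phi> \<tau> i
  proof -
    have big: "\<kappa> * 1 \<le> \<rho>" using \<rho> by simp
    note R = region_large[OF that(2) big \<rho>1(2)]
    have a1: "1 \<le> a \<tau>" using R(4) \<rho>1 by simp
    have 1: "K / a \<tau> ^ (M + weight i) \<le> K / a \<tau> ^ (M0 + weight i)"
      using K(1) a1 M R by (intro divide_left_mono power_increasing) auto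
    have "L / norm \<tau> ^ Suc (M0 + 3) \<le> L' / a \<tau> ^ Suc (M0 + 3)"
      unfolding L'_def by (rule power_ratio_bound[OF R(2,3) L(1)]) (use k in auto)
    also have "\<dots> \<le> L' / a \<tau> ^ (M0 + weight i)"
      using L' a1 R by (intro divide_left_mono power_increasing) (auto simp: weight_def)
    finally have 2: "L / norm \<tau> ^ Suc (M0 + 3) \<le> L' / a \<tau> ^ (M0 + weight i)" .
    have "norm (w \<phi> \<tau> $ i - truncation (M0 + 3) G \<phi> \<tau> $ i)
       \<le> norm (w \<phi> \<tau> $ i - truncation (M + 3) G \<phi> \<tau> $ i) + norm (truncation (M + 3) G \<phi> \<tau> $ i - truncation (M0 + 3) G \<phi> \<tau> $ i)"
      using norm_triangle_ineq[of "w \<phi> \<tau> $ i - truncation (M + 3) G \<phi> \<tau> $ i" "truncation (M + 3) G \<phi> \<tau> $ i - truncation (M0 + 3) G \<phi> \<tau> $ i"] by simp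
    also have "\<dots> \<le> K / a \<tau> ^ (M0 + weight i) + L' / a \<tau> ^ (M0 + weight i)"
      using K(2)[OF that, of i] L(2)[OF that(1) R(1), of i] 1 2 by linarith
    finally show ?thesis by (simp add: add_divide_distrib)
  qed
  then show ?thesis unfolding near_truncation_def using K(1) L' by (intro exI[of _ "K + L'"]) auto
qed

lemma region_of_large_norm:
  assumes "r \<ge> 0" "\<tau> \<in> region k r r" "(1 + 1 / k) * (\<rho> + 1) \<le> norm \<tau>"
  shows "\<tau> \<in> region k r \<rho>"
proof -
  have s: "r < slant k \<tau>" using assms by (simp add: region_def)
  then have "norm \<tau> \<le> (1 + 1 / k) * a \<tau>" using norm_le_slant[OF k, of \<tau>] assms by simp
  then have "(1 + 1 / k) * (\<rho> + 1) \<le> (1 + 1 / k) * a \<tau>" using assms by linarith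
  then have "\<rho> + 1 \<le> a \<tau>" using k by (simp add: mult_le_cancel_left_pos add_pos_pos)
  then show ?thesis using s by (simp add: region_def)
qed

text \<open>For every order there is a solution close to a sufficiently long truncation, though only far out.
  Uniqueness at order \<open>M0\<close> identifies it with the given solution.\<close>

lemma near_imp_asymptotic:
  assumes r: "r \<ge> 1" and w: "solution_on r r w" "near_truncation M0 r r w"
  shows "asymp_expansion h (region k r r) (\<lambda>\<phi> \<tau>. w \<phi> \<tau> $ i) (\<lambda>\<phi>. G \<phi> $ i)"
  unfolding asymp_expansion_def
proof
  fix N
  define M where "M = max M0 N"
  have "M0 \<le> M" by (simp add: M_def)
  from exists_near[OF this] obtain \<rho>0 where \<rho>0: "\<rho>0 \<ge> 1"
    and ex: "\<forall>\<rho>\<ge>\<rho>0. \<forall>r. \<exists>v. solution_on r \<rho> v \<and> near_truncation M r \<rho> v \<and>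
      (\<forall>\<phi>\<in>strip h. \<forall>\<tau>\<in>region k r \<rho>. v (\<phi> + 2 * of_real pi) \<tau> = v \<phi> \<tau>)"
    by (elim exE conjE)
  define \<rho> where "\<rho> = Max {\<rho>0, r, a0, \<kappa>}"
  have \<rho>: "\<rho>0 \<le> \<rho>" "r \<le> \<rho>" "a0 \<le> \<rho>" "\<kappa> \<le> \<rho>" by (auto simp: \<rho>_def)
  obtain v where v: "solution_on r \<rho> v" "near_truncation M r \<rho> v" using ex \<rho>(1) by blast
  have "near_truncation M0 r \<rho> v" using near_weaken[OF v(2) _ \<rho>(4)] by (simp add: M_def)
  then have eq: "w \<phi> \<tau> = v \<phi> \<tau>" if "\<phi> \<in> strip h" "\<tau> \<in> region k r \<rho>" for \<phi> \<tau>
    using unique_near[OF solution_on_mono[OF w(1) \<rho>(2)] v(1) \<rho>(3) near_truncation_mono[OF w(2) \<rho>(2)] _ that] by blast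
  obtain K where K: "K \<ge> 0" "\<And>\<phi> \<tau> i. \<phi> \<in> strip h \<Longrightarrow> \<tau> \<in> region k r \<rho> \<Longrightarrow>
     norm (v \<phi> \<tau> $ i - truncation (M + 3) G \<phi> \<tau> $ i) \<le> K / a \<tau> ^ (M + weight i)"
    using v(2) unfolding near_truncation_def by blast
  obtain L where L: "L \<ge> 0" "\<And>\<phi> \<tau> i. \<phi> \<in> strip h \<Longrightarrow> norm \<tau> \<ge> 1 \<Longrightarrow>
    norm (truncation (M + 3) G \<phi> \<tau> $ i - truncation N G \<phi> \<tau> $ i) \<le> L / norm \<tau> ^ Suc N"
  proof -
    have "N \<le> M + 3" by (simp add: M_def)
    from truncation_diff_bound[OF coeff_bounded this] show ?thesis using that by blast
  qed
  define lam where "lam = 1 + 1 / k"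
  have lam: "lam > 1" using k by (simp add: lam_def)
  define K' where "K' = K * lam ^ Suc N"
  have "norm (w \<phi> \<tau> $ i - (\<Sum>n\<le>N. fps_nth (G \<phi> $ i) n / \<tau> ^ n)) \<le> (K' + L) / norm \<tau> ^ (N + 1)"
    if \<phi>: "\<phi> \<in> strip h" and \<tau>: "\<tau> \<in> region k r r" and big: "lam * (\<rho> + 1) \<le> norm \<tau>" for \<phi> \<tau>
  proof -
    have r0: "r \<ge> 0" using r by simp
    have in': "\<tau> \<in> region k r \<rho>"
      using region_of_large_norm[OF r0 \<tau>, of \<rho>] big by (simp add: lam_def)
    have a1: "1 \<le> a \<tau>" using in' \<rho>(2) r by (simp add: region_def)
    have na: "norm \<tau> \<le> lam * a \<tau>"
      using norm_le_slant[OF k, of \<tau>] \<tau> r by (simp add: region_def lam_def)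
    have "1 * 1 \<le> lam * (\<rho> + 1)" using lam \<rho>(2) r by (intro mult_mono) auto
    then have n1: "1 \<le> norm \<tau>" using big by linarith
    have "norm (w \<phi> \<tau> $ i - truncation (M + 3) G \<phi> \<tau> $ i) \<le> K / a \<tau> ^ (M + weight i)"
      using K(2)[OF \<phi> in', of i] eq[OF \<phi> in'] by simp
    also have "\<dots> \<le> K / a \<tau> ^ Suc N"
    proof (intro divide_left_mono power_increasing)
      have "N \<le> M" by (simp add: M_def)
      then show "Suc N \<le> M + weight i" by (simp add: weight_def)
    qed (use a1 K in auto)
    also have "\<dots> \<le> K' / norm \<tau> ^ Suc N"
      unfolding K'_def by (rule power_ratio_bound[OF _ na K(1)]) (use n1 lam in auto)
    finally have 1: "norm (w \<phi> \<tau> $ i - truncation (M + 3) G \<phi> \<tau> $ i) \<le> K' / norm \<tau> ^ Suc N" .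
    have "norm (w \<phi> \<tau> $ i - truncation N G \<phi> \<tau> $ i) \<le> K' / norm \<tau> ^ Suc N + L / norm \<tau> ^ Suc N"
      using norm_triangle_le[OF add_mono[OF 1 L(2)[OF \<phi> n1, of i]]] by simp
    then show ?thesis by (simp add: truncation_def add_divide_distrib)
  qed
  then show "\<exists>C R. \<forall>\<phi>\<in>strip h. \<forall>\<tau>\<in>region k r r. norm \<tau> \<ge> R \<longrightarrow>
      norm (w \<phi> \<tau> $ i - (\<Sum>n\<le>N. fps_nth (G \<phi> $ i) n / \<tau> ^ n)) \<le> C / norm \<tau> ^ (N + 1)"
    by blast
qed

text \<open>Far out, any function with the right expansion satisfies the hypotheses of the uniqueness lemma.\<close>

lemma asymptotic_imp_near:
  assumes r: "r \<ge> 1"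
    and asy: "\<And>i. asymp_expansion h (region k r r) (\<lambda>\<phi> \<tau>. w \<phi> \<tau> $ i) (\<lambda>\<phi>. G \<phi> $ i)"
  shows "\<exists>\<rho>\<ge>r. near_truncation M0 r \<rho> w \<and>
    (\<forall>\<phi>\<in>strip h. \<forall>\<tau>\<in>region k r \<rho>. \<forall>i. norm (w \<phi> \<tau> $ i) \<le> B / a \<tau> ^ weight i)"
proof -
  have "\<forall>i. \<exists>C R. \<forall>\<phi>\<in>strip h. \<forall>\<tau>\<in>region k r r. norm \<tau> \<ge> R \<longrightarrow>
      norm (w \<phi> \<tau> $ i - truncation (M0 + 3) G \<phi> \<tau> $ i) \<le> C / norm \<tau> ^ (M0 + 4)"
  proof
    fix i
    obtain C R where "\<forall>\<phi>\<in>strip h. \<forall>\<tau>\<in>region k r r. norm \<tau> \<ge> R \<longrightarrow>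
      norm (w \<phi> \<tau> $ i - (\<Sum>n\<le>M0 + 3. fps_nth (G \<phi> $ i) n / \<tau> ^ n)) \<le> C / norm \<tau> ^ (M0 + 3 + 1)"
      using asy[of i] unfolding asymp_expansion_def by blast
    then show "\<exists>C R. \<forall>\<phi>\<in>strip h. \<forall>\<tau>\<in>region k r r. norm \<tau> \<ge> R \<longrightarrow>
      norm (w \<phi> \<tau> $ i - truncation (M0 + 3) G \<phi> \<tau> $ i) \<le> C / norm \<tau> ^ (M0 + 4)"
      by (intro exI[of _ C] exI[of _ R]) (simp add: truncation_def add.commute)
  qed
  then obtain C R where CR: "\<And>i \<phi> \<tau>. \<phi> \<in> strip h \<Longrightarrow> \<tau> \<in> region k r r \<Longrightarrow> norm \<tau> \<ge> R i \<Longrightarrow>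
      norm (w \<phi> \<tau> $ i - truncation (M0 + 3) G \<phi> \<tau> $ i) \<le> C i / norm \<tau> ^ (M0 + 4)"
    by metis
  obtain R' where R': "R' \<ge> 1" "\<And>\<phi> \<tau> i. \<phi> \<in> strip h \<Longrightarrow> R' \<le> norm \<tau> \<Longrightarrow> 0 < a \<tau> \<Longrightarrow>
      norm (truncation (M0 + 3) G \<phi> \<tau> $ i) \<le> (B - 1) / a \<tau> ^ weight i"
    by (rule truncation_scaled_bound[of "M0 + 3"]) auto
  define K where "K = (\<Sum>i\<in>UNIV. \<bar>C i\<bar>) * \<kappa> ^ (M0 + 4)"
  have K: "K \<ge> 0" unfolding K_def using k by (simp add: sum_nonneg)
  define \<rho> where "\<rho> = Max ({r, \<kappa> * R', K} \<union> (\<lambda>i. \<kappa> * R i) ` UNIV)"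
  have "x \<le> \<rho>" if "x \<in> {r, \<kappa> * R', K} \<union> (\<lambda>i. \<kappa> * R i) ` UNIV" for x
    unfolding \<rho>_def using that by (intro Max_ge) auto
  then have \<rho>: "r \<le> \<rho>" "\<kappa> * R' \<le> \<rho>" "K \<le> \<rho>" "\<kappa> * R i \<le> \<rho>" for i by blast+
  have \<rho>1: "1 \<le> \<rho>" "0 < \<rho>" using \<rho>(1) r by auto
  have close: "norm (w \<phi> \<tau> $ i - truncation (M0 + 3) G \<phi> \<tau> $ i) \<le> K / a \<tau> ^ (M0 + 4)"
    if "\<phi> \<in> strip h" "\<tau> \<in> region k r \<rho>" for \<phi> \<tau> i
  proof -
    note L = region_large[OF that(2) \<rho>(4)[of i] \<rho>1(2)]
    have inr: "\<tau> \<in> region k r r" using that(2) region_mono[OF \<rho>(1)] by blast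
    have "norm (w \<phi> \<tau> $ i - truncation (M0 + 3) G \<phi> \<tau> $ i) \<le> C i / norm \<tau> ^ (M0 + 4)"
      by (rule CR[OF that(1) inr L(1)])
    also have "\<dots> \<le> (\<Sum>i\<in>UNIV. \<bar>C i\<bar>) / norm \<tau> ^ (M0 + 4)"
      using member_le_sum[of i UNIV "\<lambda>i. \<bar>C i\<bar>"] by (intro divide_right_mono) auto
    also have "\<dots> \<le> K / a \<tau> ^ (M0 + 4)"
      unfolding K_def by (rule power_ratio_bound[OF L(2,3)]) (use k in \<open>auto intro: sum_nonneg\<close>)
    finally show ?thesis .
  qed
  have "near_truncation M0 r \<rho> w"
    unfolding near_truncation_def
  proof (intro exI[of _ K] conjI K ballI allI)
    fix \<phi> \<tau> i assume *: "\<phi> \<in> strip h" "\<tau> \<in> region k r \<rho>"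
    have a1: "1 \<le> a \<tau>" using * \<rho>1 by (simp add: region_def)
    have "K / a \<tau> ^ (M0 + 4) \<le> K / a \<tau> ^ (M0 + weight i)"
      using K a1 by (intro divide_left_mono power_increasing) (auto simp: weight_def)
    then show "norm (w \<phi> \<tau> $ i - truncation (M0 + 3) G \<phi> \<tau> $ i) \<le> K / a \<tau> ^ (M0 + weight i)"
      using close[OF *, of i] by linarith
  qed
  moreover have "norm (w \<phi> \<tau> $ i) \<le> B / a \<tau> ^ weight i"
    if "\<phi> \<in> strip h" "\<tau> \<in> region k r \<rho>" for \<phi> \<tau> i
  proof -
    note L = region_large[OF that(2) \<rho>(2) \<rho>1(2)]
    have a1: "1 \<le> a \<tau>" using L(4) \<rho>1 by simp
    have 1: "norm (truncation (M0 + 3) G \<phi> \<tau> $ i) \<le> (B - 1) / a \<tau> ^ weight i"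
      by (rule R'(2)[OF that(1) L(1,2)])
    have "K / a \<tau> ^ (M0 + 4) \<le> K / a \<tau> ^ Suc (weight i)"
      using K a1 by (intro divide_left_mono power_increasing) (auto simp: weight_def)
    also have "\<dots> = (K / a \<tau>) / a \<tau> ^ weight i" by simp
    also have "\<dots> \<le> 1 / a \<tau> ^ weight i"
    proof (intro divide_right_mono)
      show "K / a \<tau> \<le> 1" using \<rho>(3) L(4) L(2) by (simp add: pos_divide_le_eq)
    qed (use L in auto)
    finally have 2: "norm (w \<phi> \<tau> $ i - truncation (M0 + 3) G \<phi> \<tau> $ i) \<le> 1 / a \<tau> ^ weight i"
      using close[OF that, of i] by linarith
    have "norm (w \<phi> \<tau> $ i) \<le> (B - 1) / a \<tau> ^ weight i + 1 / a \<tau> ^ weight i"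
      using norm_triangle_le[OF add_mono[OF 1 2]] by simp
    then show ?thesis by (simp add: diff_divide_distrib)
  qed
  ultimately show ?thesis using \<rho>(1) by blast
qed

end

section \<open>Existence and uniqueness of the unstable separatrix\<close>

theorem theorem3p2:
  fixes \<eta> :: complex and F :: "complex^4 \<Rightarrow> complex" and U :: "(complex^4) set"
    and h \<theta> :: real and G :: "complex \<Rightarrow> (complex fps)^4"
  assumes "\<eta> \<noteq> 0"
    and "open U" and "0 \<in> U"
    and "analytic_several F U" and "bounded (F ` U)"
    and "\<forall>\<alpha>. taylor_coeff F 0 \<alpha> \<noteq> 0 \<longrightarrow> weighted_order \<alpha> \<ge> 5"
    and "h > 0" and "0 < \<theta>" and "\<theta> < pi / 4"
    and "formal_separatrix (hamiltonian \<eta> F) G"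
  shows "\<exists>r>0. \<exists>\<Gamma>.
           (analytic_solution h (D_minus \<theta> r) U (hamiltonian \<eta> F) \<Gamma> \<and>
            (\<forall>i. asymp_expansion h (D_minus \<theta> r) (\<lambda>\<phi> \<tau>. \<Gamma> \<phi> \<tau> $ i) (\<lambda>\<phi>. G \<phi> $ i))) \<and>
           (\<forall>\<Gamma>'.
              analytic_solution h (D_minus \<theta> r) U (hamiltonian \<eta> F) \<Gamma>' \<and>
              (\<forall>i. asymp_expansion h (D_minus \<theta> r) (\<lambda>\<phi> \<tau>. \<Gamma>' \<phi> \<tau> $ i) (\<lambda>\<phi>. G \<phi> $ i)) \<longrightarrow>
              (\<forall>\<phi>\<in>strip h. \<forall>\<tau>\<in>D_minus \<theta> r. \<Gamma>' \<phi> \<tau> = \<Gamma> \<phi> \<tau>))"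
proof -
  define k where "k = cot \<theta>"
  have \<theta>: "0 < \<theta>" "\<theta> < pi / 2" using assms(8,9) pi_gt_zero by linarith+
  have k: "k > 0" unfolding k_def by (rule cot_gt_zero[OF \<theta>])
  define H where "H = hamiltonian \<eta> F"
  obtain cF where cF: "has_power_series_at F 0 cF"
    using assms(3,4) unfolding analytic_several_def by blast
  obtain \<rho>F where \<rho>F: "\<rho>F > 0" "pseries_on cF \<rho>F F"
    using cF unfolding has_power_series_at_0_iff by blast
  have wF: "cF \<alpha> \<noteq> 0 \<Longrightarrow> weighted_order \<alpha> \<ge> 5" for \<alpha>
    using assms(6) unfolding taylor_coeff_eq[OF cF] by blast
  obtain e where e: "e > 0" "ball 0 e \<subseteq> U" using assms(2,3) openE by blast
  define \<sigma> where "\<sigma> = min \<rho>F (e / 4)"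
  have \<sigma>: "\<sigma> > 0" "\<sigma> \<le> \<rho>F" "\<sigma> \<le> e / 4" using \<rho>F e by (auto simp: \<sigma>_def)
  have inU: "z \<in> U" if "\<forall>i. norm (z $ i) < \<sigma>" for z :: "complex^4"
  proof -
    have "\<forall>i. norm (z $ i) < e / 4" using that \<sigma>(3) less_le_trans by blast
    then have "norm z < e" by (rule norm_less_if_components_less)
    then show ?thesis using e(2) by auto
  qed
  obtain c where c: "pseries_on c \<sigma> (nonlinear_part \<eta> F)" "\<And>\<alpha>. c \<alpha> \<noteq> 0 \<Longrightarrow> weighted_order \<alpha> \<ge> 4"
    using pseries_on_nonlinear_part[OF pseries_on_mono[OF \<rho>F(2) \<sigma>(2)] wF] by blast
  define g where "g = nonlinear_field (nonlinear_part \<eta> F)"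
  obtain d where d: "\<And>i. pseries_on (d i) \<sigma> (\<lambda>z. g z $ i)"
    "\<And>i \<alpha>. d i \<alpha> \<noteq> 0 \<Longrightarrow> Suc (weight i) \<le> weighted_order \<alpha>"
    using pseries_on_nonlinear_field[OF c] unfolding g_def by blast
  have field: "ham_field H z = Jrot z + g z" if "\<forall>i. norm (z $ i) < \<sigma>" for z
    unfolding H_def g_def by (rule ham_field_split[OF c(1) that])
  define cc where "cc i = taylor_coeff (\<lambda>z. ham_field H z $ i) 0" for i
  have f_series: "pseries_on (cc i) \<sigma> (\<lambda>z. (Jrot z + g z) $ i)" for i
    unfolding cc_def H_def g_def by (rule taylor_coeff_ham_field[OF c(1) \<sigma>(1) d(1)[unfolded g_def]])
  have formal_eq: "formal_D (\<lambda>\<psi>. G \<psi> $ i) \<phi> = formal_subst (cc i) (G \<phi>)" for i \<phi>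
    using assms(10) unfolding formal_separatrix_def cc_def H_def by blast
  obtain gg :: "complex \<Rightarrow> (complex fps)^4" where gg: "\<And>i. trig_series (\<lambda>\<phi>. gg \<phi> $ i)"
    "\<And>\<phi> i. G \<phi> $ i = fps_X ^ weight i * gg \<phi> $ i"
    using assms(10) unfolding formal_separatrix_def by blast
  have coeff: "fps_nth (G \<phi> $ i) n = (if n < weight i then 0 else fps_nth (gg \<phi> $ i) (n - weight i))" for \<phi> i n
    by (simp add: gg(2) fps_X_power_mult_nth)
  have low: "n < weight i \<Longrightarrow> fps_nth (G \<phi> $ i) n = 0" for \<phi> i n by (simp add: coeff)
  have trig: "trig_poly (\<lambda>\<phi>. fps_nth (G \<phi> $ i) n)" for i n
    using gg(1)[of i] trig_poly_0 unfolding coeff trig_series_def by (cases "n < weight i") auto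
  obtain b0 where b0: "b0 \<ge> 0" "\<And>N. N \<ge> 2 \<Longrightarrow> \<exists>R\<ge>1. \<forall>\<phi>\<in>strip h. \<forall>\<tau> i. norm \<tau> \<ge> R \<longrightarrow>
      norm (truncation N G \<phi> \<tau> $ i) \<le> b0 / norm \<tau> ^ weight i"
    using truncation_leading_bound[OF trig_poly_bounded_strip[OF trig] low, of h] by blast
  define B where "B = b0 * (2 * k + 1)\<^sup>2 + 1"
  have B0: "B \<ge> 0" using b0 by (simp add: B_def)
  obtain C a0 where C0: "C \<ge> 0" and a01: "a0 \<ge> 1" and Ba: "B / a0 < \<sigma>" and lip: "weighted_lipschitz g B C a0"
    using weighted_lipschitz_exists[OF d(1) \<sigma>(1) d(2) B0] by blast
  \<comment> \<open>Large enough for a contraction factor of at most 1/2 in the rotating frame, whose entries are bounded by exp h.\<close>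
  define M0 where "M0 = Suc (nat \<lceil>8 * (exp h)\<^sup>2 * C\<rceil>)"
  have M0: "M0 \<ge> 1" "8 * (exp h)\<^sup>2 * C \<le> real M0"
    unfolding M0_def by (simp, linarith)
  interpret S: formal_solution h k \<sigma> b0 B C a0 "exp h" M0 g d cc G
  proof
    show "exp h \<ge> 1" using assms(7) by simp
  qed (fact k \<sigma>(1) d(1) f_series formal_eq trig low lip a01 Ba C0 b0 B_def cos_sin_bounded_strip M0)+
  from S.exists_near[OF order_refl] obtain \<rho>0 where \<rho>0: "\<rho>0 \<ge> 1"
    and ex: "\<forall>\<rho>\<ge>\<rho>0. \<forall>r. \<exists>v. S.solution_on r \<rho> v \<and> S.near_truncation M0 r \<rho> v \<and>
      (\<forall>\<phi>\<in>strip h. \<forall>\<tau>\<in>region k r \<rho>. v (\<phi> + 2 * of_real pi) \<tau> = v \<phi> \<tau>)"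
    by (elim exE conjE)
  define r where "r = max \<rho>0 a0"
  have r: "r \<ge> 1" "r \<ge> \<rho>0" "r \<ge> a0" using \<rho>0 by (auto simp: r_def)
  obtain w where w: "S.solution_on r r w" "S.near_truncation M0 r r w"
    and per: "\<forall>\<phi>\<in>strip h. \<forall>\<tau>\<in>region k r r. w (\<phi> + 2 * of_real pi) \<tau> = w \<phi> \<tau>"
    using ex r(2) by blast
  have D: "D_minus \<theta> r = region k r r" unfolding k_def by (rule D_minus_eq_region[OF \<theta>])
  have small: "\<forall>i. norm (z $ i) < \<sigma>"
    if "a0 \<le> \<rho>" "\<tau> \<in> region k r \<rho>" "\<forall>i. norm (z $ i) \<le> B / slant (2 * k) \<tau> ^ weight i" for z :: "complex^4" and \<tau> \<rho>
  proof
    fix i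
    have a: "a0 \<le> slant (2 * k) \<tau>" using that(1,2) by (simp add: region_def)
    then have "a0 \<le> slant (2 * k) \<tau> ^ 1" by simp
    also have "\<dots> \<le> slant (2 * k) \<tau> ^ weight i"
      using a a01 by (intro power_increasing) (auto simp: weight_def)
    finally have "B / slant (2 * k) \<tau> ^ weight i \<le> B / a0"
      using B0 a01 by (intro divide_left_mono) auto
    then show "norm (z $ i) < \<sigma>" using that(3) Ba by (meson le_less_trans order_trans)
  qed
  have wb: "\<forall>i. norm (w \<phi> \<tau> $ i) \<le> B / slant (2 * k) \<tau> ^ weight i" if "\<phi> \<in> strip h" "\<tau> \<in> region k r r" for \<phi> \<tau>
    using w(1) that unfolding S.solution_on_def by blast
  have wh: "sep_holo (strip h) (region k r r) (\<lambda>\<phi> \<tau>. w \<phi> \<tau> $ i)" for i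
    using w(1) unfolding S.solution_on_def vec_holo_def by blast
  have weq: "transport_vec w \<phi> \<tau> = Jrot (w \<phi> \<tau>) + g (w \<phi> \<tau>)" if "\<phi> \<in> strip h" "\<tau> \<in> region k r r" for \<phi> \<tau>
    using w(1) that unfolding S.solution_on_def by blast
  have sol: "analytic_solution h (D_minus \<theta> r) U H w"
    unfolding analytic_solution_def D
  proof (intro conjI ballI allI)
    show "w (\<phi> + 2 * of_real pi) \<tau> = w \<phi> \<tau>" if "\<phi> \<in> strip h" "\<tau> \<in> region k r r" for \<phi> \<tau>
      using per that by blast
    show "analytic_several (\<lambda>x::complex^2. w (x$1) (x$2) $ i) {x. x$1 \<in> strip h \<and> x$2 \<in> region k r r}" for i
    proof (rule analytic_several_osgood[OF open_strip open_region wh])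
      show "norm (w \<phi> \<tau> $ i) \<le> \<sigma>" if "\<phi> \<in> strip h" "\<tau> \<in> region k r r" for \<phi> \<tau>
        using small[OF r(3) that(2) wb[OF that]] by (simp add: less_imp_le)
    qed
    fix \<phi> \<tau> assume *: "\<phi> \<in> strip h" "\<tau> \<in> region k r r"
    note sm = small[OF r(3) *(2) wb[OF *]]
    show "w \<phi> \<tau> \<in> U" by (rule inU[OF sm])
    show "deriv (\<lambda>\<psi>. w \<psi> \<tau> $ i) \<phi> + deriv (\<lambda>\<sigma>. w \<phi> \<sigma> $ i) \<tau> = ham_field H (w \<phi> \<tau>) $ i" for i
      using weq[OF *] unfolding field[OF sm] by (simp add: vec_eq_iff transport_vec_def transport_def)
  qed
  have asy: "asymp_expansion h (D_minus \<theta> r) (\<lambda>\<phi> \<tau>. w \<phi> \<tau> $ i) (\<lambda>\<phi>. G \<phi> $ i)" for i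
    unfolding D by (rule S.near_imp_asymptotic[OF r(1) w])
  have uniq: "w' \<phi> \<tau> = w \<phi> \<tau>"
    if solution_on': "analytic_solution h (D_minus \<theta> r) U H w'"
      and asy': "\<forall>i. asymp_expansion h (D_minus \<theta> r) (\<lambda>\<phi> \<tau>. w' \<phi> \<tau> $ i) (\<lambda>\<phi>. G \<phi> $ i)"
      and \<phi>: "\<phi> \<in> strip h" and \<tau>: "\<tau> \<in> D_minus \<theta> r" for w' \<phi> \<tau>
  proof -
    have wh': "sep_holo (strip h) (region k r r) (\<lambda>\<phi> \<tau>. w' \<phi> \<tau> $ i)" for i
      using solution_on' unfolding analytic_solution_def D
      by (intro analytic_several_sep_holo[OF _ open_strip open_region]) blast
    then have vh': "vec_holo (strip h) (region k r r) w'" by (simp add: vec_holo_def)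
    obtain \<rho>1 where \<rho>1: "\<rho>1 \<ge> r" "S.near_truncation M0 r \<rho>1 w'"
      "\<forall>\<phi>\<in>strip h. \<forall>\<tau>\<in>region k r \<rho>1. \<forall>i. norm (w' \<phi> \<tau> $ i) \<le> B / slant (2 * k) \<tau> ^ weight i"
      using S.asymptotic_imp_near[OF r(1)] asy' unfolding D by blast
    have a1: "a0 \<le> \<rho>1" using r(3) \<rho>1(1) by simp
    note sub = region_mono[OF \<rho>1(1), of k r]
    have "S.solution_on r \<rho>1 w'"
      unfolding S.solution_on_def
    proof (intro conjI ballI)
      show "vec_holo (strip h) (region k r \<rho>1) w'"
        using vh' sub unfolding vec_holo_def sep_holo_def by (meson holomorphic_on_subset subsetD)
      fix \<phi> \<tau> assume *: "\<phi> \<in> strip h" "\<tau> \<in> region k r \<rho>1"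
      have "\<forall>i. norm (w' \<phi> \<tau> $ i) < \<sigma>" using small[OF a1 *(2)] \<rho>1(3) * by blast
      from field[OF this] have "ham_field H (w' \<phi> \<tau>) = Jrot (w' \<phi> \<tau>) + g (w' \<phi> \<tau>)" .
      moreover have "transport_vec w' \<phi> \<tau> = ham_field H (w' \<phi> \<tau>)"
        using solution_on' * sub unfolding analytic_solution_def D
        by (auto simp: vec_eq_iff transport_vec_def transport_def)
      ultimately show "transport_vec w' \<phi> \<tau> = Jrot (w' \<phi> \<tau>) + g (w' \<phi> \<tau>)" by simp
      show "\<forall>i. norm (w' \<phi> \<tau> $ i) \<le> B / slant (2 * k) \<tau> ^ weight i" using \<rho>1(3) * by blast
    qed
    then have agree: "w' \<phi> \<tau> = w \<phi> \<tau>" if "\<tau> \<in> region k r \<rho>1" for \<tau>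
      using S.unique_near[OF _ S.solution_on_mono[OF w(1) \<rho>1(1)] a1 \<rho>1(2) S.near_truncation_mono[OF w(2) \<rho>1(1)] \<phi> that] by blast
    \<comment> \<open>The two solutions agree far out only; the identity theorem in \<tau> extends this to the whole domain.\<close>
    have "w' \<phi> \<tau> $ i - w \<phi> \<tau> $ i = 0" for i
    proof (rule analytic_continuation[where f = "\<lambda>\<tau>. w' \<phi> \<tau> $ i - w \<phi> \<tau> $ i" and S = "region k r r"
          and U = "region k r \<rho>1" and \<xi> = "of_real (- \<rho>1 - 1)"])
      show "(\<lambda>\<tau>. w' \<phi> \<tau> $ i - w \<phi> \<tau> $ i) holomorphic_on region k r r"
        using wh[of i] wh'[of i] \<phi> unfolding sep_holo_def by (auto intro!: holomorphic_on_diff)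
      show "connected (region k r r)" by (rule connected_D_region[OF k])
      have p: "complex_of_real (- \<rho>1 - 1) \<in> region k r \<rho>1"
        using \<rho>1(1) r(1) by (simp add: region_def slant_def)
      then show "complex_of_real (- \<rho>1 - 1) \<in> region k r r" using sub by blast
      show "complex_of_real (- \<rho>1 - 1) islimpt region k r \<rho>1"
        by (rule interior_limit_point) (use p in \<open>simp add: interior_open open_region\<close>)
      show "\<tau> \<in> region k r r" using \<tau> by (simp add: D)
      show "w' \<phi> z $ i - w \<phi> z $ i = 0" if "z \<in> region k r \<rho>1" for z using agree[OF that] by simp
    qed (use open_region sub in auto)
    then show ?thesis by (simp add: vec_eq_iff)
  qed
  show ?thesis
    unfolding H_def[symmetric]
  proof (intro exI[of _ r] exI[of _ w] conjI allI impI ballI)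
    show "r > 0" using r(1) by simp
    show "analytic_solution h (D_minus \<theta> r) U H w" by (rule sol)
    show "asymp_expansion h (D_minus \<theta> r) (\<lambda>\<phi> \<tau>. w \<phi> \<tau> $ i) (\<lambda>\<phi>. G \<phi> $ i)" for i by (rule asy)
  qed (use uniq in blast)
qed

end
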